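(* Let $\mathcal A$ be a commutative $W^*$-algebra, let $\mathcal H$ be a finitely or countably generated Hilbert $\mathcal A$-module, and let $\mathcal G$ be a unitary group on $\mathcal H$ such that $l^2_{\mathcal G}(\mathcal A)$ is self-dual. Suppose that $\eta\in\mathcal H$ is a complete Parseval frame vector for $\mathcal G$. Then for $\xi\in\mathcal H$: (1) $\xi$ is a complete Parseval frame vector for $\mathcal G$ if and only if there exists a unitary operator $A\in\mathcal G''$ such that $\xi=A\eta$. (2) $\xi$ is a complete frame vector for $\mathcal G$ if and only if there exists an invertible and adjointable operator $A\in\mathcal G''$ such that $\xi=A\eta$. (3) $\xi$ is a complete Bessel sequence vector for $\mathcal G$ if and only if there exists an adjointable operator $A\in\mathcal G''$ such that $\xi=A\eta$.
   Context: Hilbert $\mathcal A$-modules are left modules over a $C^*$-algebra $\mathcal A$ with an $\mathcal A$-valued inner product $\langle\cdot,\cdot\rangle$ that is $\mathcal A$-linear in the first variable and satisfies $\langle x,y\rangle=\langle y,x\rangle^*$; they are complete in the norm $\|x\|=\|\langle x,x\rangle\|^{1/2}$. $\mathcal H$ is finitely (resp. countably) generated if it has a finite (algebraic) generating set (resp. a countable set of generators). A $W^*$-algebra is a $C^*$-algebra that is a dual Banach space; it is unital. $End_{\mathcal A}(\mathcal H)$ denotes the bounded $\mathcal A$-linear operators on $\mathcal H$, and $End^*_{\mathcal A}(\mathcal H)$ the adjointable ones. A unitary group on $\mathcal H$ is a group $\mathcal G$ (under composition) of unitary operators in $End^*_{\mathcal A}(\mathcal H)$. For $\mathcal S\subseteq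 End_{\mathcal A}(\mathcal H)$ the commutant is $\mathcal S'=\{A\in End_{\mathcal A}(\mathcal H): AS=SA \text{ for all } S\in\mathcal S\}$, and $\mathcal S''=(\mathcal S')'$. $l^2_{\mathcal G}(\mathcal A)$ is the Hilbert $\mathcal A$-module of all families $\{a_U\}_{U\in\mathcal G}\subseteq\mathcal A$ such that $\sum_{U\in\mathcal G}a_Ua_U^*$ converges in norm, with inner product $\langle\{a_U\},\{b_U\}\rangle=\sum_U a_Ub_U^*$. A Hilbert $\mathcal A$-module $\mathcal K$ is self-dual if every bounded $\mathcal A$-linear map $\mathcal K\to\mathcal A$ has the form $x\mapsto\langle x,y\rangle$ for some $y\in\mathcal K$. A family $\{x_j\}_{j\in\mathbb J}$ in $\mathcal H$ ($\mathbb J$ finite or countable) is a (standard) frame for $\mathcal H$ if there are constants $C,D>0$ such that $C\langle x,x\rangle\le\sum_{j}\langle x,x_j\rangle\langle x_j,x\rangle\le D\langle x,x\rangle$ for all $x\in\mathcal H$, where the sum converges in norm. It is a Parseval frame if one can take $C=D=1$, and a Bessel sequence with bound $D$ if the sum converges in norm and the right-hand inequality holds for all $x\in\mathcal H$. A vector $\xi\in\mathcal H$ is a complete Parseval frame vector (resp. complete frame vector, complete Bessel sequence vector) for $\mathcal G$ if the family $\{U\xi\}_{U\in\mathcal G}$ is a Parseval frame (resp. a frame with some bounds, a Bessel sequence with some bound) for $\mathcal H$. *)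

theory Defs
  imports "HOL-Analysis.Analysis"
begin

class scaleC =
  fixes scaleC :: "complex \<Rightarrow> 'a \<Rightarrow> 'a"  (infixr "*\<^sub>C" 75)

class complex_banach = banach + scaleC +
  assumes scaleC_add_right: "c *\<^sub>C (x + y) = c *\<^sub>C x + c *\<^sub>C y"
    and scaleC_add_left: "(c + d) *\<^sub>C x = c *\<^sub>C x + d *\<^sub>C x"
    and scaleC_scaleC: "c *\<^sub>C (d *\<^sub>C x) = (c * d) *\<^sub>C x"
    and scaleR_scaleC: "r *\<^sub>R x = complex_of_real r *\<^sub>C x"
    and norm_scaleC: "norm (c *\<^sub>C x) = cmod c * norm x"

class cstar_algebra = complex_banach + real_normed_algebra +
  fixes star :: "'a \<Rightarrow> 'a"
  assumes mult_scaleC_left: "(c *\<^sub>C a) * b = c *\<^sub>C (a * b)"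
    and mult_scaleC_right: "a * (c *\<^sub>C b) = c *\<^sub>C (a * b)"
    and star_star: "star (star a) = a"
    and star_add: "star (a + b) = star a + star b"
    and star_scaleC: "star (c *\<^sub>C a) = cnj c *\<^sub>C star a"
    and star_mult: "star (a * b) = star b * star a"
    and cstar_identity: "norm (star a * a) = (norm a)\<^sup>2"

text \<open>The unit is not required to differ from \<open>0\<close>, so the zero algebra is included.\<close>

class comm_unital_cstar_algebra = cstar_algebra + comm_monoid_mult

definition cstar_le :: "'a::cstar_algebra \<Rightarrow> 'a \<Rightarrow> bool"
  where "cstar_le a b \<longleftrightarrow> (\<exists>c. b - a = star c * c)"

text \<open>The Banach space dual of \<open>'x\<close>, with the operator norm of the ambient type of
  bounded real-linear maps.\<close>

definition complex_dual :: "('x::complex_banach \<Rightarrow>\<^sub>L complex) set"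
  where "complex_dual = {f. \<forall>c x. blinfun_apply f (c *\<^sub>C x) = c * blinfun_apply f x}"

text \<open>\<open>'a\<close> is isometrically isomorphic to the dual of the Banach space \<open>'x\<close>. HOL has no
  quantification over types, so the predual is a type parameter; where this is a hypothesis
  and \<open>'x\<close> occurs nowhere else, it says that some predual exists.\<close>

definition is_dual_of :: "'a::complex_banach itself \<Rightarrow> 'x::complex_banach itself \<Rightarrow> bool"
  where "is_dual_of _ _ \<longleftrightarrow>
    (\<exists>\<Phi> :: 'a \<Rightarrow> ('x \<Rightarrow>\<^sub>L complex).
       bij_betw \<Phi> UNIV complex_dual \<and>
       (\<forall>a b. \<Phi> (a + b) = \<Phi> a + \<Phi> b) \<and>
       (\<forall>c a x. blinfun_apply (\<Phi> (c *\<^sub>C a)) x = c * blinfun_apply (\<Phi> a) x) \<and>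
       (\<forall>a. norm (\<Phi> a) = norm a))"

definition wstar_algebra ::
  "'a::comm_unital_cstar_algebra itself \<Rightarrow> 'x::complex_banach itself \<Rightarrow> bool"
  where "wstar_algebra A X \<longleftrightarrow> is_dual_of A X"

text \<open>The norm of \<open>'h\<close> is required to be the one induced by the inner product, and
  completeness is part of the class \<open>complex_banach\<close>.\<close>

locale hilbert_module =
  fixes act :: "'a::cstar_algebra \<Rightarrow> 'h::complex_banach \<Rightarrow> 'h"
    and ip :: "'h \<Rightarrow> 'h \<Rightarrow> 'a"
  assumes act_add_left: "act (a + b) x = act a x + act b x"
    and act_add_right: "act a (x + y) = act a x + act a y"
    and act_act: "act a (act b x) = act (a * b) x"
    and act_scaleC_left: "act (c *\<^sub>C a) x = c *\<^sub>C act a x"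
    and act_scaleC_right: "act a (c *\<^sub>C x) = c *\<^sub>C act a x"
    and ip_add_left: "ip (x + y) z = ip x z + ip y z"
    and ip_scaleC_left: "ip (c *\<^sub>C x) y = c *\<^sub>C ip x y"
    and ip_act_left: "ip (act a x) y = a * ip x y"
    and ip_star: "ip x y = star (ip y x)"
    and ip_nonneg: "cstar_le 0 (ip x x)"
    and ip_eq_0_iff: "ip x x = 0 \<longleftrightarrow> x = 0"
    and norm_ip: "norm x = sqrt (norm (ip x x))"

definition module_hull :: "('a \<Rightarrow> 'h::comm_monoid_add \<Rightarrow> 'h) \<Rightarrow> 'h set \<Rightarrow> 'h set"
  where "module_hull act S = {\<Sum>s\<in>F. act (c s) s | F c. finite F \<and> F \<subseteq> S}"

definition finitely_generated :: "('a \<Rightarrow> 'h::comm_monoid_add \<Rightarrow> 'h) \<Rightarrow> bool"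
  where "finitely_generated act \<longleftrightarrow> (\<exists>S. finite S \<and> module_hull act S = UNIV)"

text \<open>As usual for Hilbert modules, a countable set of generators is one whose algebraic
  hull is norm-dense.\<close>

definition countably_generated :: "('a \<Rightarrow> 'h::complex_banach \<Rightarrow> 'h) \<Rightarrow> bool"
  where "countably_generated act \<longleftrightarrow>
    (\<exists>S. countable S \<and> closure (module_hull act S) = UNIV)"

definition End_mod :: "('a \<Rightarrow> 'h::complex_banach \<Rightarrow> 'h) \<Rightarrow> ('h \<Rightarrow> 'h) set"
  where "End_mod act = {T. bounded_linear T \<and> (\<forall>a x. T (act a x) = act a (T x))}"

definition is_adjoint :: "('h \<Rightarrow> 'h \<Rightarrow> 'a) \<Rightarrow> ('h \<Rightarrow> 'h) \<Rightarrow> ('h \<Rightarrow> 'h) \<Rightarrow> bool"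
  where "is_adjoint ip T S \<longleftrightarrow> (\<forall>x y. ip (T x) y = ip x (S y))"

definition End_adj :: "('a \<Rightarrow> 'h::complex_banach \<Rightarrow> 'h) \<Rightarrow> ('h \<Rightarrow> 'h \<Rightarrow> 'a) \<Rightarrow> ('h \<Rightarrow> 'h) set"
  where "End_adj act ip = {T \<in> End_mod act. \<exists>S\<in>End_mod act. is_adjoint ip T S}"

definition unitary_op ::
  "('a \<Rightarrow> 'h::complex_banach \<Rightarrow> 'h) \<Rightarrow> ('h \<Rightarrow> 'h \<Rightarrow> 'a) \<Rightarrow> ('h \<Rightarrow> 'h) \<Rightarrow> bool"
  where "unitary_op act ip U \<longleftrightarrow> U \<in> End_mod act \<and>
    (\<exists>V\<in>End_mod act. is_adjoint ip U V \<and> U \<circ> V = id \<and> V \<circ> U = id)"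

definition invertible_op :: "('a \<Rightarrow> 'h::complex_banach \<Rightarrow> 'h) \<Rightarrow> ('h \<Rightarrow> 'h) \<Rightarrow> bool"
  where "invertible_op act T \<longleftrightarrow> T \<in> End_mod act \<and>
    (\<exists>R\<in>End_mod act. T \<circ> R = id \<and> R \<circ> T = id)"

definition commutant ::
  "('a \<Rightarrow> 'h::complex_banach \<Rightarrow> 'h) \<Rightarrow> ('h \<Rightarrow> 'h) set \<Rightarrow> ('h \<Rightarrow> 'h) set"
  where "commutant act \<S> = {A \<in> End_mod act. \<forall>S\<in>\<S>. A \<circ> S = S \<circ> A}"

definition unitary_group ::
  "('a \<Rightarrow> 'h::complex_banach \<Rightarrow> 'h) \<Rightarrow> ('h \<Rightarrow> 'h \<Rightarrow> 'a) \<Rightarrow> ('h \<Rightarrow> 'h) set \<Rightarrow> bool"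
  where "unitary_group act ip G \<longleftrightarrow>
    (\<forall>U\<in>G. unitary_op act ip U) \<and> id \<in> G \<and>
    (\<forall>U\<in>G. \<forall>V\<in>G. U \<circ> V \<in> G) \<and> (\<forall>U\<in>G. \<exists>V\<in>G. U \<circ> V = id \<and> V \<circ> U = id)"

text \<open>Families indexed by \<open>I\<close> are functions vanishing outside \<open>I\<close>. For sums of positive
  elements of a C*-algebra, norm convergence in some order and unconditional norm
  convergence (\<open>summable_on\<close>) coincide.\<close>

definition l2_carrier :: "'i set \<Rightarrow> ('i \<Rightarrow> 'a::cstar_algebra) set"
  where "l2_carrier I =
    {a. (\<forall>i. i \<notin> I \<longrightarrow> a i = 0) \<and> (\<lambda>i. a i * star (a i)) summable_on I}"

definition l2_ip :: "'i set \<Rightarrow> ('i \<Rightarrow> 'a::cstar_algebra) \<Rightarrow> ('i \<Rightarrow> 'a) \<Rightarrow> 'a"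
  where "l2_ip I a b = (\<Sum>\<^sub>\<infinity>i\<in>I. a i * star (b i))"

text \<open>Self-duality of a Hilbert module given by a carrier set, its addition, its scalar
  multiplication and its inner product.\<close>

definition self_dual ::
  "'k set \<Rightarrow> ('k \<Rightarrow> 'k \<Rightarrow> 'k) \<Rightarrow> ('a::cstar_algebra \<Rightarrow> 'k \<Rightarrow> 'k) \<Rightarrow> ('k \<Rightarrow> 'k \<Rightarrow> 'a) \<Rightarrow> bool"
  where "self_dual K add act ip \<longleftrightarrow>
    (\<forall>f :: 'k \<Rightarrow> 'a.
       (\<forall>x\<in>K. \<forall>y\<in>K. f (add x y) = f x + f y) \<and>
       (\<forall>a. \<forall>x\<in>K. f (act a x) = a * f x) \<and>
       (\<exists>B. \<forall>x\<in>K. norm (f x) \<le> B * sqrt (norm (ip x x)))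
       \<longrightarrow> (\<exists>y\<in>K. \<forall>x\<in>K. f x = ip x y))"

definition l2_self_dual :: "'a::cstar_algebra itself \<Rightarrow> 'i set \<Rightarrow> bool"
  where "l2_self_dual _ I \<longleftrightarrow>
    self_dual (l2_carrier I :: ('i \<Rightarrow> 'a) set)
      (\<lambda>a b i. a i + b i) (\<lambda>c a i. c * a i) (l2_ip I)"

definition bessel_with_bound ::
  "('h \<Rightarrow> 'h \<Rightarrow> 'a::cstar_algebra) \<Rightarrow> real \<Rightarrow> 'j set \<Rightarrow> ('j \<Rightarrow> 'h) \<Rightarrow> bool"
  where "bessel_with_bound ip D J f \<longleftrightarrow> countable J \<and>
    (\<forall>x. (\<lambda>j. ip x (f j) * ip (f j) x) summable_on J \<and>
         cstar_le (\<Sum>\<^sub>\<infinity>j\<in>J. ip x (f j) * ip (f j) x) (D *\<^sub>R ip x x))"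

definition frame_with_bounds ::
  "('h \<Rightarrow> 'h \<Rightarrow> 'a::cstar_algebra) \<Rightarrow> real \<Rightarrow> real \<Rightarrow> 'j set \<Rightarrow> ('j \<Rightarrow> 'h) \<Rightarrow> bool"
  where "frame_with_bounds ip C D J f \<longleftrightarrow> countable J \<and>
    (\<forall>x. (\<lambda>j. ip x (f j) * ip (f j) x) summable_on J \<and>
         cstar_le (C *\<^sub>R ip x x) (\<Sum>\<^sub>\<infinity>j\<in>J. ip x (f j) * ip (f j) x) \<and>
         cstar_le (\<Sum>\<^sub>\<infinity>j\<in>J. ip x (f j) * ip (f j) x) (D *\<^sub>R ip x x))"

definition complete_Parseval_frame_vector ::
  "('h \<Rightarrow> 'h \<Rightarrow> 'a::cstar_algebra) \<Rightarrow> ('h \<Rightarrow> 'h) set \<Rightarrow> 'h \<Rightarrow> bool"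
  where "complete_Parseval_frame_vector ip G \<xi> \<longleftrightarrow> frame_with_bounds ip 1 1 G (\<lambda>U. U \<xi>)"

definition complete_frame_vector ::
  "('h \<Rightarrow> 'h \<Rightarrow> 'a::cstar_algebra) \<Rightarrow> ('h \<Rightarrow> 'h) set \<Rightarrow> 'h \<Rightarrow> bool"
  where "complete_frame_vector ip G \<xi> \<longleftrightarrow>
    (\<exists>C>0. \<exists>D>0. frame_with_bounds ip C D G (\<lambda>U. U \<xi>))"

definition complete_Bessel_vector ::
  "('h \<Rightarrow> 'h \<Rightarrow> 'a::cstar_algebra) \<Rightarrow> ('h \<Rightarrow> 'h) set \<Rightarrow> 'h \<Rightarrow> bool"
  where "complete_Bessel_vector ip G \<xi> \<longleftrightarrow> (\<exists>D>0. bessel_with_bound ip D G (\<lambda>U. U \<xi>))"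

end

theory Submission
  imports Defs
begin

text \<open>Characters of the commutative algebra turn \<open>\<A>\<close>-valued inequalities into scalar ones. The
  analysis operators \<open>x \<mapsto> (\<langle>x, U\<xi>\<rangle>)\<^sub>U\<close> of \<open>\<eta>\<close> and of a Bessel vector \<open>\<xi>\<close> intertwine \<open>G\<close> with the
  left translations of \<open>l\<^sup>2(G)\<close>. Let \<open>N\<close> be the commutant of these translations and
  \<open>(Kc)\<^sub>U = (c\<^bsub>U\<^sup>-\<^sup>1\<^esub>)\<^sup>*\<close> the flip. Since \<open>K N K\<close> commutes with \<open>N\<close>, every \<open>w \<in> N\<close> with
  \<open>w \<theta>\<^sub>\<eta> = \<theta>\<^sub>\<xi>\<close> yields \<open>A = \<theta>\<^sub>\<eta>\<^sup>* K w K \<theta>\<^sub>\<eta> \<in> G''\<close> with \<open>A \<eta> = \<xi>\<close>, and \<open>A\<close> is unitary or invertible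
  if \<open>w\<close> is; self-duality makes all operators in \<open>G'\<close> adjointable.
  For a Bessel vector take \<open>w = \<theta>\<^sub>\<xi> \<theta>\<^sub>\<eta>\<^sup>*\<close>. For a Parseval vector take an extreme point \<open>w\<close> of the
  weakly compact convex set of contractions in \<open>N\<close> that map \<open>\<theta>\<^sub>\<eta>\<close> to \<open>\<theta>\<^sub>\<xi>\<close>: it is a maximal partial
  isometry, hence unitary because \<open>N\<close> has a faithful trace. A frame vector is reduced to a
  Parseval vector by the square root of its frame operator.
  Conversely, if \<open>\<xi> = A \<eta>\<close> with \<open>A \<in> G''\<close> and \<open>x\<close> is a Bessel vector with frame operator \<open>S\<^sub>x \<in> G'\<close>,
  then \<open>\<Sum>\<^sub>U \<langle>x, U\<xi>\<rangle>\<langle>U\<xi>, x\<rangle> = \<langle>S\<^sub>x A \<eta>, A \<eta>\<rangle>\<close> is comparable to \<open>\<langle>S\<^sub>x \<eta>, \<eta>\<rangle> = \<langle>x, x\<rangle>\<close>, and Bessel vectors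
  are dense.\<close>

section \<open>Commutative C*-algebras and their characters\<close>

text \<open>The flip is forced by the orbits: \<open>K\<close> interchanges the families
  \<open>\<theta> \<xi> x\<close> and \<open>\<theta> x \<xi>\<close>. Hence \<open>K w K\<close>
  maps \<open>\<theta> \<eta> \<eta>\<close> to
  \<open>K (\<theta> \<xi> \<eta>) = \<theta> \<eta> \<xi>\<close>, from which the synthesis
  operator of \<open>\<eta>\<close> returns \<open>\<xi>\<close>; without \<open>K\<close> one would
  be left with \<open>\<theta> \<xi> \<eta>\<close>. The obstacle is the Parseval case. The obvious
  \<open>w\<close> is only a partial isometry between the ranges of the two analysis operators, and
  a unitary \<open>w\<close> exists only if the complements match as well, which is a finiteness
  property of \<open>N\<close>. Comparison of projections is avoided: extremality shows that
  \<open>u\<close> is a partial isometry and that no element of \<open>N\<close> maps the initial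
  defect of \<open>u\<close> nontrivially into its final defect; the algebra-valued trace then makes
  both defects vanish. Compactness has a price: a weak limit of operators is at first only an
  algebra-valued form. It respects the module action because multiplication is weak-star continuous
  on bounded sets, and it comes from an operator because the standard module is self-dual.\<close>

lemma scaleC_one [simp]: "1 *\<^sub>C x = (x::'a::complex_banach)"
  using scaleR_scaleC[of 1 x] by simp

lemma scaleC_zero_left [simp]: "0 *\<^sub>C x = (0::'a::complex_banach)"
  using scaleR_scaleC[of 0 x] by simp

lemma scaleC_zero_right [simp]: "c *\<^sub>C 0 = (0::'a::complex_banach)"
  using scaleC_add_right[of c 0 "0::'a"] by simp

lemma scaleC_minus_right: "c *\<^sub>C (- x) = - (c *\<^sub>C (x::'a::complex_banach))"
  using scaleC_add_right[of c x "-x"] by (simp add: add_eq_0_iff2)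

lemma scaleC_diff_right: "c *\<^sub>C (x - y) = c *\<^sub>C x - c *\<^sub>C (y::'a::complex_banach)"
  using scaleC_add_right[of c x "-y"] by (simp add: scaleC_minus_right)

lemma scaleC_minus_left: "(- c) *\<^sub>C x = - (c *\<^sub>C (x::'a::complex_banach))"
  using scaleC_add_left[of c "-c" x] by (simp add: add_eq_0_iff)

lemma star_zero [simp]: "star (0::'a::cstar_algebra) = 0"
  using star_add[of 0 "0::'a"] by simp

lemma star_minus: "star (- a) = - star (a::'a::cstar_algebra)"
  using star_add[of a "-a"] by (simp add: add_eq_0_iff2)

lemma star_diff: "star (a - b) = star a - star (b::'a::cstar_algebra)"
  using star_add[of a "-b"] by (simp add: star_minus)

lemma star_scaleR: "star (r *\<^sub>R a) = r *\<^sub>R star (a::'a::cstar_algebra)"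
  by (simp add: scaleR_scaleC star_scaleC)

lemma star_one [simp]: "star (1::'a::comm_unital_cstar_algebra) = 1"
  by (metis mult_1 star_mult star_star)

lemma norm_star [simp]: "norm (star (a::'a::cstar_algebra)) = norm a"
proof -
  have *: "norm b \<le> norm (star b)" for b :: 'a
  proof (cases "b = 0")
    case False
    have "norm b * norm b \<le> norm (star b) * norm b"
      using norm_mult_ineq[of "star b" b] cstar_identity[of b] by (simp add: power2_eq_square)
    with False show ?thesis by simp
  qed simp
  show ?thesis using *[of a] *[of "star a"] by (simp add: star_star)
qed

lemma bounded_linear_star: "bounded_linear (star :: 'a::cstar_algebra \<Rightarrow> 'a)"
  by (rule bounded_linear_intro[of _ 1]) (simp_all add: star_add star_scaleR)

lemma norm_one_le: "norm (1::'a::comm_unital_cstar_algebra) \<le> 1"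
proof -
  have "norm (1::'a) * norm (1::'a) = norm (1::'a)"
    using cstar_identity[of "1::'a"] by (simp add: power2_eq_square)
  then show ?thesis by (metis mult_cancel_right2 norm_zero order_refl zero_le_one)
qed

lemma norm_scaleR_one_le: "norm (r *\<^sub>R (1::'a::comm_unital_cstar_algebra)) \<le> \<bar>r\<bar>"
  using mult_left_mono[OF norm_one_le, of "\<bar>r\<bar>"] by simp

lemma norm_add_scaleR_one_le:
  "norm (a + r *\<^sub>R (1::'a::comm_unital_cstar_algebra)) \<le> norm a + \<bar>r\<bar>"
  by (metis norm_scaleR_one_le norm_triangle_mono order_refl)

text \<open>For commuting self-adjoint \<open>a\<close>, \<open>b\<close> the C*-identity for \<open>a + \<i>b\<close> reads
  \<open>norm (a\<^sup>2 + b\<^sup>2) = (norm (a + \<i>b))\<^sup>2\<close>.\<close>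

lemma norm_square_le_sum_squares:
  fixes a b :: "'a::comm_unital_cstar_algebra"
  assumes "star a = a" "star b = b"
  shows "norm (a * a) \<le> norm (a * a + b * b)"
proof -
  define c where "c = a + \<i> *\<^sub>C b"
  have sc: "star c = a - \<i> *\<^sub>C b"
    by (simp add: c_def star_add star_scaleC assms scaleC_minus_left)
  have "star c * c = a * a + b * b"
    unfolding sc unfolding c_def by (simp add: algebra_simps mult_scaleC_left mult_scaleC_right
        scaleC_scaleC scaleC_minus_left)
  then have n: "norm (a * a + b * b) = (norm c)\<^sup>2" by (metis cstar_identity)
  have "2 *\<^sub>R a = c + star c" unfolding sc unfolding c_def by (simp add: scaleR_2)
  then have "2 * norm a = norm (c + star c)" by (metis norm_scaleR abs_numeral)
  then have "norm a \<le> norm c" using norm_triangle_ineq[of c "star c"] by simp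
  then have "(norm a)\<^sup>2 \<le> (norm c)\<^sup>2" by (simp add: power_mono)
  moreover have "norm (a * a) = (norm a)\<^sup>2" using cstar_identity[of a] assms by simp
  ultimately show ?thesis using n by simp
qed

section \<open>Square roots near the unit and the positive cone\<close>

text \<open>With \<open>1 - x = (1 - y)\<^sup>2\<close> rewritten as the fixed point equation below, square roots are
  obtained in Banach algebras without unit.\<close>

lemma square_root_fixed_point:
  fixes m :: "'b::banach \<Rightarrow> 'b \<Rightarrow> 'b"
  assumes m: "bounded_bilinear m" and mn: "\<And>y z. norm (m y z) \<le> norm y * norm z"
    and S: "closed S" "0 \<in> S" "\<And>y. y \<in> S \<Longrightarrow> (1/2) *\<^sub>R (x + m y y) \<in> S"
    and x: "norm x < 1"
  shows "\<exists>y\<in>S. norm y \<le> norm x \<and> y = (1/2) *\<^sub>R (x + m y y)"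
proof -
  interpret bounded_bilinear m by fact
  define r where "r = norm x"
  define f where "f y = (1/2) *\<^sub>R (x + m y y)" for y
  have r: "0 \<le> r" "r < 1" using x by (auto simp: r_def)
  have "\<exists>!y \<in> S \<inter> cball 0 r. f y = y"
  proof (rule Banach_fix[OF _ _ r])
    show "complete (S \<inter> cball 0 r)"
      using S(1) by (simp add: complete_eq_closed closed_Int)
    show "S \<inter> cball 0 r \<noteq> {}" using S(2) r by auto
    show "f ` (S \<inter> cball 0 r) \<subseteq> S \<inter> cball 0 r"
    proof (rule image_subsetI)
      fix y assume "y \<in> S \<inter> cball 0 r"
      then have y: "y \<in> S" "norm y \<le> r" by auto
      have "norm (x + m y y) \<le> r + r * r"
        using norm_triangle_ineq[of x "m y y"] mn[of y y]
          mult_mono[OF y(2) y(2) r(1) norm_ge_zero] by (simp add: r_def)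
      also have "\<dots> \<le> 2 * r" using r mult_left_mono[of r 1 r] by simp
      finally show "f y \<in> S \<inter> cball 0 r" using S(3)[OF y(1)] by (simp add: f_def)
    qed
    show "dist (f y) (f z) \<le> r * dist y z" if "y \<in> S \<inter> cball 0 r" "z \<in> S \<inter> cball 0 r" for y z
    proof -
      have yz: "norm y \<le> r" "norm z \<le> r" using that by auto
      have "f y - f z = (1/2) *\<^sub>R (m y (y - z) + m (y - z) z)"
        by (simp add: f_def diff_left diff_right algebra_simps)
      then have "norm (f y - f z) \<le> (1/2) * (norm (m y (y - z)) + norm (m (y - z) z))"
        using norm_triangle_ineq[of "m y (y-z)" "m (y-z) z"] by simp
      moreover have "norm (m y (y - z)) \<le> r * norm (y - z)"
        using mn[of y "y - z"] mult_right_mono[OF yz(1), of "norm (y - z)"] by simp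
      moreover have "norm (m (y - z) z) \<le> norm (y - z) * r"
        using mn[of "y - z" z] mult_left_mono[OF yz(2), of "norm (y - z)"] by simp
      ultimately show ?thesis by (simp add: dist_norm mult.commute)
    qed
  qed
  then obtain y where "y \<in> S" "norm y \<le> r" "f y = y" by auto
  then show ?thesis unfolding r_def f_def by metis
qed

text \<open>The equation \<open>y = (x + y y) / 2\<close> says that \<open>1 - y\<close> squares to
  \<open>1 - x\<close>. Self-adjointness is a closed condition preserved by the iteration, so it
  passes to the fixed point.\<close>

lemma self_adjoint_square_root:
  fixes x :: "'a::comm_unital_cstar_algebra"
  assumes "star x = x" "norm x < 1"
  shows "\<exists>y. star y = y \<and> norm y \<le> norm x \<and> (1 - y) * (1 - y) = 1 - x"
proof -
  have "closed {y::'a. star y = y}"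
    by (intro closed_Collect_eq continuous_on_id linear_continuous_on bounded_linear_star)
  then obtain y where y: "star y = y" "norm y \<le> norm x" "y = (1/2) *\<^sub>R (x + y * y)"
    using square_root_fixed_point[OF bounded_bilinear_mult norm_mult_ineq, of "{y. star y = y}" x]
      assms by (auto simp: star_scaleR star_add star_mult)
  from y(3) have "2 *\<^sub>R y = 2 *\<^sub>R ((1/2) *\<^sub>R (x + y * y))" by (rule arg_cong)
  then have "2 *\<^sub>R y = x + y * y" by simp
  then have "(1 - y) * (1 - y) = 1 - x" by (simp add: algebra_simps scaleR_2)
  with y show ?thesis by blast
qed

text \<open>For self-adjoint \<open>a\<close> the second condition says that the spectrum lies in
  \<open>[0, 2 t]\<close>; it expresses a nonnegative spectrum by the norm alone.\<close>

definition positive :: "'a::comm_unital_cstar_algebra \<Rightarrow> bool"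
  where "positive a \<longleftrightarrow> star a = a \<and> (\<exists>t. norm (t *\<^sub>R 1 - a) \<le> t)"

lemma norm_shift_mono:
  fixes a :: "'a::comm_unital_cstar_algebra"
  assumes "norm (t *\<^sub>R 1 - a) \<le> t" "t \<le> s"
  shows "norm (s *\<^sub>R 1 - a) \<le> s"
proof -
  have "s *\<^sub>R 1 - a = (t *\<^sub>R 1 - a) + (s - t) *\<^sub>R 1" by (simp add: algebra_simps)
  then have "norm (s *\<^sub>R 1 - a) \<le> norm (t *\<^sub>R 1 - a) + norm ((s - t) *\<^sub>R (1::'a))"
    by (metis norm_triangle_ineq)
  then show ?thesis using assms norm_scaleR_one_le[of "s - t", where 'a='a] by simp
qed

lemma positive_sa: "positive a \<Longrightarrow> star a = a"
  by (simp add: positive_def)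

lemma positive_add:
  assumes "positive a" "positive b" shows "positive (a + b)"
proof -
  obtain t s where "norm (t *\<^sub>R 1 - a) \<le> t" "norm (s *\<^sub>R 1 - b) \<le> s"
    using assms by (auto simp: positive_def)
  moreover have "(t + s) *\<^sub>R 1 - (a + b) = (t *\<^sub>R 1 - a) + (s *\<^sub>R 1 - b)" by (simp add: algebra_simps)
  ultimately have "norm ((t + s) *\<^sub>R 1 - (a + b)) \<le> t + s" by (metis norm_triangle_mono)
  then show ?thesis using assms by (auto simp: positive_def star_add)
qed

lemma positive_shift: "star a = a \<Longrightarrow> norm a \<le> t \<Longrightarrow> positive (t *\<^sub>R 1 + a)"
  unfolding positive_def by (auto simp: star_add star_scaleR intro!: exI[of _ t])

lemma positive_scaleR_one: "0 \<le> t \<Longrightarrow> positive (t *\<^sub>R 1)"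
  unfolding positive_def by (auto simp: star_scaleR intro!: exI[of _ t])

text \<open>For \<open>s < 1\<close> the element \<open>1 - s h h\<close> has a square root
  \<open>1 - y\<close>. The square of \<open>1 - y\<close> and \<open>s h h\<close> are two squares
  with sum \<open>1\<close>, so the first is at most \<open>1\<close> in norm. Letting
  \<open>s\<close> tend to \<open>1\<close> gives the claim.\<close>

lemma norm_one_minus_square:
  fixes h :: "'a::comm_unital_cstar_algebra"
  assumes h: "star h = h" "norm h \<le> 1"
  shows "norm (1 - h * h) \<le> 1"
proof (rule field_le_epsilon)
  fix e :: real assume e: "0 < e"
  define s where "s = max 0 (1 - e)"
  have s: "0 \<le> s" "s < 1" "1 - s \<le> e" using e by (auto simp: s_def)
  have hh: "norm (h * h) \<le> 1" using norm_mult_ineq[of h h] h(2) by (meson mult_le_one norm_ge_zero order_trans)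
  have "norm (s *\<^sub>R (h * h)) \<le> s" using hh s mult_left_mono[OF hh s(1)] by simp
  then obtain y where y: "star y = y" "(1 - y) * (1 - y) = 1 - s *\<^sub>R (h * h)"
    using self_adjoint_square_root[of "s *\<^sub>R (h * h)"] s h by (auto simp: star_scaleR star_mult)
  define k where "k = sqrt s *\<^sub>R h"
  have k: "star k = k" "k * k = s *\<^sub>R (h * h)" using s h by (simp_all add: k_def star_scaleR)
  have "norm ((1 - y) * (1 - y)) \<le> norm ((1 - y) * (1 - y) + k * k)"
    by (rule norm_square_le_sum_squares) (use y k in \<open>simp_all add: star_diff\<close>)
  also have "\<dots> \<le> 1" using y k norm_one_le[where 'a='a] by simp
  finally have "norm (1 - s *\<^sub>R (h * h)) \<le> 1" using y by simp
  moreover have eq: "1 - h * h = (1 - s *\<^sub>R (h * h)) - (1 - s) *\<^sub>R (h * h)" by (simp add: algebra_simps)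
  moreover have "norm ((1 - s) *\<^sub>R (h * h)) \<le> e"
    using s hh mult_mono[of "1-s" e "norm (h*h)" 1] by simp
  ultimately show "norm (1 - h * h) \<le> 1 + e"
    by (subst eq) (rule norm_triangle_le_diff, rule add_mono)
qed

lemma norm_shift_square:
  fixes h :: "'a::comm_unital_cstar_algebra"
  assumes h: "star h = h" and t: "norm (h * h) \<le> t"
  shows "norm (t *\<^sub>R 1 - h * h) \<le> t"
proof (cases "h = 0")
  case True
  then show ?thesis using t norm_scaleR_one_le[of t, where 'a='a] by simp
next
  case False
  have n: "norm (h * h) = (norm h)\<^sup>2" using cstar_identity[of h] h by simp
  then have t0: "0 < t" using t False by (smt (verit) zero_less_norm_iff zero_less_power)
  define k where "k = (1 / sqrt t) *\<^sub>R h"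
  have "norm h \<le> sqrt t" using t n by (simp add: real_le_rsqrt)
  then have "norm (1 - k * k) \<le> 1"
    using t0 h by (intro norm_one_minus_square) (auto simp: k_def star_scaleR divide_simps)
  moreover have "t *\<^sub>R 1 - h * h = t *\<^sub>R (1 - k * k)"
    using t0 by (simp add: k_def algebra_simps)
  ultimately show ?thesis using t0 by simp
qed

lemma positive_square: "star h = h \<Longrightarrow> positive (h * h)"
  unfolding positive_def using norm_shift_square[OF _ order_refl] by (auto simp: star_mult)

text \<open>The shift by \<open>e\<close> brings the element within reach of the fixed point
  iteration. Exact roots follow later as limits, once characters can compare the roots for different
  \<open>e\<close>.\<close>

lemma positive_approx_square:
  assumes "positive a" "0 < e"
  shows "\<exists>k. star k = k \<and> a + e *\<^sub>R 1 = k * k \<and> positive k"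
proof -
  obtain t where t: "norm (t *\<^sub>R 1 - a) \<le> t" and sa: "star a = a"
    using assms by (auto simp: positive_def)
  have t0: "0 \<le> t" using t norm_ge_zero order_trans by blast
  \<comment> \<open>This scaling gives \<open>1 - x = (a + e) / (t + e)\<close> and bounds the norm
    of \<open>x\<close> by \<open>t / (t + e) < 1\<close>.\<close>
  define x where "x = (1 / (t + e)) *\<^sub>R (t *\<^sub>R 1 - a)"
  have "norm x < 1" using t t0 assms by (simp add: x_def divide_simps)
  moreover have "star x = x" by (simp add: x_def star_scaleR star_diff sa)
  ultimately obtain y where y: "star y = y" "(1 - y) * (1 - y) = 1 - x" "norm y \<le> 1"
    using self_adjoint_square_root[of x] by (metis less_imp_le order_trans)
  define k where "k = sqrt (t + e) *\<^sub>R (1 - y)"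
  have "k * k = (t + e) *\<^sub>R (1 - x)" using y t0 assms by (simp add: k_def)
  also have "\<dots> = (t + e) *\<^sub>R 1 - (t *\<^sub>R 1 - a)" using t0 assms by (simp add: x_def scaleR_diff_right)
  also have "\<dots> = a + e *\<^sub>R 1" by (simp add: algebra_simps)
  finally have "a + e *\<^sub>R 1 = k * k" by simp
  moreover have sk: "star k = k" using y by (simp add: k_def star_scaleR star_diff)
  moreover have "sqrt (t + e) *\<^sub>R 1 - k = sqrt (t + e) *\<^sub>R y" by (simp add: k_def algebra_simps)
  then have "norm (sqrt (t + e) *\<^sub>R 1 - k) \<le> sqrt (t + e)"
    using y(3) t0 assms by (simp add: mult_left_le)
  then have "positive k" using sk by (auto simp: positive_def)
  ultimately show ?thesis by blast
qed

text \<open>The number \<open>t\<close> in \<open>positive\<close> can be normalised to the norm of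
  \<open>a\<close>: \<open>a + e\<close> is a square, a square admits every bound of its norm as
  \<open>t\<close>, and the shift by \<open>e\<close> cancels in the difference.\<close>

lemma positive_norm_shift:
  assumes "positive a" shows "norm (norm a *\<^sub>R 1 - a) \<le> norm a"
proof (rule field_le_epsilon)
  fix e :: real assume e: "0 < e"
  obtain k where k: "star k = k" "a + e *\<^sub>R 1 = k * k"
    using positive_approx_square[OF assms e] by blast
  have "norm (k * k) \<le> norm a + e"
    using norm_add_scaleR_one_le[of a e] e k(2) by simp
  then have "norm ((norm a + e) *\<^sub>R 1 - k * k) \<le> norm a + e"
    by (rule norm_shift_square[OF k(1)])
  moreover have "(norm a + e) *\<^sub>R 1 - k * k = norm a *\<^sub>R 1 - a"
    unfolding k(2)[symmetric] by (simp add: algebra_simps)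
  ultimately show "norm (norm a *\<^sub>R 1 - a) \<le> norm a + e" by simp
qed

text \<open>Positivity is closed because \<open>t\<close> stays bounded: the norm of
  \<open>a\<close> plus \<open>e\<close> serves for \<open>a + e\<close>.\<close>

lemma positive_limit:
  assumes "\<And>e. 0 < e \<Longrightarrow> positive (a + e *\<^sub>R 1)"
  shows "positive a"
proof -
  have "star (a + 1 *\<^sub>R 1) = a + 1 *\<^sub>R 1" using assms[of 1] by (simp add: positive_def)
  then have "star a = a" by (simp add: star_add)
  moreover have "norm (norm a *\<^sub>R 1 - a) \<le> norm a"
  proof (rule field_le_epsilon)
    fix e :: real assume e: "0 < e"
    have "norm (a + e *\<^sub>R 1) \<le> norm a + e"
      using norm_add_scaleR_one_le[of a e] e by simp
    then have "norm ((norm a + e) *\<^sub>R 1 - (a + e *\<^sub>R 1)) \<le> norm a + e"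
      using norm_shift_mono[OF positive_norm_shift[OF assms[OF e]]] by blast
    moreover have "(norm a + e) *\<^sub>R 1 - (a + e *\<^sub>R 1) = norm a *\<^sub>R 1 - a" by (simp add: algebra_simps)
    ultimately show "norm (norm a *\<^sub>R 1 - a) \<le> norm a + e" by simp
  qed
  ultimately show ?thesis by (auto simp: positive_def)
qed

text \<open>By commutativity \<open>(a + e) (b + e)\<close> is the square of the product of two
  roots. The excess \<open>e (a + b) + e e\<close> over \<open>a b\<close> is absorbed by
  \<open>d\<close>.\<close>

lemma positive_mult:
  assumes "positive a" "positive b" shows "positive (a * b)"
proof (rule positive_limit)
  fix d :: real assume d: "0 < d"
  define M where "M = 1 + norm a + norm b"
  have M: "1 \<le> M" by (simp add: M_def)
  \<comment> \<open>With \<open>e \<le> 1\<close> the excess has norm at most \<open>e M\<close>,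
    hence at most \<open>d\<close>.\<close>
  define e where "e = min 1 (d / M)"
  have e: "0 < e" "e \<le> 1" "e * M \<le> d" using M d by (auto simp: e_def min_def divide_simps)
  obtain h where h: "star h = h" "a + e *\<^sub>R 1 = h * h" using positive_approx_square[OF assms(1) e(1)] by blast
  obtain k where k: "star k = k" "b + e *\<^sub>R 1 = k * k" using positive_approx_square[OF assms(2) e(1)] by blast
  have "positive ((h * k) * (h * k))" using h k by (intro positive_square) (simp add: star_mult mult.commute)
  also have "(h * k) * (h * k) = (a + e *\<^sub>R 1) * (b + e *\<^sub>R 1)" unfolding h k by (simp add: ac_simps)
  finally have p: "positive ((a + e *\<^sub>R 1) * (b + e *\<^sub>R 1))" .
  define f where "f = - (e *\<^sub>R (a + b))"
  have "e * e \<le> e" using e by (simp add: mult_left_le)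
  moreover have "e * norm (a + b) \<le> e * norm a + e * norm b"
    using mult_left_mono[OF norm_triangle_ineq[of a b], of e] e by (simp add: distrib_left)
  moreover have "e + e * norm a + e * norm b \<le> d" using e by (simp add: M_def distrib_left)
  ultimately have "e * norm (a + b) \<le> d - e * e" by linarith
  then have "positive ((d - e * e) *\<^sub>R 1 + f)" using e
    by (intro positive_shift) (simp_all add: f_def star_minus star_scaleR star_add positive_sa assms)
  from positive_add[OF p this] show "positive (a * b + d *\<^sub>R 1)"
    by (simp add: f_def algebra_simps)
qed

text \<open>Up to small shifts \<open>h\<close> and \<open>r - h\<close> are squares with sum
  \<open>r\<close>, and a square is dominated in norm by a sum of two squares.\<close>

lemma norm_le_of_positive_diff:
  assumes "positive h" "positive (r *\<^sub>R 1 - h)" "0 \<le> r"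
  shows "norm h \<le> r"
proof (rule field_le_epsilon)
  fix e :: real assume e: "0 < e"
  obtain k where k: "star k = k" "h + (e/3) *\<^sub>R 1 = k * k" using positive_approx_square[OF assms(1), of "e/3"] e by auto
  obtain l where l: "star l = l" "r *\<^sub>R 1 - h + (e/3) *\<^sub>R 1 = l * l" using positive_approx_square[OF assms(2), of "e/3"] e by auto
  have "norm (k * k) \<le> norm (k * k + l * l)" by (rule norm_square_le_sum_squares) fact+
  also have "k * k + l * l = (r + 2 * (e/3)) *\<^sub>R 1"
    unfolding k(2)[symmetric] l(2)[symmetric] by (simp add: algebra_simps flip: scaleR_add_left)
  also have "norm \<dots> \<le> r + 2 * (e/3)" using norm_scaleR_one_le[of "r + 2 * (e/3)", where 'a='a] e assms(3) by linarith
  finally have "norm (h + (e/3) *\<^sub>R 1) \<le> r + 2 * (e/3)" using k by simp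
  moreover have "norm h \<le> norm (h + (e/3) *\<^sub>R 1) + norm ((e/3) *\<^sub>R (1::'a))"
    using norm_triangle_ineq4[of "h + (e/3) *\<^sub>R 1" "(e/3) *\<^sub>R 1"] by simp
  ultimately show "norm h \<le> r + e" using norm_scaleR_one_le[of "e/3", where 'a='a] e by linarith
qed

text \<open>With \<open>h\<close> and \<open>k\<close> the real and imaginary parts of
  \<open>a\<close>, commutativity turns \<open>star a * a\<close> into
  \<open>h * h + k * k\<close>.\<close>

lemma positive_star_mult: "positive (star a * (a::'a::comm_unital_cstar_algebra))"
proof -
  define h where "h = (1/2) *\<^sub>R (a + star a)"
  define k where "k = (1/2) *\<^sub>R ((- \<i>) *\<^sub>C (a - star a))"
  have "star h = h" by (simp add: h_def star_scaleR star_add star_star add.commute)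
  moreover have "star k = k"
    by (simp add: k_def star_scaleR star_scaleC star_diff star_star scaleC_minus_left flip: scaleC_minus_right)
  moreover have "h * h + k * k = star a * a"
    by (simp add: h_def k_def scaleC_minus_left mult_scaleC_left mult_scaleC_right scaleC_scaleC
        algebra_simps flip: scaleR_add_left)
  ultimately show ?thesis by (metis positive_add positive_square)
qed

section \<open>Maximal cones and the real values of a character\<close>

text \<open>The maximal cones are the sets where a given character is nonnegative.\<close>

definition pos_cone :: "'a::comm_unital_cstar_algebra set \<Rightarrow> bool"
  where "pos_cone T \<longleftrightarrow> (\<forall>f\<in>T. star f = f) \<and> Collect positive \<subseteq> T \<and>
    (\<forall>f\<in>T. \<forall>g\<in>T. f + g \<in> T) \<and> (\<forall>p f. positive p \<longrightarrow> f \<in> T \<longrightarrow> p * f \<in> T) \<and> - 1 \<notin> T"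

lemma pos_cone_scaleR: "pos_cone T \<Longrightarrow> f \<in> T \<Longrightarrow> 0 \<le> r \<Longrightarrow> r *\<^sub>R f \<in> T"
  unfolding pos_cone_def using positive_scaleR_one[of r] by (metis mult_1 mult_scaleR_left)

lemma positive_zero: "positive 0"
  using positive_scaleR_one[of 0] by simp

lemma positive_one: "positive 1"
  using positive_scaleR_one[of 1] by simp

text \<open>The candidate is the cone generated by \<open>T\<close> and \<open>f\<close>; the only
  axiom it can violate is the absence of \<open>- 1\<close>.\<close>

lemma pos_cone_adjoin:
  assumes T: "pos_cone T" and f: "star f = f"
  shows "- 1 \<in> {t + p * f | t p. t \<in> T \<and> positive p} \<or>
     (\<exists>T'. pos_cone T' \<and> T \<subseteq> T' \<and> f \<in> T')"
proof (cases "- 1 \<in> {t + p * f | t p. t \<in> T \<and> positive p}")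
  case False
  define T' where "T' = {t + p * f | t p. t \<in> T \<and> positive p}"
  have tT: "t \<in> T'" if "t \<in> T" for t
    using that positive_zero by (force simp: T'_def)
  have "star x = x" if "x \<in> T'" for x
    using that T f by (auto simp: T'_def pos_cone_def star_add star_mult positive_sa mult.commute)
  moreover have "Collect positive \<subseteq> T'" using T tT by (auto simp: pos_cone_def)
  moreover have "x + y \<in> T'" if "x \<in> T'" "y \<in> T'" for x y
  proof -
    from that obtain t p s q where "x = t + p * f" "y = s + q * f" "t \<in> T" "s \<in> T" "positive p" "positive q"
      by (auto simp: T'_def)
    then have "x + y = (t + s) + (p + q) * f" "t + s \<in> T" "positive (p + q)"
      using T by (auto simp: algebra_simps pos_cone_def positive_add)
    then show ?thesis unfolding T'_def by blast
  qed
  moreover have "p * x \<in> T'" if "positive p" "x \<in> T'" for p x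
  proof -
    from that obtain t q where "x = t + q * f" "t \<in> T" "positive q" by (auto simp: T'_def)
    then have "p * x = p * t + (p * q) * f" "p * t \<in> T" "positive (p * q)"
      using T that by (auto simp: algebra_simps pos_cone_def positive_mult)
    then show ?thesis unfolding T'_def by blast
  qed
  ultimately have "pos_cone T'" using False by (simp add: pos_cone_def T'_def)
  moreover have "f \<in> T'"
  proof -
    have "0 \<in> T" using T positive_zero by (auto simp: pos_cone_def)
    then have "0 + 1 * f \<in> T'" unfolding T'_def using positive_one by blast
    then show ?thesis by simp
  qed
  ultimately show ?thesis using tT by blast
qed simp

text \<open>If neither extension is possible, \<open>- 1 = t + p f = s - q f\<close>. Eliminating
  \<open>f\<close> puts \<open>- (p + q)\<close> and then \<open>- p\<close> into \<open>T\<close>.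
  As \<open>p (M + f)\<close> is positive, \<open>M p - 1\<close> lies in \<open>T\<close> too, and
  adding \<open>M (- p)\<close> produces \<open>- 1\<close>.\<close>

lemma maximal_pos_cone_total:
  assumes T: "pos_cone T" and max: "\<And>T'. pos_cone T' \<Longrightarrow> T \<subseteq> T' \<Longrightarrow> T' = T" and f: "star f = f"
  shows "f \<in> T \<or> - f \<in> T"
proof (rule ccontr)
  assume "\<not> (f \<in> T \<or> - f \<in> T)"
  then have "- 1 \<in> {t + p * f | t p. t \<in> T \<and> positive p}" "- 1 \<in> {t + p * (- f) | t p. t \<in> T \<and> positive p}"
    using pos_cone_adjoin[OF T f] pos_cone_adjoin[OF T, of "- f"] max f by (auto simp: star_minus)
  then obtain t p s q where t: "- 1 = t + p * f" "t \<in> T" "positive p" and s: "- 1 = s - q * f" "s \<in> T" "positive q"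
    by auto
  have T_add: "x + y \<in> T" if "x \<in> T" "y \<in> T" for x y using T that by (auto simp: pos_cone_def)
  have T_mult: "p * x \<in> T" if "positive p" "x \<in> T" for p x using T that by (auto simp: pos_cone_def)
  have T_pos: "p \<in> T" if "positive p" for p using T that by (auto simp: pos_cone_def)
  define M where "M = norm f + 1"
  have M: "0 < M" "norm f \<le> M" by (simp_all add: M_def add_nonneg_pos)
  have "q * t + p * s = q * (- 1 - p * f) + p * (- 1 + q * f)" using t(1) s(1) by (simp add: algebra_simps)
  also have "\<dots> = - (p + q)" by (simp add: algebra_simps)
  finally have "- (p + q) \<in> T" using T_add[OF T_mult[OF s(3) t(2)] T_mult[OF t(3) s(2)]] by simp
  from T_add[OF this T_pos[OF s(3)]] have mp: "- p \<in> T" by simp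
  have "t + p * (M *\<^sub>R 1 + f) \<in> T"
    by (intro T_add T_pos t(2) positive_mult t(3) positive_shift f M)
  also have "t + p * (M *\<^sub>R 1 + f) = (t + p * f) + M *\<^sub>R p" by (simp add: algebra_simps)
  also have "\<dots> = M *\<^sub>R p - 1" using t(1)[symmetric] by simp
  finally have "M *\<^sub>R p - 1 \<in> T" .
  from T_add[OF this pos_cone_scaleR[OF T mp less_imp_le[OF M(1)]]] have "(M *\<^sub>R p - 1) + M *\<^sub>R (- p) \<in> T" by blast
  also have "(M *\<^sub>R p - 1) + M *\<^sub>R (- p) = - 1" by simp
  finally show False using T by (simp add: pos_cone_def)
qed

text \<open>Membership of \<open>h - norm h *\<^sub>R 1\<close> in the cone will force the resulting
  character to take the value \<open>norm h\<close> at \<open>h\<close>.\<close>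

lemma ex_maximal_pos_cone:
  fixes h :: "'a::comm_unital_cstar_algebra"
  assumes h: "positive h" "h \<noteq> 0"
  shows "\<exists>T. pos_cone T \<and> h - norm h *\<^sub>R 1 \<in> T \<and> (\<forall>T'. pos_cone T' \<longrightarrow> T \<subseteq> T' \<longrightarrow> T' = T)"
proof -
  define g where "g = h - norm h *\<^sub>R 1"
  have h0: "0 < norm h" using h by simp
  have one: "(1::'a) \<noteq> 0" using h(2) by (metis mult_1 mult_zero_left)
  then have n1: "norm (1::'a) = 1"
    using cstar_identity[of "1::'a"] by (simp add: power2_eq_square)
  have "pos_cone (Collect positive :: 'a set)"
  proof -
    have "\<not> positive (- (1::'a))"
    proof
      assume "positive (- (1::'a))"
      then obtain t where "norm (t *\<^sub>R (1::'a) - - 1) \<le> t" by (auto simp: positive_def)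
      moreover have "t *\<^sub>R (1::'a) - - 1 = (t + 1) *\<^sub>R 1" by (simp add: algebra_simps)
      ultimately show False using n1 by simp
    qed
    then show ?thesis by (auto simp: pos_cone_def positive_sa positive_add positive_mult)
  qed
  \<comment> \<open>If \<open>- 1\<close> were generated, enlarging \<open>p\<close> to the constant
    \<open>M\<close> would make \<open>M (norm h - h) - 1\<close> positive, so \<open>h\<close>
    would be bounded by \<open>norm h - 1 / M\<close>.\<close>
  moreover have "- 1 \<notin> {t + p * g | t p. t \<in> Collect positive \<and> positive p}"
  proof
    assume "- 1 \<in> {t + p * g | t p. t \<in> Collect positive \<and> positive p}"
    then obtain t p where t: "- 1 = t + p * g" "positive t" "positive p" by auto
    define M where "M = norm p + 1"
    have M: "0 < M" "norm p \<le> M" by (simp_all add: M_def add_nonneg_pos)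
    have "positive (norm h *\<^sub>R 1 + - h)"
      by (rule positive_shift) (simp_all add: star_minus positive_sa h)
    then have g: "positive (- g)" by (simp add: g_def)
    have "positive (M *\<^sub>R 1 + - p)" using M
      by (intro positive_shift) (simp_all add: star_minus positive_sa t)
    from positive_mult[OF this g] have "positive (t + (M *\<^sub>R 1 + - p) * - g)"
      using t(2) positive_add by blast
    also have "t + (M *\<^sub>R 1 + - p) * - g = (t + p * g) + M *\<^sub>R (- g)" by (simp add: algebra_simps)
    also have "\<dots> = M *\<^sub>R (- g) - 1" using t(1)[symmetric] by simp
    finally have "positive (((1/M) *\<^sub>R 1) * (M *\<^sub>R (- g) - 1))"
      using positive_mult positive_scaleR_one[of "1/M"] M by (metis less_imp_le zero_le_divide_1_iff)
    also have "((1/M) *\<^sub>R 1) * (M *\<^sub>R (- g) - 1) = (norm h - 1/M) *\<^sub>R 1 - h"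
      using M by (simp add: g_def algebra_simps)
    finally have p1: "positive ((norm h - 1/M) *\<^sub>R 1 - h)" .
    \<comment> \<open>\<open>norm_le_of_positive_diff\<close> asks for a nonnegative bound; adding
      \<open>h\<close> shows that the constant \<open>norm h - 1 / M\<close> is itself
      positive.\<close>
    from positive_add[OF this h(1)] have "positive ((norm h - 1/M) *\<^sub>R (1::'a))" by simp
    then obtain s where "norm (s *\<^sub>R 1 - (norm h - 1/M) *\<^sub>R (1::'a)) \<le> s" by (auto simp: positive_def)
    then have "\<bar>s - (norm h - 1/M)\<bar> \<le> s" using n1 by (simp flip: scaleR_diff_left)
    then have "0 \<le> norm h - 1/M" by linarith
    then have "norm h \<le> norm h - 1/M" using norm_le_of_positive_diff[OF h(1) p1] by blast
    then show False using M by simp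
  qed
  moreover have "star g = g" using h by (simp add: g_def star_diff star_scaleR positive_sa)
  ultimately obtain T0 where T0: "pos_cone T0" "g \<in> T0" using pos_cone_adjoin by blast
  define A where "A = {T. pos_cone T \<and> g \<in> T}"
  have "\<exists>M\<in>A. \<forall>X\<in>A. M \<subseteq> X \<longrightarrow> X = M"
  proof (rule subset_Zorn_nonempty)
    show "A \<noteq> {}" using T0 by (auto simp: A_def)
    fix C assume C: "C \<noteq> {}" "subset.chain A C"
    then have CA: "C \<subseteq> A" and ch: "\<And>X Y. X \<in> C \<Longrightarrow> Y \<in> C \<Longrightarrow> X \<subseteq> Y \<or> Y \<subseteq> X"
      by (auto simp: subset.chain_def)
    have "f + k \<in> \<Union>C" if "f \<in> \<Union>C" "k \<in> \<Union>C" for f k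
    proof -
      from that obtain X Y where "X \<in> C" "Y \<in> C" "f \<in> X" "k \<in> Y" by blast
      with ch[of X Y] obtain Z where "Z \<in> C" "f \<in> Z" "k \<in> Z" by blast
      moreover then have "f + k \<in> Z" using CA by (auto simp: A_def pos_cone_def)
      ultimately show ?thesis by blast
    qed
    moreover have "\<forall>f\<in>\<Union>C. star f = f" using CA by (auto simp: A_def pos_cone_def)
    moreover have "Collect positive \<subseteq> \<Union>C" using C(1) CA by (fastforce simp: A_def pos_cone_def)
    moreover have "\<forall>p f. positive p \<longrightarrow> f \<in> \<Union>C \<longrightarrow> p * f \<in> \<Union>C"
      using CA by (auto simp: A_def pos_cone_def)
    moreover have "- 1 \<notin> \<Union>C" using CA by (auto simp: A_def pos_cone_def)
    ultimately have "pos_cone (\<Union>C)" by (simp only: pos_cone_def) blast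
    then show "\<Union>C \<in> A" using C(1) CA by (auto simp: A_def)
  qed
  then show ?thesis unfolding A_def g_def by blast
qed

section \<open>Characters and the order they determine\<close>

definition character :: "('a::comm_unital_cstar_algebra \<Rightarrow> complex) \<Rightarrow> bool"
  where "character \<omega> \<longleftrightarrow> (\<forall>a b. \<omega> (a + b) = \<omega> a + \<omega> b) \<and> (\<forall>a b. \<omega> (a * b) = \<omega> a * \<omega> b) \<and>
    (\<forall>c a. \<omega> (c *\<^sub>C a) = c * \<omega> a) \<and> (\<forall>a. \<omega> (star a) = cnj (\<omega> a)) \<and> \<omega> 1 = 1"

text \<open>A maximal cone contains \<open>f\<close> or \<open>- f\<close> for every self-adjoint
  \<open>f\<close>, so the constants below and above \<open>f\<close> form a Dedekind cut, and
  \<open>\<phi> f\<close> is the number it defines. Sums are immediate from the cone; products are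
  reduced to elements of value \<open>0\<close>.\<close>

lemma ex_real_character:
  fixes h :: "'a::comm_unital_cstar_algebra"
  assumes h: "positive h" "h \<noteq> 0"
  shows "\<exists>\<phi>::'a \<Rightarrow> real. (\<forall>f g. star f = f \<longrightarrow> star g = g \<longrightarrow> \<phi> (f + g) = \<phi> f + \<phi> g \<and> \<phi> (f * g) = \<phi> f * \<phi> g) \<and>
     (\<forall>r f. star f = f \<longrightarrow> \<phi> (r *\<^sub>R f) = r * \<phi> f) \<and> \<phi> 1 = 1 \<and> \<phi> h = norm h"
proof -
  obtain T where T: "pos_cone T" "h - norm h *\<^sub>R 1 \<in> T"
    and max: "\<And>T'. pos_cone T' \<Longrightarrow> T \<subseteq> T' \<Longrightarrow> T' = T"
    using ex_maximal_pos_cone[OF h] by blast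
  have T_add: "x + y \<in> T" if "x \<in> T" "y \<in> T" for x y using T that by (auto simp: pos_cone_def)
  have T_mult: "p * x \<in> T" if "positive p" "x \<in> T" for p x using T that by (auto simp: pos_cone_def)
  have T_pos: "p \<in> T" if "positive p" for p using T that by (auto simp: pos_cone_def)
  have T_sa: "star x = x" if "x \<in> T" for x using T that by (auto simp: pos_cone_def)
  have T_sc: "r *\<^sub>R x \<in> T" if "x \<in> T" "0 \<le> r" for r x using pos_cone_scaleR T that by blast
  have tot: "f \<in> T \<or> - f \<in> T" if "star f = f" for f by (rule maximal_pos_cone_total[OF T(1) max that])
  have const: "r *\<^sub>R 1 \<in> T \<longleftrightarrow> 0 \<le> r" for r
  proof
    assume r: "r *\<^sub>R 1 \<in> T"
    show "0 \<le> r"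
    proof (rule ccontr)
      assume "\<not> 0 \<le> r"
      then have "(1 / - r) *\<^sub>R (r *\<^sub>R 1) \<in> T" by (intro T_sc[OF r]) (simp add: zero_le_divide_iff)
      also have "(1 / - r) *\<^sub>R (r *\<^sub>R 1) = (- 1 :: 'a)" using \<open>\<not> 0 \<le> r\<close> by simp
      finally show False using T by (simp add: pos_cone_def)
    qed
  qed (simp add: T_pos positive_scaleR_one)
  define \<phi> where "\<phi> f = Sup {r. f - r *\<^sub>R 1 \<in> T}" for f
  have bd: "r \<le> norm f" if "f - r *\<^sub>R 1 \<in> T" for f r
  proof -
    have sf: "star f = f" using T_sa[OF that] by (simp add: star_diff star_scaleR)
    have "norm f *\<^sub>R 1 + - f \<in> T" by (intro T_pos positive_shift) (simp_all add: star_minus sf)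
    from T_add[OF that this] have "(norm f - r) *\<^sub>R 1 \<in> T" by (simp add: algebra_simps)
    then show ?thesis by (simp add: const)
  qed
  have ne: "f - (- norm f) *\<^sub>R 1 \<in> T" if "star f = f" for f
    using T_pos[OF positive_shift[OF that order_refl]] by (simp add: add.commute)
  have bdd: "bdd_above {r. f - r *\<^sub>R 1 \<in> T}" for f using bd by (auto intro!: bdd_aboveI)
  have lower: "r \<le> \<phi> f" if "f - r *\<^sub>R 1 \<in> T" for f r
    unfolding \<phi>_def by (rule cSup_upper) (use that bdd in auto)
  have below: "f - r *\<^sub>R 1 \<in> T" if sf: "star f = f" and r: "r < \<phi> f" for f r
  proof -
    have "{r. f - r *\<^sub>R 1 \<in> T} \<noteq> {}" using ne[OF sf] by blast
    from less_cSupD[OF this r[unfolded \<phi>_def]] obtain s where s: "r < s" "f - s *\<^sub>R 1 \<in> T" by auto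
    have "(f - s *\<^sub>R 1) + (s - r) *\<^sub>R 1 \<in> T" using s const by (intro T_add) auto
    then show ?thesis by (simp add: algebra_simps)
  qed
  have upper: "\<phi> f \<le> r" if "star f = f" "r *\<^sub>R 1 - f \<in> T" for f r
  proof (rule ccontr)
    assume "\<not> \<phi> f \<le> r"
    then obtain s where s: "r < s" "s < \<phi> f" using dense not_le by blast
    from T_add[OF below[OF that(1) s(2)] that(2)] have "(r - s) *\<^sub>R 1 \<in> T" by (simp add: algebra_simps)
    then show False using s const by simp
  qed
  have above: "r *\<^sub>R 1 - f \<in> T" if sf: "star f = f" and r: "\<phi> f < r" for f r
  proof -
    have "f - r *\<^sub>R 1 \<notin> T" using lower[of f r] r by auto
    then show ?thesis using tot[of "f - r *\<^sub>R 1"] by (simp add: star_diff star_scaleR sf)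
  qed
  have add: "\<phi> (f + g) = \<phi> f + \<phi> g" if "star f = f" "star g = g" for f g
  proof (rule antisym; rule field_le_epsilon)
    fix e :: real assume e: "0 < e"
    have "(\<phi> f + e/2) *\<^sub>R 1 - f + ((\<phi> g + e/2) *\<^sub>R 1 - g) \<in> T" using e that by (intro T_add above) auto
    also have "(\<phi> f + e/2) *\<^sub>R 1 - f + ((\<phi> g + e/2) *\<^sub>R 1 - g) = (\<phi> f + \<phi> g + e) *\<^sub>R 1 - (f + g)"
      by (simp add: algebra_simps flip: scaleR_add_left)
    finally show "\<phi> (f + g) \<le> \<phi> f + \<phi> g + e" using that by (intro upper) (simp_all add: star_add)
    have "f - (\<phi> f - e/2) *\<^sub>R 1 + (g - (\<phi> g - e/2) *\<^sub>R 1) \<in> T" using e that by (intro T_add below) auto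
    also have "f - (\<phi> f - e/2) *\<^sub>R 1 + (g - (\<phi> g - e/2) *\<^sub>R 1) = (f + g) - (\<phi> f + \<phi> g - e) *\<^sub>R 1"
      by (simp add: algebra_simps flip: scaleR_add_left)
    finally show "\<phi> f + \<phi> g \<le> \<phi> (f + g) + e" using lower by fastforce
  qed
  have nonneg: "0 \<le> \<phi> f" if "f \<in> T" for f using lower[of f 0] that by simp
  have cst: "\<phi> (r *\<^sub>R 1) = r" for r
  proof (rule antisym)
    show "\<phi> (r *\<^sub>R 1) \<le> r" using const[of 0] by (intro upper) (simp_all add: star_scaleR)
    show "r \<le> \<phi> (r *\<^sub>R 1)" using const[of 0] by (intro lower) simp
  qed
  have cst': "\<phi> (- (r *\<^sub>R 1)) = - r" for r using cst[of "- r"] by simp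
  have minus: "\<phi> (- f) = - \<phi> f" if "star f = f" for f
    using add[of f "- f"] cst[of 0] that by (simp add: star_minus)
  \<comment> \<open>For \<open>\<phi> f = 0\<close> every \<open>f + e\<close> with
    \<open>e > 0\<close> lies in \<open>T\<close>, hence so does \<open>p f + e p\<close>; this
    bounds \<open>\<phi> (p f)\<close> below by \<open>- e \<phi> p\<close>. Applying it to
    \<open>g\<close> and \<open>- g\<close> gives \<open>0\<close>.\<close>
  have zero: "\<phi> (p * g) = 0" if p: "positive p" and g: "star g = g" "\<phi> g = 0" for p g
  proof -
    have *: "- \<phi> (p * f) \<le> e * \<phi> p" if f: "star f = f" "\<phi> f = 0" "0 < e" for f e
    proof -
      have sp: "star (e *\<^sub>R p) = e *\<^sub>R p" "star (p * f) = p * f"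
        using p f by (simp_all add: star_scaleR star_mult positive_sa mult.commute)
      have "f - (- e) *\<^sub>R 1 \<in> T" using f by (intro below) auto
      from T_mult[OF p this] have "p * f + e *\<^sub>R p \<in> T" by (simp add: algebra_simps)
      then have "0 \<le> \<phi> (p * f) + \<phi> (e *\<^sub>R p)" using nonneg add sp by metis
      moreover have "\<phi> (e *\<^sub>R p) \<le> e * \<phi> p"
      proof (rule field_le_epsilon)
        fix d :: real assume d: "0 < d"
        have "(\<phi> p + d / e) *\<^sub>R 1 - p \<in> T" using d f(3) p by (intro above) (auto simp: positive_sa)
        from T_sc[OF this, of e] f(3) have "(e * \<phi> p + d) *\<^sub>R 1 - e *\<^sub>R p \<in> T" by (simp add: algebra_simps)
        then show "\<phi> (e *\<^sub>R p) \<le> e * \<phi> p + d" using sp by (intro upper) auto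
      qed
      ultimately show ?thesis by simp
    qed
    have **: "- \<phi> (p * f) \<le> 0" if f: "star f = f" "\<phi> f = 0" for f
    proof (rule field_le_epsilon)
      fix d :: real assume d: "0 < d"
      have pp: "0 \<le> \<phi> p" using nonneg T_pos p by blast
      \<comment> \<open>The \<open>+ 1\<close> keeps the denominator positive when
        \<open>\<phi> p = 0\<close>.\<close>
      have "- \<phi> (p * f) \<le> (d / (\<phi> p + 1)) * \<phi> p" using d pp f by (intro *) auto
      also have "\<dots> \<le> d" using d pp by (simp add: divide_simps mult_left_mono)
      finally show "- \<phi> (p * f) \<le> 0 + d" by simp
    qed
    have sg: "star (p * g) = p * g" using p g by (simp add: star_mult positive_sa mult.commute)
    have "\<phi> (p * - g) = - \<phi> (p * g)" using minus[OF sg] by simp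
    with **[of g] **[of "- g"] g show ?thesis by (simp add: minus star_minus)
  qed
  have multp: "\<phi> (p * f) = \<phi> p * \<phi> f" if p: "positive p" and f: "star f = f" for p f
  proof -
    define g where "g = f + (- \<phi> f) *\<^sub>R 1"
    have g: "star g = g" "\<phi> g = 0" using f add[OF f, of "(- \<phi> f) *\<^sub>R 1"] cst'
      by (simp_all add: g_def star_diff star_minus star_scaleR)
    have s: "star (\<phi> f *\<^sub>R p) = \<phi> f *\<^sub>R p" "star (p * g) = p * g"
      using p g by (simp_all add: star_scaleR positive_sa star_mult mult.commute)
    have "p * f = p * g + \<phi> f *\<^sub>R p" by (simp add: g_def algebra_simps)
    then have 1: "\<phi> (p * f) = \<phi> (\<phi> f *\<^sub>R p)" using add[OF s(2,1)] zero[OF p g] by simp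
    define k where "k = p + (- \<phi> p) *\<^sub>R 1"
    have k: "star k = k" "\<phi> k = 0" using p add[of p "(- \<phi> p) *\<^sub>R 1"] cst'
      by (simp_all add: k_def star_diff star_minus star_scaleR positive_sa)
    have zk: "\<phi> (r *\<^sub>R k) = 0" if "0 \<le> r" for r
      using zero[OF positive_scaleR_one[OF that] k] by simp
    have "\<phi> (r *\<^sub>R k) = 0" for r
    proof (cases "0 \<le> r")
      case False
      then have "\<phi> ((- r) *\<^sub>R k) = 0" by (intro zk) simp
      then show ?thesis using minus[of "r *\<^sub>R k"] k by (simp add: star_scaleR)
    qed (rule zk)
    moreover have "\<phi> f *\<^sub>R p = \<phi> f *\<^sub>R k + (\<phi> p * \<phi> f) *\<^sub>R 1" by (simp add: k_def algebra_simps)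
    ultimately have "\<phi> (\<phi> f *\<^sub>R p) = \<phi> p * \<phi> f"
      using add[of "\<phi> f *\<^sub>R k" "(\<phi> p * \<phi> f) *\<^sub>R 1"] cst k by (simp add: star_scaleR)
    with 1 show ?thesis by simp
  qed
  have mult: "\<phi> (f * g) = \<phi> f * \<phi> g" if f: "star f = f" and g: "star g = g" for f g
  proof -
    \<comment> \<open>A self-adjoint element is the difference of a positive one and a constant, and
      \<open>multp\<close> covers both.\<close>
    define p where "p = norm f *\<^sub>R 1 + f"
    have p: "positive p" unfolding p_def by (rule positive_shift[OF f order_refl])
    have c: "positive (norm f *\<^sub>R 1)" by (rule positive_scaleR_one) simp
    have "p * g = (norm f *\<^sub>R 1) * g + f * g" by (simp add: p_def algebra_simps)
    then have "\<phi> (p * g) = \<phi> ((norm f *\<^sub>R 1) * g) + \<phi> (f * g)"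
      using f g by (subst add[symmetric]) (simp_all add: star_scaleR star_mult mult.commute)
    moreover have "\<phi> p = norm f + \<phi> f" unfolding p_def using add[of "norm f *\<^sub>R 1" f] f cst by (simp add: star_scaleR)
    ultimately show ?thesis using multp[OF p g] multp[OF c g] cst by (simp add: algebra_simps)
  qed
  have "\<phi> (r *\<^sub>R f) = r * \<phi> f" if "star f = f" for r f
    using mult[of "r *\<^sub>R 1" f] that cst by (simp add: star_scaleR)
  moreover have "\<phi> 1 = 1" using cst[of 1] by simp
  moreover have "\<phi> h = norm h"
  proof (rule antisym)
    show "norm h \<le> \<phi> h" by (rule lower[OF T(2)])
    have "norm h *\<^sub>R 1 + - h \<in> T" by (intro T_pos positive_shift) (simp_all add: star_minus positive_sa h)
    then show "\<phi> h \<le> norm h" by (intro upper) (simp_all add: positive_sa h)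
  qed
  ultimately show ?thesis using add mult by blast
qed

lemma char_add: "character \<omega> \<Longrightarrow> \<omega> (a + b) = \<omega> a + \<omega> b"
  and char_mult: "character \<omega> \<Longrightarrow> \<omega> (a * b) = \<omega> a * \<omega> b"
  and char_scaleC: "character \<omega> \<Longrightarrow> \<omega> (c *\<^sub>C a) = c * \<omega> a"
  and char_star: "character \<omega> \<Longrightarrow> \<omega> (star a) = cnj (\<omega> a)"
  and char_one: "character \<omega> \<Longrightarrow> \<omega> 1 = 1"
  by (simp_all add: character_def)

lemma char_scaleR: "character \<omega> \<Longrightarrow> \<omega> (r *\<^sub>R a) = of_real r * \<omega> a"
  by (simp add: scaleR_scaleC char_scaleC)

lemma char_zero: "character \<omega> \<Longrightarrow> \<omega> 0 = 0"
  using char_scaleR[of \<omega> 0 0] by simp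

lemma char_minus: "character \<omega> \<Longrightarrow> \<omega> (- a) = - \<omega> a"
  using char_scaleR[of \<omega> "- 1" a] by simp

lemma char_diff: "character \<omega> \<Longrightarrow> \<omega> (a - b) = \<omega> a - \<omega> b"
  using char_add[of \<omega> a "- b"] by (simp add: char_minus)

lemmas char_simps = char_add char_mult char_scaleC char_star char_one char_scaleR char_zero
  char_minus char_diff

lemma char_sum: "character \<omega> \<Longrightarrow> \<omega> (sum f F) = (\<Sum>i\<in>F. \<omega> (f i))"
  by (induction F rule: infinite_finite_induct) (simp_all add: char_simps)

lemma char_self_adjoint_Im: "character \<omega> \<Longrightarrow> star a = a \<Longrightarrow> Im (\<omega> a) = 0"
  by (metis char_star cnj.simps(2) neg_equal_zero)

lemma char_positive:
  assumes c: "character \<omega>" and a: "positive a"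
  shows "0 \<le> Re (\<omega> a)"
proof (rule field_le_epsilon)
  fix e :: real assume "0 < e"
  then obtain k where k: "star k = k" "a + e *\<^sub>R 1 = k * k" using positive_approx_square[OF a] by blast
  have "\<omega> a + of_real e = \<omega> k * \<omega> k" using arg_cong[OF k(2), of \<omega>] c by (simp add: char_simps)
  then have "Re (\<omega> a) + e = Re (\<omega> k * \<omega> k)" by (metis Re_complex_of_real plus_complex.sel(1))
  then show "0 \<le> Re (\<omega> a) + e" using char_self_adjoint_Im[OF c k(1)] by simp
qed

text \<open>A character is nonnegative on the positive element
  \<open>norm (star a * a) *\<^sub>R 1 - star a * a\<close>; the C*-identity turns this into the
  bound.\<close>

lemma norm_char_le:
  assumes c: "character \<omega>" shows "cmod (\<omega> a) \<le> norm a"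
proof -
  have "norm (star a * a) *\<^sub>R 1 + - (star a * a) = norm (star a * a) *\<^sub>R 1 - star a * a" by simp
  moreover have "positive (norm (star a * a) *\<^sub>R 1 + - (star a * a))"
    by (rule positive_shift) (simp_all add: star_minus star_mult star_star)
  ultimately have "0 \<le> Re (\<omega> (norm (star a * a) *\<^sub>R 1 - star a * a))" using char_positive[OF c] by metis
  also have "\<omega> (norm (star a * a) *\<^sub>R 1 - star a * a) = of_real ((norm a)\<^sup>2) - of_real ((cmod (\<omega> a))\<^sup>2)"
    using c by (simp add: char_simps cstar_identity mult.commute[of "cnj _"] flip: complex_norm_square)
  finally have "(cmod (\<omega> a))\<^sup>2 \<le> (norm a)\<^sup>2"
    unfolding of_real_diff[symmetric] Re_complex_of_real by linarith
  then show ?thesis using norm_ge_zero by (rule power2_le_imp_le)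
qed

lemma bounded_linear_char: "character \<omega> \<Longrightarrow> bounded_linear \<omega>"
  by (rule bounded_linear_intro[of _ 1])
    (simp_all add: char_simps norm_char_le scaleR_conv_of_real)

text \<open>A functional that attains the norm at \<open>star a * a\<close> also attains it at
  \<open>a\<close>, since \<open>\<omega> (star a * a)\<close> is the squared modulus of
  \<open>\<omega> a\<close>. The real functional is extended through the unique decomposition into
  real and imaginary parts.\<close>

lemma ex_character:
  fixes a :: "'a::comm_unital_cstar_algebra"
  assumes "a \<noteq> 0" shows "\<exists>\<omega>. character \<omega> \<and> cmod (\<omega> a) = norm a"
proof -
  define h where "h = star a * a"
  have n: "norm h = (norm a)\<^sup>2" by (simp add: h_def cstar_identity)
  then have h: "positive h" "h \<noteq> 0" using assms positive_star_mult[of a] by (auto simp: h_def)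
  obtain \<phi> :: "'a \<Rightarrow> real" where
    add: "\<And>f g. star f = f \<Longrightarrow> star g = g \<Longrightarrow> \<phi> (f + g) = \<phi> f + \<phi> g" and
    mult: "\<And>f g. star f = f \<Longrightarrow> star g = g \<Longrightarrow> \<phi> (f * g) = \<phi> f * \<phi> g" and
    scale: "\<And>r f. star f = f \<Longrightarrow> \<phi> (r *\<^sub>R f) = r * \<phi> f" and
    one: "\<phi> 1 = 1" and hn: "\<phi> h = norm h"
    using ex_real_character[OF h] by metis
  define R where "R b = (1/2) *\<^sub>R (b + star b)" for b :: 'a
  define J where "J b = (1/2) *\<^sub>R ((- \<i>) *\<^sub>C (b - star b))" for b :: 'a
  have sa: "star (R b) = R b" "star (J b) = J b" for b
    by (simp_all add: R_def J_def star_scaleR star_add star_star star_scaleC star_diff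
        scaleC_minus_left add.commute flip: scaleC_minus_right)
  have dec: "b = R b + \<i> *\<^sub>C J b" for b
    by (simp add: R_def J_def scaleC_scaleC scaleR_scaleC scaleC_add_right scaleC_diff_right
        flip: scaleC_add_left)
  have uniq: "R b = h \<and> J b = k" if "b = h + \<i> *\<^sub>C k" "star h = h" "star k = k" for b h k
  proof -
    have sb: "star b = h - \<i> *\<^sub>C k" using that by (simp add: star_add star_scaleC scaleC_minus_left)
    then have "b + star b = 2 *\<^sub>R h" "b - star b = 2 *\<^sub>R (\<i> *\<^sub>C k)" using that by (simp_all add: scaleR_2)
    then show ?thesis
      by (simp add: R_def J_def scaleC_scaleC scaleR_scaleC)
  qed
  define \<omega> where "\<omega> b = Complex (\<phi> (R b)) (\<phi> (J b))" for b
  have ii: "\<i> *\<^sub>C (\<i> *\<^sub>C b) = - b" for b :: 'a by (simp add: scaleC_scaleC scaleC_minus_left)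
  have phim: "\<phi> (- f) = - \<phi> f" if "star f = f" for f using scale[OF that, of "- 1"] by simp
  have phid: "\<phi> (f - g) = \<phi> f - \<phi> g" if "star f = f" "star g = g" for f g
    using add[of f "- g"] phim that by (simp add: star_minus)
  have 1: "\<omega> (b + c) = \<omega> b + \<omega> c" for b c
  proof -
    have "b + c = (R b + R c) + \<i> *\<^sub>C (J b + J c)"
      using dec[of b] dec[of c] by (simp add: scaleC_add_right) (metis add.assoc add.left_commute)
    from uniq[OF this] show ?thesis by (simp add: \<omega>_def sa star_add add complex_eq_iff)
  qed
  have 2: "\<omega> (b * c) = \<omega> b * \<omega> c" for b c
  proof -
    have "b * c = (R b + \<i> *\<^sub>C J b) * (R c + \<i> *\<^sub>C J c)" using dec by metis
    also have "\<dots> = (R b * R c - J b * J c) + \<i> *\<^sub>C (R b * J c + J b * R c)"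
      by (simp add: algebra_simps mult_scaleC_left mult_scaleC_right scaleC_add_right ii)
    finally show ?thesis
      using uniq[of "b * c" "R b * R c - J b * J c" "R b * J c + J b * R c"]
      by (simp add: \<omega>_def sa star_add star_diff star_mult add phid mult complex_eq_iff mult.commute)
  qed
  have 4: "\<omega> (star b) = cnj (\<omega> b)" for b
  proof -
    have "star b = star (R b + \<i> *\<^sub>C J b)" using dec by metis
    also have "\<dots> = R b + \<i> *\<^sub>C (- J b)"
      by (simp add: star_add star_scaleC sa scaleC_minus_left scaleC_minus_right)
    finally show ?thesis using uniq[of "star b" "R b" "- J b"]
      by (simp add: \<omega>_def sa star_minus phim complex_eq_iff)
  qed
  have 3: "\<omega> (z *\<^sub>C b) = z * \<omega> b" for z b
  proof -
    have "z *\<^sub>C (1::'a) = (of_real (Re z) + \<i> * of_real (Im z)) *\<^sub>C 1"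
      by (metis complex_eq)
    then have z1: "z *\<^sub>C (1::'a) = Re z *\<^sub>R 1 + \<i> *\<^sub>C (Im z *\<^sub>R 1)"
      by (simp add: scaleR_scaleC scaleC_scaleC scaleC_add_left)
    have "\<omega> (z *\<^sub>C (1::'a)) = z" using uniq[OF z1]
      by (simp add: \<omega>_def star_scaleR scale one complex_eq_iff)
    moreover have "z *\<^sub>C b = (z *\<^sub>C 1) * b" by (simp add: mult_scaleC_left)
    ultimately show ?thesis using 2 by metis
  qed
  have 5: "\<omega> 1 = 1" using uniq[of 1 1 0] scale[of 0 0] by (simp add: \<omega>_def one complex_eq_iff)
  have c: "character \<omega>" using 1 2 3 4 5 by (simp add: character_def)
  have "\<omega> h = of_real (norm h)"
    using uniq[of h h 0] positive_sa[OF h(1)] scale[of 0 0] by (simp add: \<omega>_def hn complex_eq_iff)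
  moreover have "\<omega> h = of_real ((cmod (\<omega> a))\<^sup>2)"
    using c by (simp add: h_def char_simps mult.commute[of "cnj _"] flip: complex_norm_square)
  ultimately have "(cmod (\<omega> a))\<^sup>2 = (norm a)\<^sup>2" using n of_real_eq_iff by metis
  then have "cmod (\<omega> a) = norm a" by (simp add: power2_eq_iff_nonneg)
  with c show ?thesis by blast
qed

text \<open>The bound \<open>0 \<le> r\<close> settles \<open>a = 0\<close>; the zero algebra has no
  character at all.\<close>

lemma norm_le_char:
  assumes "\<And>\<omega>. character \<omega> \<Longrightarrow> cmod (\<omega> a) \<le> r" "0 \<le> r"
  shows "norm a \<le> r"
proof (cases "a = 0")
  case False
  then show ?thesis using ex_character assms(1) by metis
qed (use assms(2) in simp)

lemma char_eqI: "(\<And>\<omega>. character \<omega> \<Longrightarrow> \<omega> a = \<omega> b) \<Longrightarrow> a = b"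
  using norm_le_char[of "a - b" 0] by (simp add: char_diff)

lemma self_adjoint_charI: "(\<And>\<omega>. character \<omega> \<Longrightarrow> Im (\<omega> a) = 0) \<Longrightarrow> star a = a"
  by (rule char_eqI) (simp add: char_star complex_eq_iff)

lemma positive_charI:
  assumes "\<And>\<omega>. character \<omega> \<Longrightarrow> Im (\<omega> a) = 0" "\<And>\<omega>. character \<omega> \<Longrightarrow> 0 \<le> Re (\<omega> a)"
  shows "positive a"
proof -
  have "norm (norm a *\<^sub>R 1 - a) \<le> norm a"
  proof (rule norm_le_char)
    fix \<omega> :: "'a \<Rightarrow> complex" assume c: "character \<omega>"
    have "\<omega> a = of_real (Re (\<omega> a))" using assms(1)[OF c] by (simp add: complex_eq_iff)
    moreover have "Re (\<omega> a) \<le> norm a" using norm_char_le[OF c, of a] complex_Re_le_cmod order_trans by blast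
    moreover have "\<omega> (norm a *\<^sub>R 1 - a) = of_real (norm a) - \<omega> a" using c by (simp add: char_simps)
    then have "cmod (\<omega> (norm a *\<^sub>R 1 - a)) = \<bar>norm a - Re (\<omega> a)\<bar>"
      using \<open>\<omega> a = of_real (Re (\<omega> a))\<close> by (metis norm_of_real of_real_diff)
    ultimately show "cmod (\<omega> (norm a *\<^sub>R 1 - a)) \<le> norm a"
      using assms(2)[OF c] by linarith
  qed simp
  then show ?thesis using self_adjoint_charI[OF assms(1)] by (auto simp: positive_def)
qed

text \<open>Characters compute the approximate roots \<open>k n\<close> as real square roots of
  \<open>\<omega> a + 1 / (n + 1)\<close>. Since the real square root is subadditive, these values
  are Cauchy uniformly in \<open>\<omega>\<close>, so the sequence is Cauchy in norm.\<close>

lemma positive_square_root: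
  assumes a: "positive a"
  shows "\<exists>s. positive s \<and> s * s = a"
proof -
  have "\<exists>k. positive k \<and> a + (1 / real (Suc n)) *\<^sub>R 1 = k * k" for n
    using positive_approx_square[OF a, of "1 / real (Suc n)"] by auto
  then obtain k where k: "\<And>n. positive (k n)" "\<And>n. a + (1 / real (Suc n)) *\<^sub>R 1 = k n * k n" by metis
  have ck: "\<omega> (k n) = of_real (sqrt (Re (\<omega> a) + 1 / real (Suc n)))" if c: "character \<omega>" for \<omega> n
  proof -
    have *: "\<omega> (k n) = of_real (Re (\<omega> (k n)))"
      using char_self_adjoint_Im[OF c positive_sa[OF k(1)]] by (simp add: complex_eq_iff)
    have "\<omega> a + of_real (1 / real (Suc n)) = \<omega> (k n) * \<omega> (k n)"
      using arg_cong[OF k(2)[of n], of \<omega>] c by (simp add: char_simps)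
    then have "Re (\<omega> a) + 1 / real (Suc n) = Re (\<omega> (k n) * \<omega> (k n))"
      by (metis Re_complex_of_real plus_complex.sel(1))
    also have "\<dots> = (Re (\<omega> (k n)))\<^sup>2"
      using char_self_adjoint_Im[OF c positive_sa[OF k(1)]] by (simp add: power2_eq_square)
    finally have "sqrt (Re (\<omega> a) + 1 / real (Suc n)) = Re (\<omega> (k n))"
      using char_positive[OF c k(1)[of n]] by simp
    with * show ?thesis by simp
  qed
  have bd: "norm (k n - k m) \<le> sqrt (1 / real (Suc N))" if "N \<le> n" "N \<le> m" for n m N
  proof (rule norm_le_char)
    fix \<omega> :: "'a \<Rightarrow> complex" assume c: "character \<omega>"
    define p where "p = Re (\<omega> a)"
    have p: "0 \<le> p" using char_positive[OF c a] by (simp add: p_def)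
    have le: "sqrt (p + x) - sqrt (p + y) \<le> sqrt (1 / real (Suc N))"
      if "0 \<le> x" "0 \<le> y" "x \<le> 1 / real (Suc N)" for x y
    proof -
      have "sqrt (p + x) \<le> sqrt (p + y) + sqrt x"
        using sqrt_add_le_add_sqrt[of "p + y" x] that p
        by (smt (verit) real_sqrt_le_mono)
      then show ?thesis using that(3) real_sqrt_le_mono[of x "1 / real (Suc N)"] by linarith
    qed
    have "1 / real (Suc n) \<le> 1 / real (Suc N)" "1 / real (Suc m) \<le> 1 / real (Suc N)"
      using that by (simp_all add: divide_simps)
    then have "\<bar>sqrt (p + 1 / real (Suc n)) - sqrt (p + 1 / real (Suc m))\<bar> \<le> sqrt (1 / real (Suc N))"
      using le[of "1 / real (Suc n)" "1 / real (Suc m)"] le[of "1 / real (Suc m)" "1 / real (Suc n)"]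
      by (simp add: abs_le_iff)
    then show "cmod (\<omega> (k n - k m)) \<le> sqrt (1 / real (Suc N))"
      using c by (simp add: char_diff ck p_def flip: of_real_diff)
  qed simp
  have "Cauchy k"
  proof (rule metric_CauchyI)
    fix e :: real assume e: "0 < e"
    then obtain N where N: "1 / real (Suc N) < e\<^sup>2" using nat_approx_posE[of "e\<^sup>2"] by auto
    then have "sqrt (1 / real (Suc N)) < e" using e by (smt (verit) real_less_lsqrt)
    then show "\<exists>M. \<forall>m\<ge>M. \<forall>n\<ge>M. dist (k m) (k n) < e"
      using bd by (metis dist_norm le_less_trans)
  qed
  then obtain s where s: "k \<longlonglongrightarrow> s" using Cauchy_convergent convergent_def by blast
  have "(\<lambda>n. a + (1 / real (Suc n)) *\<^sub>R 1) \<longlonglongrightarrow> a + 0 *\<^sub>R 1"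
    by (intro tendsto_intros LIMSEQ_Suc[OF lim_1_over_n])
  moreover have "(\<lambda>n. a + (1 / real (Suc n)) *\<^sub>R 1) \<longlonglongrightarrow> s * s"
    unfolding k(2) by (intro tendsto_mult s)
  ultimately have "s * s = a" using LIMSEQ_unique by fastforce
  moreover have "positive s"
  proof (rule positive_charI)
    fix \<omega> :: "'a \<Rightarrow> complex" assume c: "character \<omega>"
    have l: "(\<lambda>n. \<omega> (k n)) \<longlonglongrightarrow> \<omega> s" using bounded_linear.tendsto[OF bounded_linear_char[OF c] s] .
    show "Im (\<omega> s) = 0"
      using tendsto_Im[OF l] unfolding char_self_adjoint_Im[OF c positive_sa[OF k(1)]] LIMSEQ_const_iff
      by simp
    show "0 \<le> Re (\<omega> s)" using tendsto_Re[OF l]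
      by (rule LIMSEQ_le_const) (use char_positive[OF c k(1)] in blast)
  qed
  ultimately show ?thesis by blast
qed

lemma cstar_le_iff_positive: "cstar_le a b \<longleftrightarrow> positive (b - (a::'a::comm_unital_cstar_algebra))"
  by (metis cstar_le_def positive_star_mult positive_square_root positive_sa)

lemma cstar_le_iff_char:
  fixes a b :: "'a::comm_unital_cstar_algebra"
  shows "cstar_le a b \<longleftrightarrow> (\<forall>\<omega>. character \<omega> \<longrightarrow> Im (\<omega> a) = Im (\<omega> b) \<and> Re (\<omega> a) \<le> Re (\<omega> b))"
proof
  assume "cstar_le a b"
  then have p: "positive (b - a)" by (simp add: cstar_le_iff_positive)
  show "\<forall>\<omega>. character \<omega> \<longrightarrow> Im (\<omega> a) = Im (\<omega> b) \<and> Re (\<omega> a) \<le> Re (\<omega> b)"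
    using char_positive[OF _ p] char_self_adjoint_Im[OF _ positive_sa[OF p]]
    by (simp add: char_diff)
next
  assume "\<forall>\<omega>. character \<omega> \<longrightarrow> Im (\<omega> a) = Im (\<omega> b) \<and> Re (\<omega> a) \<le> Re (\<omega> b)"
  then show "cstar_le a b"
    unfolding cstar_le_iff_positive by (intro positive_charI) (simp_all add: char_diff)
qed

text \<open>\<open>b + e\<close> is a multiple of \<open>1 - x\<close> with the norm of
  \<open>x\<close> below \<open>1\<close>; the fixed point \<open>y = 1 + x y\<close> is the sum of
  the Neumann series.\<close>

lemma positive_inverse:
  fixes b :: "'a::comm_unital_cstar_algebra"
  assumes b: "positive b" and e: "0 < e"
  shows "\<exists>i. i * (b + e *\<^sub>R 1) = 1"
proof -
  define t where "t = norm b + e"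
  define x where "x = (1 / t) *\<^sub>R (norm b *\<^sub>R 1 - b)"
  have t: "0 < t" using e by (simp add: t_def add_nonneg_pos)
  have x: "norm x < 1" using positive_norm_shift[OF b] t e by (simp add: x_def t_def divide_simps)
  have "\<exists>!y\<in>UNIV. 1 + x * y = y"
  proof (rule Banach_fix[of _ "norm x"])
    show "dist (1 + x * y) (1 + x * z) \<le> norm x * dist y z" for y z
      using norm_mult_ineq[of x "y - z"] by (simp add: dist_norm right_diff_distrib)
  qed (use x in \<open>auto simp: complete_UNIV\<close>)
  then obtain y where "1 + x * y = y" by auto
  then have y: "(1 - x) * y = 1" by (simp add: algebra_simps)
  have "t *\<^sub>R (1 - x) = t *\<^sub>R 1 - (norm b *\<^sub>R 1 - b)" using t by (simp add: x_def scaleR_diff_right)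
  then have "t *\<^sub>R (1 - x) = b + e *\<^sub>R 1" by (simp add: t_def algebra_simps)
  then have "((1/t) *\<^sub>R y) * (b + e *\<^sub>R 1) = ((1/t) *\<^sub>R y) * (t *\<^sub>R (1 - x))" by simp
  also have "\<dots> = 1" using y t by (simp add: mult.commute)
  finally show ?thesis by blast
qed

subsection \<open>Square-summable families\<close>

text \<open>Estimates by characters concern finite sums, so summability is always reduced to finite
  sets that avoid a fixed one.\<close>

lemma summable_on_Cauchy_criterion:
  fixes f :: "'i \<Rightarrow> 'b::banach"
  shows "f summable_on A \<longleftrightarrow> (\<forall>e>0. \<exists>F0. finite F0 \<and> F0 \<subseteq> A \<and>
    (\<forall>F. finite F \<and> F \<subseteq> A \<and> F \<inter> F0 = {} \<longrightarrow> norm (sum f F) \<le> e))" (is "_ \<longleftrightarrow> ?R")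
proof
  assume "f summable_on A"
  then obtain S where S: "(sum f \<longlongrightarrow> S) (finite_subsets_at_top A)"
    by (auto simp: summable_on_def has_sum_def)
  show ?R
  proof (intro allI impI)
    fix e :: real assume "0 < e"
    then have "eventually (\<lambda>F. dist (sum f F) S < e/2) (finite_subsets_at_top A)"
      by (intro tendstoD[OF S]) simp
    then obtain F0 where F0: "finite F0" "F0 \<subseteq> A"
      "\<forall>F. finite F \<and> F0 \<subseteq> F \<and> F \<subseteq> A \<longrightarrow> dist (sum f F) S < e/2"
      unfolding eventually_finite_subsets_at_top by (elim exE conjE)
    have "norm (sum f F) \<le> e" if "finite F" "F \<subseteq> A" "F \<inter> F0 = {}" for F
    proof -
      have "sum f (F \<union> F0) = sum f F + sum f F0" using that F0 by (intro sum.union_disjoint)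
      moreover have "dist (sum f (F \<union> F0)) S < e/2" "dist (sum f F0) S < e/2"
        using F0 that by (meson Un_least finite_UnI sup_ge2 order_refl)+
      ultimately show ?thesis using dist_triangle_half_l[of "sum f (F \<union> F0)" S e "sum f F0"]
        by (simp add: dist_norm)
    qed
    then show "\<exists>F0. finite F0 \<and> F0 \<subseteq> A \<and> (\<forall>F. finite F \<and> F \<subseteq> A \<and> F \<inter> F0 = {} \<longrightarrow> norm (sum f F) \<le> e)"
      using F0(1,2) by blast
  qed
next
  assume R: ?R
  have "cauchy_filter (filtermap (sum f) (finite_subsets_at_top A))"
    unfolding cauchy_filter_metric_filtermap
  proof (intro allI impI)
    fix e :: real assume "0 < e"
    then have "0 < e/3" by simp
    from R[rule_format, OF this] obtain F0 where F0: "finite F0" "F0 \<subseteq> A"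
      "\<forall>F. finite F \<and> F \<subseteq> A \<and> F \<inter> F0 = {} \<longrightarrow> norm (sum f F) \<le> e/3"
      by (elim exE conjE)
    have *: "dist (sum f F) (sum f F0) \<le> e/3" if "finite F" "F0 \<subseteq> F" "F \<subseteq> A" for F
    proof -
      have "sum f F - sum f F0 = sum f (F - F0)" using that by (simp add: sum_diff)
      moreover have "norm (sum f (F - F0)) \<le> e/3" using F0(3) that by blast
      ultimately show ?thesis by (simp add: dist_norm)
    qed
    show "\<exists>P. eventually P (finite_subsets_at_top A) \<and> (\<forall>F F'. P F \<and> P F' \<longrightarrow> dist (sum f F) (sum f F') < e)"
    proof (intro exI conjI allI impI)
      show "eventually (\<lambda>F. finite F \<and> F0 \<subseteq> F \<and> F \<subseteq> A) (finite_subsets_at_top A)"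
        unfolding eventually_finite_subsets_at_top using F0 by blast
      show "dist (sum f F) (sum f F') < e"
        if "(finite F \<and> F0 \<subseteq> F \<and> F \<subseteq> A) \<and> (finite F' \<and> F0 \<subseteq> F' \<and> F' \<subseteq> A)" for F F'
        using *[of F] *[of F'] that \<open>0 < e\<close> dist_triangle2[of "sum f F" "sum f F'" "sum f F0"] by auto
    qed
  qed
  moreover have "complete (UNIV::'b set)"
    by (meson Cauchy_convergent UNIV_I complete_def convergent_def)
  ultimately obtain L' where "(sum f \<longlongrightarrow> L') (finite_subsets_at_top A)"
    using complete_uniform[where S=UNIV] by (force simp add: filterlim_def)
  then show "f summable_on A" using summable_on_def has_sum_def by blast
qed

text \<open>Under a single character a family becomes a scalar one, for which the triangle and
  Cauchy-Schwarz inequalities of \<open>L2_set\<close> hold.\<close>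

definition char_l2 :: "('a::comm_unital_cstar_algebra \<Rightarrow> complex) \<Rightarrow> ('i \<Rightarrow> 'a) \<Rightarrow> 'i set \<Rightarrow> real"
  where "char_l2 \<omega> f F = L2_set (\<lambda>i. cmod (\<omega> (f i))) F"

lemma char_l2_nonneg [simp]: "0 \<le> char_l2 \<omega> f F"
  by (simp add: char_l2_def)

lemma char_l2_square: "(char_l2 \<omega> f F)\<^sup>2 = (\<Sum>i\<in>F. (cmod (\<omega> (f i)))\<^sup>2)"
  by (simp add: char_l2_def L2_set_def sum_nonneg)

lemma char_mult_star: "character \<omega> \<Longrightarrow> \<omega> (a * star a) = of_real ((cmod (\<omega> a))\<^sup>2)"
  by (simp add: char_simps flip: complex_norm_square)

lemma char_sum_square: "character \<omega> \<Longrightarrow> \<omega> (\<Sum>i\<in>F. f i * star (f i)) = of_real ((char_l2 \<omega> f F)\<^sup>2)"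
  by (simp add: char_sum char_mult_star char_l2_square del: of_real_power)

lemma char_l2_triangle:
  assumes "character \<omega>"
  shows "char_l2 \<omega> (\<lambda>i. f i + g i) F \<le> char_l2 \<omega> f F + char_l2 \<omega> g F"
proof -
  have "char_l2 \<omega> (\<lambda>i. f i + g i) F \<le> L2_set (\<lambda>i. cmod (\<omega> (f i)) + cmod (\<omega> (g i))) F"
    unfolding char_l2_def by (intro L2_set_mono) (simp_all add: char_add[OF assms] norm_triangle_ineq)
  then show ?thesis unfolding char_l2_def by (rule order_trans[OF _ L2_set_triangle_ineq])
qed

lemma char_l2_Cauchy_Schwarz:
  assumes "character \<omega>"
  shows "cmod (\<omega> (\<Sum>i\<in>F. f i * star (g i))) \<le> char_l2 \<omega> f F * char_l2 \<omega> g F"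
proof -
  have "cmod (\<omega> (\<Sum>i\<in>F. f i * star (g i))) \<le> (\<Sum>i\<in>F. \<bar>cmod (\<omega> (f i))\<bar> * \<bar>cmod (\<omega> (g i))\<bar>)"
    using assms by (auto simp: char_sum char_simps norm_mult intro!: sum_norm_le)
  then show ?thesis unfolding char_l2_def by (rule order_trans[OF _ L2_set_mult_ineq])
qed

definition square_summable :: "('i \<Rightarrow> 'a::comm_unital_cstar_algebra) \<Rightarrow> 'i set \<Rightarrow> bool"
  where "square_summable f A \<longleftrightarrow> (\<lambda>i. f i * star (f i)) summable_on A"

lemma norm_sum_square_le_iff:
  fixes f :: "'i \<Rightarrow> 'a::comm_unital_cstar_algebra"
  assumes "0 \<le> r"
  shows "norm (\<Sum>i\<in>F. f i * star (f i)) \<le> r\<^sup>2 \<longleftrightarrow> (\<forall>\<omega>. character \<omega> \<longrightarrow> char_l2 \<omega> f F \<le> r)"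
proof safe
  fix \<omega> :: "'a \<Rightarrow> complex"
  assume n: "norm (\<Sum>i\<in>F. f i * star (f i)) \<le> r\<^sup>2" and c: "character \<omega>"
  have "(char_l2 \<omega> f F)\<^sup>2 \<le> r\<^sup>2"
    using order_trans[OF norm_char_le[OF c] n] unfolding char_sum_square[OF c] norm_of_real by simp
  then show "char_l2 \<omega> f F \<le> r" using assms power2_le_imp_le by blast
next
  assume "\<forall>\<omega>. character \<omega> \<longrightarrow> char_l2 \<omega> f F \<le> r"
  then show "norm (\<Sum>i\<in>F. f i * star (f i)) \<le> r\<^sup>2"
    by (intro norm_le_char) (simp_all only: char_sum_square norm_of_real abs_power2 power_mono char_l2_nonneg zero_le_power2)
qed

lemma square_summable_iff:
  fixes f :: "'i \<Rightarrow> 'a::comm_unital_cstar_algebra"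
  shows "square_summable f A \<longleftrightarrow> (\<forall>e>0. \<exists>F0. finite F0 \<and> F0 \<subseteq> A \<and>
    (\<forall>F. finite F \<and> F \<subseteq> A \<and> F \<inter> F0 = {} \<longrightarrow> (\<forall>\<omega>. character \<omega> \<longrightarrow> char_l2 \<omega> f F \<le> e)))" (is "_ \<longleftrightarrow> ?R")
proof -
  have "?R \<longleftrightarrow> (\<forall>e>0. \<exists>F0. finite F0 \<and> F0 \<subseteq> A \<and>
    (\<forall>F. finite F \<and> F \<subseteq> A \<and> F \<inter> F0 = {} \<longrightarrow> norm (\<Sum>i\<in>F. f i * star (f i)) \<le> e\<^sup>2))"
    by (simp add: norm_sum_square_le_iff)
  also have "\<dots> \<longleftrightarrow> (\<forall>e>0. \<exists>F0. finite F0 \<and> F0 \<subseteq> A \<and>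
    (\<forall>F. finite F \<and> F \<subseteq> A \<and> F \<inter> F0 = {} \<longrightarrow> norm (\<Sum>i\<in>F. f i * star (f i)) \<le> e))" (is "?X \<longleftrightarrow> ?Y")
  proof
    assume X: ?X
    show ?Y
    proof (intro allI impI)
      fix e :: real assume "0 < e"
      then show "\<exists>F0. finite F0 \<and> F0 \<subseteq> A \<and>
        (\<forall>F. finite F \<and> F \<subseteq> A \<and> F \<inter> F0 = {} \<longrightarrow> norm (\<Sum>i\<in>F. f i * star (f i)) \<le> e)"
        using X[rule_format, of "sqrt e"] by simp
    qed
  next
    assume Y: ?Y
    show ?X
    proof (intro allI impI)
      fix e :: real assume "0 < e"
      then show "\<exists>F0. finite F0 \<and> F0 \<subseteq> A \<and>
        (\<forall>F. finite F \<and> F \<subseteq> A \<and> F \<inter> F0 = {} \<longrightarrow> norm (\<Sum>i\<in>F. f i * star (f i)) \<le> e\<^sup>2)"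
        using Y[rule_format, of "e\<^sup>2"] by simp
    qed
  qed
  finally show ?thesis by (simp add: square_summable_def summable_on_Cauchy_criterion)
qed

lemma square_summable_tail:
  fixes f :: "'i \<Rightarrow> 'a::comm_unital_cstar_algebra"
  assumes "square_summable f A" "0 < e"
  shows "\<exists>F0. finite F0 \<and> F0 \<subseteq> A \<and>
    (\<forall>F. finite F \<and> F \<subseteq> A \<and> F \<inter> F0 = {} \<longrightarrow> (\<forall>\<omega>. character \<omega> \<longrightarrow> char_l2 \<omega> f F \<le> e))"
  using assms(1)[unfolded square_summable_iff, rule_format, OF assms(2)] .

lemma square_summable_char_bounded:
  fixes f :: "'i \<Rightarrow> 'a::comm_unital_cstar_algebra"
  assumes f: "square_summable f A" and c: "character \<omega>" and F: "finite F" "F \<subseteq> A"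
  shows "(char_l2 \<omega> f F)\<^sup>2 \<le> Re (\<omega> (\<Sum>\<^sub>\<infinity>i\<in>A. f i * star (f i)))"
proof -
  have "((\<lambda>i. f i * star (f i)) has_sum (\<Sum>\<^sub>\<infinity>i\<in>A. f i * star (f i))) A"
    using f by (simp add: square_summable_def)
  from has_sum_bounded_linear[OF bounded_linear_char[OF c] this]
  have "((\<lambda>i. Re (\<omega> (f i * star (f i)))) has_sum Re (\<omega> (\<Sum>\<^sub>\<infinity>i\<in>A. f i * star (f i)))) A"
    by (rule has_sum_bounded_linear[OF bounded_linear_Re])
  then have "((\<lambda>i. (cmod (\<omega> (f i)))\<^sup>2) has_sum Re (\<omega> (\<Sum>\<^sub>\<infinity>i\<in>A. f i * star (f i)))) A"
    by (simp add: char_mult_star[OF c] del: of_real_power)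
  from finite_sum_le_has_sum[OF this F] show ?thesis by (simp add: char_l2_square)
qed

lemma summable_on_mult_star:
  fixes f g :: "'i \<Rightarrow> 'a::comm_unital_cstar_algebra"
  assumes f: "square_summable f A" and g: "square_summable g A"
  shows "(\<lambda>i. f i * star (g i)) summable_on A"
  unfolding summable_on_Cauchy_criterion
proof (intro allI impI)
  fix e :: real assume e: "0 < e"
  obtain F0 where F0: "finite F0" "F0 \<subseteq> A"
    "\<forall>F. finite F \<and> F \<subseteq> A \<and> F \<inter> F0 = {} \<longrightarrow> (\<forall>\<omega>. character \<omega> \<longrightarrow> char_l2 \<omega> f F \<le> sqrt e)"
    using square_summable_tail[OF f real_sqrt_gt_zero[OF e]] by (elim exE conjE)
  obtain F1 where F1: "finite F1" "F1 \<subseteq> A"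
    "\<forall>F. finite F \<and> F \<subseteq> A \<and> F \<inter> F1 = {} \<longrightarrow> (\<forall>\<omega>. character \<omega> \<longrightarrow> char_l2 \<omega> g F \<le> sqrt e)"
    using square_summable_tail[OF g real_sqrt_gt_zero[OF e]] by (elim exE conjE)
  have "norm (\<Sum>i\<in>F. f i * star (g i)) \<le> e" if F: "finite F" "F \<subseteq> A" "F \<inter> (F0 \<union> F1) = {}" for F
  proof (rule norm_le_char)
    fix \<omega> :: "'a \<Rightarrow> complex" assume c: "character \<omega>"
    have "char_l2 \<omega> f F * char_l2 \<omega> g F \<le> sqrt e * sqrt e"
      using F c e by (intro mult_mono F0(3)[rule_format] F1(3)[rule_format]) auto
    then show "cmod (\<omega> (\<Sum>i\<in>F. f i * star (g i))) \<le> e"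
      using order_trans[OF char_l2_Cauchy_Schwarz[OF c]] e by fastforce
  qed (use e in simp)
  then show "\<exists>F0. finite F0 \<and> F0 \<subseteq> A \<and> (\<forall>F. finite F \<and> F \<subseteq> A \<and> F \<inter> F0 = {} \<longrightarrow>
      norm (\<Sum>i\<in>F. f i * star (g i)) \<le> e)"
    using F0(1,2) F1(1,2) by (intro exI[of _ "F0 \<union> F1"]) auto
qed

lemma square_summable_add:
  fixes f g :: "'i \<Rightarrow> 'a::comm_unital_cstar_algebra"
  assumes f: "square_summable f A" and g: "square_summable g A"
  shows "square_summable (\<lambda>i. f i + g i) A"
  unfolding square_summable_iff
proof (intro allI impI)
  fix e :: real assume e: "0 < e"
  obtain F0 where F0: "finite F0" "F0 \<subseteq> A"
    "\<forall>F. finite F \<and> F \<subseteq> A \<and> F \<inter> F0 = {} \<longrightarrow> (\<forall>\<omega>. character \<omega> \<longrightarrow> char_l2 \<omega> f F \<le> e/2)"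
    using square_summable_tail[OF f half_gt_zero[OF e]] by (elim exE conjE)
  obtain F1 where F1: "finite F1" "F1 \<subseteq> A"
    "\<forall>F. finite F \<and> F \<subseteq> A \<and> F \<inter> F1 = {} \<longrightarrow> (\<forall>\<omega>. character \<omega> \<longrightarrow> char_l2 \<omega> g F \<le> e/2)"
    using square_summable_tail[OF g half_gt_zero[OF e]] by (elim exE conjE)
  have "char_l2 \<omega> (\<lambda>i. f i + g i) F \<le> e"
    if F: "finite F" "F \<subseteq> A" "F \<inter> (F0 \<union> F1) = {}" and c: "character \<omega>" for F \<omega>
  proof -
    have "char_l2 \<omega> f F \<le> e/2" by (rule F0(3)[rule_format]) (use F c in auto)
    moreover have "char_l2 \<omega> g F \<le> e/2" by (rule F1(3)[rule_format]) (use F c in auto)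
    ultimately show ?thesis using char_l2_triangle[OF c, of f g F] by linarith
  qed
  then show "\<exists>F0. finite F0 \<and> F0 \<subseteq> A \<and> (\<forall>F. finite F \<and> F \<subseteq> A \<and> F \<inter> F0 = {} \<longrightarrow>
      (\<forall>\<omega>. character \<omega> \<longrightarrow> char_l2 \<omega> (\<lambda>i. f i + g i) F \<le> e))"
    using F0(1,2) F1(1,2) by (intro exI[of _ "F0 \<union> F1"]) auto
qed

lemma square_summable_mult:
  fixes f :: "'i \<Rightarrow> 'a::comm_unital_cstar_algebra"
  assumes "square_summable f A"
  shows "square_summable (\<lambda>i. c * f i) A"
proof -
  have "(\<lambda>i. (c * star c) * (f i * star (f i))) summable_on A"
    using assms unfolding square_summable_def
    by (intro summable_on_bounded_linear[OF bounded_linear_mult_right])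
  then show ?thesis unfolding square_summable_def by (simp add: star_mult ac_simps)
qed

lemma square_summable_reindex:
  "bij_betw g A B \<Longrightarrow> square_summable (\<lambda>i. f (g i)) A \<longleftrightarrow> square_summable f B"
  unfolding square_summable_def by (rule summable_on_reindex_bij_betw)

section \<open>Hilbert modules over commutative C*-algebras\<close>

locale comm_hilbert_module = hilbert_module act ip
  for act :: "'a::comm_unital_cstar_algebra \<Rightarrow> 'h::complex_banach \<Rightarrow> 'h"
    and ip :: "'h \<Rightarrow> 'h \<Rightarrow> 'a"
begin

lemma ip_add_right: "ip x (y + z) = ip x y + ip x z"
  by (metis ip_add_left ip_star star_add)

lemma ip_scaleC_right: "ip x (c *\<^sub>C y) = cnj c *\<^sub>C ip x y"
  by (metis ip_scaleC_left ip_star star_scaleC)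

lemma ip_act_right: "ip x (act a y) = star a * ip x y"
  by (metis ip_act_left ip_star star_mult mult.commute)

lemma ip_scaleR_left: "ip (r *\<^sub>R x) y = r *\<^sub>R ip x y"
  by (simp add: scaleR_scaleC ip_scaleC_left)

lemma ip_scaleR_right: "ip x (r *\<^sub>R y) = r *\<^sub>R ip x y"
  by (simp add: scaleR_scaleC ip_scaleC_right)

lemma ip_zero_left [simp]: "ip 0 y = 0"
  using ip_scaleR_left[of 0 0 y] by simp

lemma ip_zero_right [simp]: "ip x 0 = 0"
  using ip_scaleR_right[of x 0 0] by simp

lemma ip_minus_left: "ip (- x) y = - ip x y"
  using ip_scaleR_left[of "- 1" x y] by simp

lemma ip_minus_right: "ip x (- y) = - ip x y"
  using ip_scaleR_right[of x "- 1" y] by simp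

lemma ip_diff_left: "ip (x - y) z = ip x z - ip y z"
  using ip_add_left[of x "- y" z] by (simp add: ip_minus_left)

lemma ip_diff_right: "ip x (y - z) = ip x y - ip x z"
  using ip_add_right[of x y "- z"] by (simp add: ip_minus_right)

lemmas ip_simps = ip_add_left ip_add_right ip_diff_left ip_diff_right ip_minus_left ip_minus_right
  ip_scaleR_left ip_scaleR_right ip_scaleC_left ip_scaleC_right ip_act_left ip_act_right

lemma ip_sum_left: "ip (sum f F) y = (\<Sum>i\<in>F. ip (f i) y)"
  by (induction F rule: infinite_finite_induct) (simp_all add: ip_simps)

lemma ip_ext: "(\<And>z. ip x z = ip y z) \<Longrightarrow> x = y"
  by (metis eq_iff_diff_eq_0 ip_diff_left ip_eq_0_iff)

text \<open>The axioms of \<open>hilbert_module\<close> do not mention a unit; \<open>1\<close> acts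
  as the identity because the inner product separates vectors.\<close>

lemma act_scaleR_one: "act (r *\<^sub>R 1) x = r *\<^sub>R x"
  by (rule ip_ext) (simp add: ip_simps)

lemma positive_ip: "positive (ip x x)"
  using ip_nonneg[of x] by (simp add: cstar_le_iff_positive)

lemma char_ip_Im: "character \<omega> \<Longrightarrow> Im (\<omega> (ip x x)) = 0"
  using char_self_adjoint_Im positive_sa positive_ip by blast

lemma char_ip_nonneg: "character \<omega> \<Longrightarrow> 0 \<le> Re (\<omega> (ip x x))"
  using char_positive positive_ip by blast

lemma char_ip_real: "character \<omega> \<Longrightarrow> \<omega> (ip x x) = of_real (Re (\<omega> (ip x x)))"
  by (simp add: complex_eq_iff char_ip_Im)

lemma char_ip_cnj: "character \<omega> \<Longrightarrow> \<omega> (ip x y) = cnj (\<omega> (ip y x))"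
  by (metis char_star ip_star)

lemma norm_square: "(norm x)\<^sup>2 = norm (ip x x)"
  by (simp add: norm_ip)

lemma char_ip_le: "character \<omega> \<Longrightarrow> Re (\<omega> (ip x x)) \<le> (norm x)\<^sup>2"
  unfolding norm_square using norm_char_le complex_Re_le_cmod order_trans by blast

lemma norm_leI:
  assumes "\<And>\<omega>. character \<omega> \<Longrightarrow> Re (\<omega> (ip x x)) \<le> r\<^sup>2" "0 \<le> r"
  shows "norm x \<le> r"
proof -
  have "norm (ip x x) \<le> r\<^sup>2"
  proof (rule norm_le_char)
    fix \<omega> :: "'a \<Rightarrow> complex" assume c: "character \<omega>"
    show "cmod (\<omega> (ip x x)) \<le> r\<^sup>2"
      using assms(1)[OF c] char_ip_nonneg[OF c, of x] by (subst char_ip_real[OF c]) (simp only: norm_of_real)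
  qed simp
  then show ?thesis using assms(2) power2_le_imp_le by (metis norm_square)
qed

lemma char_quadratic:
  assumes c: "character \<omega>"
  shows "Re (\<omega> (ip (s *\<^sub>C x - t *\<^sub>C y) (s *\<^sub>C x - t *\<^sub>C y))) =
    (cmod s)\<^sup>2 * Re (\<omega> (ip x x)) - 2 * Re (s * cnj t * \<omega> (ip x y)) + (cmod t)\<^sup>2 * Re (\<omega> (ip y y))"
proof -
  have "\<omega> (ip (s *\<^sub>C x - t *\<^sub>C y) (s *\<^sub>C x - t *\<^sub>C y)) =
     (s * cnj s) * \<omega> (ip x x) - s * cnj t * \<omega> (ip x y) - cnj (s * cnj t * \<omega> (ip x y)) + (t * cnj t) * \<omega> (ip y y)"
    using c by (simp add: ip_simps char_simps char_ip_cnj[OF c, of y x] algebra_simps)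
  also have "\<dots> = of_real ((cmod s)\<^sup>2) * \<omega> (ip x x) - s * cnj t * \<omega> (ip x y) - cnj (s * cnj t * \<omega> (ip x y))
     + of_real ((cmod t)\<^sup>2) * \<omega> (ip y y)"
    by (simp only: complex_norm_square)
  finally show ?thesis
    by (simp only: plus_complex.sel minus_complex.sel cnj.sel Re_complex_of_real Im_complex_of_real times_complex.sel) simp
qed

text \<open>The scalar form \<open>\<omega> (ip x y)\<close> may be degenerate. Taking
  \<open>(r, q)\<close> and \<open>(cnj q, p)\<close> for \<open>(s, t)\<close> gives the inequality
  multiplied by \<open>r\<close> and by \<open>p\<close>; if both vanish, \<open>(1, q)\<close>
  forces \<open>n = 0\<close>.\<close>

lemma char_Cauchy_Schwarz:
  assumes c: "character \<omega>"
  shows "(cmod (\<omega> (ip x y)))\<^sup>2 \<le> Re (\<omega> (ip x x)) * Re (\<omega> (ip y y))"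
proof -
  define p where "p = Re (\<omega> (ip x x))"
  define r where "r = Re (\<omega> (ip y y))"
  define q where "q = \<omega> (ip x y)"
  define n where "n = (cmod q)\<^sup>2"
  have p: "0 \<le> p" and r: "0 \<le> r" using char_ip_nonneg[OF c] by (auto simp: p_def r_def)
  have n: "cnj q * q = of_real n" "q * cnj q = of_real n"
    unfolding n_def by (simp_all only: complex_norm_square mult.commute)
  have quad: "0 \<le> (cmod s)\<^sup>2 * p - 2 * Re (s * cnj t * q) + (cmod t)\<^sup>2 * r" for s t
    using char_ip_nonneg[OF c, of "s *\<^sub>C x - t *\<^sub>C y"] unfolding char_quadratic[OF c] p_def r_def q_def .
  have 1: "0 \<le> r * (r * p - n)"
  proof -
    have "Re (of_real r * cnj q * q) = r * n" unfolding mult.assoc n by simp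
    then show ?thesis using quad[of "of_real r" q] r by (simp add: n_def power2_eq_square algebra_simps)
  qed
  have 2: "0 \<le> p * (r * p - n)"
  proof -
    have "cnj q * cnj (of_real p) * q = of_real p * (cnj q * q)" by (simp add: ac_simps)
    then have "Re (cnj q * cnj (of_real p) * q) = p * n" unfolding n by (simp only:) simp
    then show ?thesis using quad[of "cnj q" "of_real p"] p by (simp add: n_def power2_eq_square algebra_simps)
  qed
  have "n \<le> p * r"
  proof (cases "p = 0 \<and> r = 0")
    case True
    have "Re (1 * cnj q * q) = n" using n by simp
    then have "n \<le> 0" using quad[of 1 q] True by simp
    then show ?thesis using True by simp
  next
    case False
    then show ?thesis using 1 2 p r by (auto simp: zero_le_mult_iff mult.commute)
  qed
  then show ?thesis by (simp add: n_def p_def q_def r_def)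
qed

lemma norm_ip_le: "norm (ip x y) \<le> norm x * norm y"
proof (rule norm_le_char)
  fix \<omega> :: "'a \<Rightarrow> complex" assume c: "character \<omega>"
  have "(cmod (\<omega> (ip x y)))\<^sup>2 \<le> (norm x)\<^sup>2 * (norm y)\<^sup>2"
    using char_Cauchy_Schwarz[OF c, of x y] mult_mono[OF char_ip_le[OF c, of x] char_ip_le[OF c, of y]]
      char_ip_nonneg[OF c, of y] by simp
  then show "cmod (\<omega> (ip x y)) \<le> norm x * norm y"
    by (metis mult_nonneg_nonneg norm_ge_zero power2_le_imp_le power_mult_distrib)
qed simp

lemma norm_act_le: "norm (act a x) \<le> norm a * norm x"
proof -
  have "(norm (act a x))\<^sup>2 = norm (a * star a * ip x x)" by (simp add: norm_square ip_simps ac_simps)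
  also have "\<dots> \<le> norm a * norm a * (norm x)\<^sup>2" unfolding norm_square
    using order_trans[OF norm_mult_ineq mult_right_mono[OF norm_mult_ineq[of a "star a"] norm_ge_zero]] by simp
  finally show ?thesis
    by (metis mult_nonneg_nonneg norm_ge_zero power2_eq_square power2_le_imp_le power_mult_distrib)
qed

lemma bounded_linear_ip_left: "bounded_linear (\<lambda>x. ip x y)"
  by (rule bounded_linear_intro[of _ "norm y"]) (simp_all add: ip_simps norm_ip_le)

lemma bounded_linear_ip_right: "bounded_linear (ip x)"
  by (rule bounded_linear_intro[of _ "norm x"])
    (simp_all add: ip_simps norm_ip_le mult.commute[of "norm _" "norm x"])

lemma tendsto_ip:
  assumes "(f \<longlongrightarrow> x) F" "(g \<longlongrightarrow> y) F"
  shows "((\<lambda>n. ip (f n) (g n)) \<longlongrightarrow> ip x y) F"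
proof -
  have "bounded_bilinear ip"
    by (rule bounded_bilinear.intro)
      (auto simp: ip_simps intro!: exI[of _ 1] norm_ip_le)
  then show ?thesis using assms by (rule bounded_bilinear.tendsto)
qed

end

section \<open>Adjoint pairs between two modules\<close>

definition adj_pair :: "('h::real_normed_vector \<Rightarrow> 'h \<Rightarrow> 'a) \<Rightarrow> ('k::real_normed_vector \<Rightarrow> 'k \<Rightarrow> 'a)
    \<Rightarrow> ('h \<Rightarrow> 'k) \<Rightarrow> ('k \<Rightarrow> 'h) \<Rightarrow> bool"
  where "adj_pair ip1 ip2 T S \<longleftrightarrow> (\<forall>x y. ip2 (T x) y = ip1 x (S y)) \<and> (\<exists>B. \<forall>x. norm (T x) \<le> B * norm x)"

lemma adj_pairD: "adj_pair ip1 ip2 T S \<Longrightarrow> ip2 (T x) y = ip1 x (S y)"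
  by (simp add: adj_pair_def)

lemma adj_pair_bound:
  assumes "adj_pair ip1 ip2 T S"
  obtains B where "0 < B" "\<And>x. norm (T x) \<le> B * norm x"
proof -
  obtain B where "\<And>x. norm (T x) \<le> B * norm x" using assms by (auto simp: adj_pair_def)
  then have "norm (T x) \<le> (\<bar>B\<bar> + 1) * norm x" for x
    by (smt (verit) mult_right_mono norm_ge_zero)
  then show thesis by (intro that[of "\<bar>B\<bar> + 1"]) auto
qed

lemma adj_pair_comp:
  assumes T: "adj_pair ip1 ip2 T S" and T': "adj_pair ip2 ip3 T' S'"
  shows "adj_pair ip1 ip3 (\<lambda>x. T' (T x)) (\<lambda>x. S (S' x))"
proof -
  obtain B where B: "\<And>x. norm (T x) \<le> B * norm x" using T by (auto simp: adj_pair_def)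
  obtain B' where B': "0 < B'" "\<And>x. norm (T' x) \<le> B' * norm x" using adj_pair_bound[OF T'] by blast
  have "norm (T' (T x)) \<le> (B' * B) * norm x" for x
    using order_trans[OF B'(2)[of "T x"] mult_left_mono[OF B[of x], of B']] B'(1) by (simp add: mult.assoc)
  then show ?thesis using T T' unfolding adj_pair_def by auto
qed

lemma adj_pair_id: "adj_pair ip ip (\<lambda>x. x) (\<lambda>x. x)"
  by (auto simp: adj_pair_def intro!: exI[of _ 1])

locale hilbert_module_pair = M1: comm_hilbert_module act1 ip1 + M2: comm_hilbert_module act2 ip2
  for act1 :: "'a::comm_unital_cstar_algebra \<Rightarrow> 'h::complex_banach \<Rightarrow> 'h"
    and ip1 :: "'h \<Rightarrow> 'h \<Rightarrow> 'a"
    and act2 :: "'a \<Rightarrow> 'k::complex_banach \<Rightarrow> 'k"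
    and ip2 :: "'k \<Rightarrow> 'k \<Rightarrow> 'a"
begin

text \<open>Linearity is not built into \<open>adj_pair\<close>: here and in the next lemmas it
  follows from the adjoint relation, because inner products separate vectors.\<close>

lemma adj_act: "adj_pair ip1 ip2 T S \<Longrightarrow> T (act1 a x) = act2 a (T x)"
  by (rule M2.ip_ext) (simp add: adj_pairD M1.ip_simps M2.ip_simps)

lemma adj_add: "adj_pair ip1 ip2 T S \<Longrightarrow> T (x + y) = T x + T y"
  by (rule M2.ip_ext) (simp add: adj_pairD M1.ip_simps M2.ip_simps)

lemma adj_diff: "adj_pair ip1 ip2 T S \<Longrightarrow> T (x - y) = T x - T y"
  by (rule M2.ip_ext) (simp add: adj_pairD M1.ip_simps M2.ip_simps)

lemma adj_scaleR: "adj_pair ip1 ip2 T S \<Longrightarrow> T (r *\<^sub>R x) = r *\<^sub>R T x"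
  by (rule M2.ip_ext) (simp add: adj_pairD M1.ip_simps M2.ip_simps)

lemma adj_zero: "adj_pair ip1 ip2 T S \<Longrightarrow> T 0 = 0"
  using adj_scaleR[of T S 0 0] by simp

lemma adj_bounded_linear: "adj_pair ip1 ip2 T S \<Longrightarrow> bounded_linear T"
proof -
  assume T: "adj_pair ip1 ip2 T S"
  then obtain B where "\<And>x. norm (T x) \<le> norm x * B"
    unfolding adj_pair_def by (auto simp: mult.commute)
  with T show ?thesis by (intro bounded_linear_intro) (simp_all add: adj_add adj_scaleR)
qed

lemma adj_norm_le:
  assumes T: "adj_pair ip1 ip2 T S" and B: "\<And>x. norm (T x) \<le> B * norm x" "0 \<le> B"
  shows "norm (S y) \<le> B * norm y"
proof (cases "norm (S y) = 0")
  case False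
  have "norm (S y) * norm (S y) = norm (ip2 (T (S y)) y)"
    by (simp add: adj_pairD[OF T] flip: M1.norm_square power2_eq_square)
  also have "\<dots> \<le> (B * norm (S y)) * norm y"
    by (rule order_trans[OF M2.norm_ip_le mult_right_mono[OF B(1)]]) simp
  also have "\<dots> = (B * norm y) * norm (S y)" by simp
  finally show ?thesis by (rule mult_right_le_imp_le) (use False in simp)
qed (use B in simp)

lemma adj_sym:
  assumes T: "adj_pair ip1 ip2 T S" shows "adj_pair ip2 ip1 S T"
proof -
  have "ip1 (S y) x = ip2 y (T x)" for x y
    using adj_pairD[OF T, of x y] by (metis M1.ip_star M2.ip_star)
  moreover obtain B where B: "0 < B" "\<And>x. norm (T x) \<le> B * norm x" using adj_pair_bound[OF T] by blast
  then have "norm (S y) \<le> B * norm y" for y by (intro adj_norm_le[OF T]) auto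
  ultimately show ?thesis by (auto simp: adj_pair_def)
qed

lemma adj_pair_plus:
  assumes T: "adj_pair ip1 ip2 T S" and T': "adj_pair ip1 ip2 T' S'"
  shows "adj_pair ip1 ip2 (\<lambda>x. T x + T' x) (\<lambda>x. S x + S' x)"
proof -
  obtain B B' where B: "\<And>x. norm (T x) \<le> B * norm x" "\<And>x. norm (T' x) \<le> B' * norm x"
    using T T' by (auto simp: adj_pair_def)
  have "norm (T x + T' x) \<le> (B + B') * norm x" for x
    using norm_triangle_mono[OF B(1) B(2)] by (simp add: distrib_right)
  then show ?thesis using T T' unfolding adj_pair_def by (auto simp: M1.ip_simps M2.ip_simps)
qed

lemma adj_pair_scaleR:
  assumes T: "adj_pair ip1 ip2 T S"
  shows "adj_pair ip1 ip2 (\<lambda>x. r *\<^sub>R T x) (\<lambda>x. r *\<^sub>R S x)"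
proof -
  obtain B where B: "\<And>x. norm (T x) \<le> B * norm x" using T by (auto simp: adj_pair_def)
  have "norm (r *\<^sub>R T x) \<le> (\<bar>r\<bar> * B) * norm x" for x using mult_left_mono[OF B, of "\<bar>r\<bar>"] by (simp add: mult.assoc)
  then show ?thesis using T unfolding adj_pair_def by (auto simp: M1.ip_simps M2.ip_simps)
qed

lemma adj_pair_minus:
  assumes T: "adj_pair ip1 ip2 T S" and T': "adj_pair ip1 ip2 T' S'"
  shows "adj_pair ip1 ip2 (\<lambda>x. T x - T' x) (\<lambda>x. S x - S' x)"
  using adj_pair_plus[OF T adj_pair_scaleR[OF T', of "- 1"]] by simp

text \<open>Testing on \<open>(\<langle>x,x\<rangle> + e)\<^sup>-\<^sup>1\<^sup>/\<^sup>2 x\<close> turns a norm bound into a bound under every character.\<close>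

lemma char_bound_of_norm_bound:
  assumes hom: "\<And>a x. T (act1 a x) = act2 a (T x)" and B: "\<And>x. norm (T x) \<le> B * norm x"
    and c: "character \<omega>"
  shows "Re (\<omega> (ip2 (T x) (T x))) \<le> B\<^sup>2 * Re (\<omega> (ip1 x x))"
proof (rule field_le_epsilon)
  fix d :: real assume d: "0 < d"
  \<comment> \<open>The \<open>+ 1\<close> ensures \<open>0 < e\<close> and
    \<open>B\<^sup>2 * e \<le> d\<close> for \<open>B = 0\<close> as well.\<close>
  define e where "e = d / (B\<^sup>2 + 1)"
  have B1: "0 < B\<^sup>2 + 1" by (smt (verit) zero_le_power2)
  have e: "0 < e" "B\<^sup>2 * e \<le> d"
    using d B1 by (simp_all add: e_def divide_simps mult.commute mult_left_mono)
  define b where "b = ip1 x x"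
  have b: "positive b" by (simp add: b_def M1.positive_ip)
  obtain i where i: "i * (b + e *\<^sub>R 1) = 1" using positive_inverse[OF b e(1)] by blast
  have "positive (b + e *\<^sub>R 1)" using b e by (intro positive_add positive_scaleR_one) auto
  then obtain s where s: "s * s = b + e *\<^sub>R 1" using positive_square_root by blast
  \<comment> \<open>\<open>a\<close> is an inverse square root of \<open>b + e\<close>.\<close>
  define a where "a = s * i"
  have "a * a * (b + e *\<^sub>R 1) = (i * (s * s)) * (i * (b + e *\<^sub>R 1))" by (simp add: a_def ac_simps)
  also have "\<dots> = 1" by (simp add: s i)
  finally have a: "a * a * (b + e *\<^sub>R 1) = 1" .
  have ca: "(cmod (\<phi> a))\<^sup>2 * (Re (\<phi> b) + e) = 1" if \<phi>: "character \<phi>" for \<phi>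
  proof -
    have pb: "\<phi> b = of_real (Re (\<phi> b))" "0 \<le> Re (\<phi> b)"
      using M1.char_ip_real[OF \<phi>, of x] M1.char_ip_nonneg[OF \<phi>, of x] by (simp_all add: b_def)
    have "\<phi> a * \<phi> a * (\<phi> b + of_real e) = 1" using arg_cong[OF a, of \<phi>] \<phi> by (simp add: char_simps)
    also have "\<phi> b + of_real e = of_real (Re (\<phi> b) + e)" using pb(1) by simp
    finally have "cmod (\<phi> a * \<phi> a * of_real (Re (\<phi> b) + e)) = 1" by simp
    moreover have "cmod (of_real (Re (\<phi> b) + e)) = Re (\<phi> b) + e"
      using pb(2) e by (simp only: norm_of_real)
    ultimately show ?thesis by (simp only: norm_mult power2_eq_square)
  qed
  have r1: "Re (\<phi> (ip1 (act1 a x) (act1 a x))) = (cmod (\<phi> a))\<^sup>2 * Re (\<phi> b)" if \<phi>: "character \<phi>" for \<phi>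
  proof -
    have "ip1 (act1 a x) (act1 a x) = a * star a * b" by (simp add: M1.ip_simps b_def ac_simps)
    then show ?thesis using char_mult_star[OF \<phi>, of a] by (simp add: char_mult[OF \<phi>] del: of_real_power)
  qed
  have r2: "Re (\<omega> (ip2 (act2 a (T x)) (act2 a (T x)))) = (cmod (\<omega> a))\<^sup>2 * Re (\<omega> (ip2 (T x) (T x)))"
  proof -
    have "ip2 (act2 a (T x)) (act2 a (T x)) = a * star a * ip2 (T x) (T x)" by (simp add: M2.ip_simps ac_simps)
    then show ?thesis using char_mult_star[OF c, of a] by (simp add: char_mult[OF c] del: of_real_power)
  qed
  have "norm (act1 a x) \<le> 1"
  proof (rule M1.norm_leI)
    fix \<phi> :: "'a \<Rightarrow> complex" assume \<phi>: "character \<phi>"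
    have "(cmod (\<phi> a))\<^sup>2 * Re (\<phi> b) \<le> (cmod (\<phi> a))\<^sup>2 * (Re (\<phi> b) + e)"
      using e by (intro mult_left_mono) auto
    then show "Re (\<phi> (ip1 (act1 a x) (act1 a x))) \<le> 1\<^sup>2" using r1[OF \<phi>] ca[OF \<phi>] by simp
  qed simp
  then have "norm (T (act1 a x)) \<le> \<bar>B\<bar> * 1"
    by - (rule order_trans[OF B mult_mono], auto)
  then have "norm (act2 a (T x)) \<le> \<bar>B\<bar>" by (simp add: hom)
  from power_mono[OF this norm_ge_zero, of 2] have "(norm (act2 a (T x)))\<^sup>2 \<le> B\<^sup>2" by simp
  then have "(cmod (\<omega> a))\<^sup>2 * Re (\<omega> (ip2 (T x) (T x))) \<le> B\<^sup>2 * ((cmod (\<omega> a))\<^sup>2 * (Re (\<omega> b) + e))"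
    using M2.char_ip_le[OF c, of "act2 a (T x)"] r2 ca[OF c] by simp
  then have "(cmod (\<omega> a))\<^sup>2 * Re (\<omega> (ip2 (T x) (T x))) \<le> (cmod (\<omega> a))\<^sup>2 * (B\<^sup>2 * (Re (\<omega> b) + e))"
    by (simp add: ac_simps)
  moreover have "0 < (cmod (\<omega> a))\<^sup>2" using ca[OF c] by (cases "\<omega> a = 0") auto
  ultimately have "Re (\<omega> (ip2 (T x) (T x))) \<le> B\<^sup>2 * (Re (\<omega> b) + e)" by (simp only: mult_le_cancel_left_pos)
  then show "Re (\<omega> (ip2 (T x) (T x))) \<le> B\<^sup>2 * Re (\<omega> (ip1 x x)) + d"
    using e by (simp add: b_def distrib_left)
qed

end

sublocale comm_hilbert_module \<subseteq> E: hilbert_module_pair act ip act ip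
  by unfold_locales

section \<open>Roots and inverses of operators near the identity\<close>

context comm_hilbert_module
begin

lemma adj_End: "adj_pair ip ip T S \<Longrightarrow> T \<in> End_mod act"
  by (simp add: End_mod_def E.adj_bounded_linear E.adj_act)

lemma End_adj_iff: "T \<in> End_adj act ip \<longleftrightarrow> (\<exists>S. adj_pair ip ip T S)"
proof
  assume "T \<in> End_adj act ip"
  then obtain S where S: "is_adjoint ip T S" and T: "bounded_linear T"
    by (auto simp: End_adj_def End_mod_def)
  obtain K where "\<And>x. norm (T x) \<le> norm x * K" using bounded_linear.bounded[OF T] by blast
  then show "\<exists>S. adj_pair ip ip T S" using S unfolding adj_pair_def is_adjoint_def
    by (metis mult.commute)
next
  assume "\<exists>S. adj_pair ip ip T S"
  then obtain S where S: "adj_pair ip ip T S" by blast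
  then show "T \<in> End_adj act ip"
    using adj_End[OF S] adj_End[OF E.adj_sym[OF S]] unfolding End_adj_def is_adjoint_def
    by (auto simp: adj_pairD)
qed

lemma unitary_op_iff:
  "unitary_op act ip U \<longleftrightarrow> (\<exists>V. adj_pair ip ip U V \<and> (\<forall>x. U (V x) = x) \<and> (\<forall>x. V (U x) = x))"
proof
  assume "unitary_op act ip U"
  then obtain V where V: "is_adjoint ip U V" "U \<circ> V = id" "V \<circ> U = id" and U: "bounded_linear U"
    by (auto simp: unitary_op_def End_mod_def)
  obtain K where "\<And>x. norm (U x) \<le> norm x * K" using bounded_linear.bounded[OF U] by blast
  then have "adj_pair ip ip U V" using V(1) unfolding adj_pair_def is_adjoint_def
    by (metis mult.commute)
  moreover have "\<forall>x. U (V x) = x" "\<forall>x. V (U x) = x" using V(2,3) by (metis comp_apply id_apply)+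
  ultimately show "\<exists>V. adj_pair ip ip U V \<and> (\<forall>x. U (V x) = x) \<and> (\<forall>x. V (U x) = x)" by blast
next
  assume "\<exists>V. adj_pair ip ip U V \<and> (\<forall>x. U (V x) = x) \<and> (\<forall>x. V (U x) = x)"
  then obtain V where V: "adj_pair ip ip U V" "\<forall>x. U (V x) = x" "\<forall>x. V (U x) = x" by blast
  then show "unitary_op act ip U"
    using adj_End[OF V(1)] adj_End[OF E.adj_sym[OF V(1)]] unfolding unitary_op_def is_adjoint_def
    by (auto simp: adj_pairD fun_eq_iff intro!: bexI[of _ V])
qed

text \<open>The iteration runs in the Banach algebra of all bounded operators, which carries no
  involution. Self-adjointness and commuting with everything that commutes with \<open>X\<close> are
  therefore carried along by the closed set \<open>S\<close>.\<close>

lemma operator_square_root: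
  assumes X: "adj_pair ip ip X X" and c: "\<And>x. norm (X x) \<le> c * norm x" "0 \<le> c" "c < 1"
  shows "\<exists>Y. adj_pair ip ip Y Y \<and> (\<forall>x. norm (Y x) \<le> c * norm x) \<and>
    (\<forall>x. (x - Y x) - Y (x - Y x) = x - X x) \<and>
    (\<forall>V. bounded_linear V \<longrightarrow> (\<forall>x. V (X x) = X (V x)) \<longrightarrow> (\<forall>x. V (Y x) = Y (V x)))"
proof -
  have blX: "bounded_linear X" using E.adj_bounded_linear[OF X] .
  define BX where "BX = Blinfun X"
  have BX: "blinfun_apply BX = X" by (simp add: BX_def bounded_linear_Blinfun_apply[OF blX])
  have nX: "norm BX \<le> c" by (rule norm_blinfun_bound) (simp_all add: BX c)
  define S where "S = {Y :: 'h \<Rightarrow>\<^sub>L 'h. (\<forall>x y. ip (Y x) y = ip x (Y y)) \<and>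
    (\<forall>V. bounded_linear V \<and> (\<forall>x. V (X x) = X (V x)) \<longrightarrow> (\<forall>x. V (Y x) = Y (V x)))}"
  have bla: "bounded_linear (\<lambda>Y. blinfun_apply Y x)" for x :: 'h
    by (rule blinfun.bounded_linear_left)
  have "closed S"
  proof -
    have c1: "closed {Y :: 'h \<Rightarrow>\<^sub>L 'h. ip (Y x) y = ip x (Y y)}" for x y
      by (intro closed_Collect_eq linear_continuous_on
          bounded_linear_compose[OF bounded_linear_ip_left bla] bounded_linear_compose[OF bounded_linear_ip_right bla])
    have c2: "closed {Y :: 'h \<Rightarrow>\<^sub>L 'h. V (Y x) = Y (V x)}" if "bounded_linear V" for V x
      by (intro closed_Collect_eq linear_continuous_on bounded_linear_compose[OF that bla] bla)
    have "S = (\<Inter>x. \<Inter>y. {Y. ip (blinfun_apply Y x) y = ip x (Y y)}) \<inter>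
       (\<Inter>V\<in>{V. bounded_linear V \<and> (\<forall>x. V (X x) = X (V x))}. \<Inter>x. {Y. V (blinfun_apply Y x) = Y (V x)})"
      by (auto simp: S_def)
    also have "closed \<dots>" by (intro closed_Int closed_INT ballI c1 c2) auto
    finally show ?thesis .
  qed
  moreover have "0 \<in> S"
    by (auto simp: S_def blinfun.zero_left linear_0[OF bounded_linear.linear])
  moreover have "(1/2) *\<^sub>R (BX + (Y o\<^sub>L Y)) \<in> S" if "Y \<in> S" for Y
  proof -
    have Y: "ip (Y x) y = ip x (Y y)" for x y using that by (simp add: S_def)
    have YV: "V (Y x) = Y (V x)" if "bounded_linear V" "\<And>x. V (X x) = X (V x)" for V x
      using \<open>Y \<in> S\<close> that by (simp add: S_def)
    have app: "blinfun_apply ((1/2) *\<^sub>R (BX + (Y o\<^sub>L Y))) x = (1/2) *\<^sub>R (X x + Y (Y x))" for x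
      by (simp add: blinfun.scaleR_left blinfun.add_left BX)
    show ?thesis unfolding S_def mem_Collect_eq app
    proof (intro conjI allI impI)
      show "ip ((1/2) *\<^sub>R (X x + Y (Y x))) y = ip x ((1/2) *\<^sub>R (X y + Y (Y y)))" for x y
        by (simp add: ip_simps Y adj_pairD[OF X])
      show "V ((1/2) *\<^sub>R (X x + Y (Y x))) = (1/2) *\<^sub>R (X (V x) + Y (Y (V x)))"
        if V: "bounded_linear V \<and> (\<forall>x. V (X x) = X (V x))" for V x
      proof -
        have "V (Y z) = Y (V z)" for z using YV[of V z] V by blast
        then show ?thesis using V by (simp add: linear_simps(1,5)[of V])
      qed
    qed
  qed
  moreover have "bounded_bilinear ((o\<^sub>L) :: ('h \<Rightarrow>\<^sub>L 'h) \<Rightarrow> ('h \<Rightarrow>\<^sub>L 'h) \<Rightarrow> 'h \<Rightarrow>\<^sub>L 'h)"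
    by (rule bounded_bilinear_blinfun_compose)
  ultimately obtain Y where Y: "Y \<in> S" "norm Y \<le> norm BX" "Y = (1/2) *\<^sub>R (BX + (Y o\<^sub>L Y))"
    using square_root_fixed_point[of "(o\<^sub>L)" S BX] norm_blinfun_compose nX c by fastforce
  have nY: "norm (Y x) \<le> c * norm x" for x
    using norm_blinfun[of Y x] Y(2) nX mult_right_mono[of "norm Y" c "norm x"] by simp
  have "adj_pair ip ip Y Y" using Y(1) nY by (auto simp: adj_pair_def S_def)
  moreover have "(x - Y x) - Y (x - Y x) = x - X x" for x
  proof -
    have "Y x = (1/2) *\<^sub>R (X x + Y (Y x))"
      using arg_cong[OF Y(3), of "\<lambda>Y. blinfun_apply Y x"] by (simp add: blinfun.scaleR_left blinfun.add_left BX)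
    then have "2 *\<^sub>R Y x = 2 *\<^sub>R ((1/2) *\<^sub>R (X x + Y (Y x)))" by (rule arg_cong)
    then have "Y x + Y x = X x + Y (Y x)" by (simp add: scaleR_2)
    then show ?thesis by (simp add: blinfun.diff_right algebra_simps)
  qed
  ultimately show ?thesis using Y(1) nY by (intro exI[of _ "blinfun_apply Y"]) (auto simp: S_def)
qed

lemma operator_one_minus_inverse:
  assumes Z: "adj_pair ip ip Z Z" and c: "\<And>x. norm (Z x) \<le> c * norm x" "0 \<le> c" "c < 1"
  shows "\<exists>V. adj_pair ip ip V V \<and> (\<forall>x. V x - Z (V x) = x) \<and> (\<forall>x. V (x - Z x) = x)"
proof -
  have "\<exists>!x\<in>UNIV. y + Z x = x" for y
  proof (rule Banach_fix[of _ c])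
    show "dist (y + Z x) (y + Z x') \<le> c * dist x x'" for x x'
      using c(1)[of "x - x'"] by (simp add: dist_norm E.adj_diff[OF Z])
  qed (use c in \<open>auto simp: complete_UNIV\<close>)
  then have "\<exists>x. y + Z x = x" for y by blast
  then obtain V where "\<And>y. y + Z (V y) = V y" by metis
  then have V: "V y - Z (V y) = y" for y by (metis add_diff_cancel_right')
  have inj: "x = 0" if "x - Z x = 0" for x
  proof (rule ccontr)
    assume "x \<noteq> 0"
    then have "c * norm x < 1 * norm x" using c by (intro mult_strict_right_mono) auto
    then show False using c(1)[of x] that by simp
  qed
  have V2: "V (x - Z x) = x" for x
    using inj[of "V (x - Z x) - x"] V[of "x - Z x"] by (simp add: E.adj_diff[OF Z] algebra_simps)
  have "ip (V x) y = ip x (V y)" for x y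
  proof -
    have "ip (V x) y = ip (V x) (V y - Z (V y))" by (simp add: V)
    also have "\<dots> = ip (V x - Z (V x)) (V y)" by (simp add: ip_simps adj_pairD[OF Z])
    finally show ?thesis by (simp add: V)
  qed
  moreover have "norm (V y) \<le> (1 / (1 - c)) * norm y" for y
  proof -
    have "norm (V y) - norm (Z (V y)) \<le> norm y" using norm_triangle_ineq2[of "V y" "Z (V y)"] by (simp add: V)
    then have "(1 - c) * norm (V y) \<le> norm y" using c(1)[of "V y"] by (simp add: algebra_simps)
    then show ?thesis using c by (simp add: field_simps)
  qed
  ultimately have "adj_pair ip ip V V" unfolding adj_pair_def by blast
  with V V2 show ?thesis by blast
qed

text \<open>Heuristically \<open>P X\<close> is \<open>X\<close> conjugated by the root of
  \<open>P\<close>, hence at most \<open>s P\<close>. The root actually taken is that of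
  \<open>1 - X / s\<close>, which exists because \<open>b < s\<close> and commutes with
  \<open>P\<close>: positivity of \<open>P\<close> at \<open>x - Y x\<close> is the claim.\<close>

lemma positive_commuting_le:
  assumes P: "adj_pair ip ip P P" "\<And>x \<omega>. character \<omega> \<Longrightarrow> 0 \<le> Re (\<omega> (ip (P x) x))"
    and X: "adj_pair ip ip X X" "\<And>x. norm (X x) \<le> b * norm x" and s: "b < s" "0 \<le> b"
    and comm: "\<And>x. P (X x) = X (P x)" and c: "character \<omega>"
  shows "Re (\<omega> (ip (P (X x)) x)) \<le> s * Re (\<omega> (ip (P x) x))"
proof -
  have s0: "0 < s" using s by linarith
  define X1 where "X1 x = (1/s) *\<^sub>R X x" for x
  have X1: "adj_pair ip ip X1 X1" unfolding X1_def by (rule E.adj_pair_scaleR[OF X(1)])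
  have nX1: "norm (X1 x) \<le> (b/s) * norm x" for x using X(2)[of x] s0 by (simp add: X1_def divide_simps)
  have blP: "bounded_linear P" by (rule E.adj_bounded_linear[OF P(1)])
  have "0 \<le> b / s" "b / s < 1" using s s0 by simp_all
  from operator_square_root[OF X1 nX1 this]
  obtain Y where Y: "adj_pair ip ip Y Y" "\<forall>x. norm (Y x) \<le> (b/s) * norm x" "\<forall>x. (x - Y x) - Y (x - Y x) = x - X1 x"
    "\<forall>V. bounded_linear V \<longrightarrow> (\<forall>x. V (X1 x) = X1 (V x)) \<longrightarrow> (\<forall>x. V (Y x) = Y (V x))"
    by (elim exE conjE)
  have PY: "P (Y x) = Y (P x)" for x
    using Y(4)[rule_format, OF blP] by (simp add: X1_def E.adj_scaleR[OF P(1)] comm)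
  have "ip (P (x - Y x)) (x - Y x) = ip (P ((x - Y x) - Y (x - Y x))) x"
    by (simp add: ip_simps PY E.adj_diff[OF P(1)] E.adj_diff[OF Y(1)] adj_pairD[OF Y(1)])
  also have "\<dots> = ip (P x) x - (1/s) *\<^sub>R ip (P (X x)) x"
    by (simp add: Y(3) X1_def E.adj_diff[OF P(1)] E.adj_scaleR[OF P(1)] ip_simps)
  finally have "0 \<le> Re (\<omega> (ip (P x) x - (1/s) *\<^sub>R ip (P (X x)) x))" using P(2)[OF c, of "x - Y x"] by simp
  then have "0 \<le> Re (\<omega> (ip (P x) x)) - (1/s) * Re (\<omega> (ip (P (X x)) x))"
    using c by (simp add: char_simps del: of_real_divide)
  then show ?thesis using s0 by (simp add: pos_divide_le_eq mult.commute)
qed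

end

section \<open>The standard Hilbert module of square-summable families\<close>

text \<open>Type class instances need a whole type as index set. Families over a set
  \<open>G\<close> are recovered later as the range of a projection.\<close>

typedef (overloaded) ('i, 'a) l2 = "{f :: 'i \<Rightarrow> 'a::comm_unital_cstar_algebra. square_summable f UNIV}"
  morphisms coef mk_l2
  by (rule exI[of _ "\<lambda>_. 0"]) (simp add: square_summable_def)

lemma square_summable_coef [simp]: "square_summable (coef f) UNIV"
  using coef[of f] by simp

lemma coef_mk_l2: "square_summable f UNIV \<Longrightarrow> coef (mk_l2 f) = f"
  by (simp add: mk_l2_inverse)

lemma l2_eqI: "(\<And>i. coef f i = coef g i) \<Longrightarrow> f = g"
  by (metis coef_inject ext)

lemma square_summable_zero [simp]: "square_summable (\<lambda>_. 0) A"
  by (simp add: square_summable_def)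

lemma square_summable_minus:
  "square_summable f A \<Longrightarrow> square_summable (\<lambda>i. - f i :: 'a::comm_unital_cstar_algebra) A"
  by (simp add: square_summable_def star_minus)

lemma square_summable_diff:
  "square_summable f A \<Longrightarrow> square_summable g A \<Longrightarrow> square_summable (\<lambda>i. f i - g i :: 'a::comm_unital_cstar_algebra) A"
  using square_summable_add[OF _ square_summable_minus, of f A g] by simp

lemma square_summable_scaleC:
  "square_summable f A \<Longrightarrow> square_summable (\<lambda>i. c *\<^sub>C f i :: 'a::comm_unital_cstar_algebra) A"
  using square_summable_mult[of f A "c *\<^sub>C 1"] by (simp add: mult_scaleC_left)

lemma square_summable_scaleR:
  "square_summable f A \<Longrightarrow> square_summable (\<lambda>i. r *\<^sub>R f i :: 'a::comm_unital_cstar_algebra) A"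
  by (simp add: scaleR_scaleC square_summable_scaleC)

definition l2_inner :: "('i, 'a) l2 \<Rightarrow> ('i, 'a) l2 \<Rightarrow> 'a::comm_unital_cstar_algebra"
  where "l2_inner f g = (\<Sum>\<^sub>\<infinity>i. coef f i * star (coef g i))"

instantiation l2 :: (type, comm_unital_cstar_algebra) real_normed_vector
begin

definition zero_l2 :: "('a, 'b) l2" where "0 = mk_l2 (\<lambda>_. 0)"
definition plus_l2 :: "('a, 'b) l2 \<Rightarrow> ('a, 'b) l2 \<Rightarrow> ('a, 'b) l2"
  where "f + g = mk_l2 (\<lambda>i. coef f i + coef g i)"
definition minus_l2 :: "('a, 'b) l2 \<Rightarrow> ('a, 'b) l2 \<Rightarrow> ('a, 'b) l2"
  where "f - g = mk_l2 (\<lambda>i. coef f i - coef g i)"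
definition uminus_l2 :: "('a, 'b) l2 \<Rightarrow> ('a, 'b) l2" where "- f = mk_l2 (\<lambda>i. - coef f i)"
definition scaleR_l2 :: "real \<Rightarrow> ('a, 'b) l2 \<Rightarrow> ('a, 'b) l2" where "r *\<^sub>R f = mk_l2 (\<lambda>i. r *\<^sub>R coef f i)"
definition norm_l2 :: "('a, 'b) l2 \<Rightarrow> real" where "norm f = sqrt (norm (l2_inner f f))"
definition dist_l2 :: "('a, 'b) l2 \<Rightarrow> ('a, 'b) l2 \<Rightarrow> real" where "dist_l2 f g = norm (f - g)"
definition uniformity_l2 :: "(('a, 'b) l2 \<times> ('a, 'b) l2) filter"
  where "uniformity_l2 = (INF e\<in>{0 <..}. principal {(x, y). dist x y < e})"
definition open_l2 :: "('a, 'b) l2 set \<Rightarrow> bool"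
  where "open_l2 U = (\<forall>x\<in>U. eventually (\<lambda>(x', y). x' = x \<longrightarrow> y \<in> U) uniformity)"
definition sgn_l2 :: "('a, 'b) l2 \<Rightarrow> ('a, 'b) l2" where "sgn_l2 f = inverse (norm f) *\<^sub>R f"

lemma coef_simps [simp]:
  fixes f g :: "('a, 'b) l2"
  shows "coef 0 = (\<lambda>i. 0 :: 'b)" "coef (f + g) = (\<lambda>i. coef f i + coef g i)"
    "coef (f - g) = (\<lambda>i. coef f i - coef g i)" "coef (- f) = (\<lambda>i. - coef f i)"
    "coef (r *\<^sub>R f) = (\<lambda>i. r *\<^sub>R coef f i)"
  by (simp_all add: zero_l2_def plus_l2_def minus_l2_def uminus_l2_def scaleR_l2_def coef_mk_l2
      square_summable_add square_summable_diff square_summable_minus square_summable_scaleR)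

text \<open>The norm is the supremum of scalar norms over characters and finite sets. The triangle
  inequality and completeness are read off from this form.\<close>

lemma norm_l2_le_iff:
  fixes f :: "('a, 'b) l2"
  assumes "0 \<le> r"
  shows "norm f \<le> r \<longleftrightarrow> (\<forall>F \<omega>. finite F \<longrightarrow> character \<omega> \<longrightarrow> char_l2 \<omega> (coef f) F \<le> r)"
proof
  assume n: "norm f \<le> r"
  then have n2: "norm (l2_inner f f) \<le> r\<^sup>2" using assms by (simp add: norm_l2_def real_le_lsqrt sqrt_le_D)
  show "\<forall>F \<omega>. finite F \<longrightarrow> character \<omega> \<longrightarrow> char_l2 \<omega> (coef f) F \<le> r"
  proof (intro allI impI)
    fix F :: "'a set" and \<omega> :: "'b \<Rightarrow> complex" assume F: "finite F" and c: "character \<omega>"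
    have "(char_l2 \<omega> (coef f) F)\<^sup>2 \<le> Re (\<omega> (l2_inner f f))"
      unfolding l2_inner_def using F c by (intro square_summable_char_bounded) auto
    also have "\<dots> \<le> r\<^sup>2"
      using complex_Re_le_cmod[of "\<omega> (l2_inner f f)"] norm_char_le[OF c, of "l2_inner f f"] n2 by linarith
    finally show "char_l2 \<omega> (coef f) F \<le> r" using assms power2_le_imp_le by blast
  qed
next
  assume b: "\<forall>F \<omega>. finite F \<longrightarrow> character \<omega> \<longrightarrow> char_l2 \<omega> (coef f) F \<le> r"
  have "((\<lambda>i. coef f i * star (coef f i)) has_sum l2_inner f f) UNIV"
    using square_summable_coef[of f] by (simp add: square_summable_def l2_inner_def)
  then have "(sum (\<lambda>i. coef f i * star (coef f i)) \<longlongrightarrow> l2_inner f f) (finite_subsets_at_top UNIV)"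
    by (simp add: has_sum_def)
  then have "((\<lambda>F. norm (\<Sum>i\<in>F. coef f i * star (coef f i))) \<longlongrightarrow> norm (l2_inner f f)) (finite_subsets_at_top UNIV)"
    by (rule tendsto_norm)
  moreover have "eventually (\<lambda>F. norm (\<Sum>i\<in>F. coef f i * star (coef f i)) \<le> r\<^sup>2) (finite_subsets_at_top UNIV)"
    using b assms by (intro eventually_finite_subsets_at_top_weakI) (simp add: norm_sum_square_le_iff)
  ultimately have "norm (l2_inner f f) \<le> r\<^sup>2" by (intro tendsto_upperbound) auto
  then show "norm f \<le> r" using assms by (simp add: norm_l2_def real_le_lsqrt)
qed

lemma norm_l2_nonneg: "0 \<le> norm (f :: ('a, 'b) l2)"
  by (simp add: norm_l2_def)

lemma char_l2_le_norm:
  fixes f :: "('a, 'b) l2"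
  shows "finite F \<Longrightarrow> character \<omega> \<Longrightarrow> char_l2 \<omega> (coef f) F \<le> norm f"
  using norm_l2_le_iff[OF norm_l2_nonneg, of f f] by blast

lemma norm_coef_le:
  fixes f :: "('a, 'b) l2"
  shows "norm (coef f i) \<le> norm f"
proof (rule norm_le_char)
  fix \<omega> :: "'b \<Rightarrow> complex" assume c: "character \<omega>"
  show "cmod (\<omega> (coef f i)) \<le> norm f"
    using char_l2_le_norm[OF _ c, of "{i}" f] by (simp add: char_l2_def L2_set_def)
qed (rule norm_l2_nonneg)

instance
proof
  fix f g h :: "('a, 'b) l2" and r s :: real and U :: "('a, 'b) l2 set"
  show "f + g + h = f + (g + h)" "f + g = g + f" "0 + f = f" "- f + f = 0" "f - g = f + - g"
    by (rule l2_eqI, simp add: add.assoc add.commute)+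
  show "r *\<^sub>R (f + g) = r *\<^sub>R f + r *\<^sub>R g" "(r + s) *\<^sub>R f = r *\<^sub>R f + s *\<^sub>R f"
    "r *\<^sub>R s *\<^sub>R f = (r * s) *\<^sub>R f" "1 *\<^sub>R f = f"
    by (rule l2_eqI, simp add: scaleR_add_left scaleR_add_right)+
  show "dist f g = norm (f - g)" by (rule dist_l2_def)
  show "sgn f = inverse (norm f) *\<^sub>R f" by (rule sgn_l2_def)
  show "uniformity = (INF e\<in>{0 <..}. principal {(x, y :: ('a, 'b) l2). dist x y < e})"
    by (rule uniformity_l2_def)
  show "open U = (\<forall>x\<in>U. eventually (\<lambda>(x', y). x' = x \<longrightarrow> y \<in> U) uniformity)" by (rule open_l2_def)
  show "(norm f = 0) = (f = 0)"
  proof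
    assume "norm f = 0"
    then have "norm (coef f i) \<le> 0" for i using norm_coef_le[of f i] by simp
    then show "f = 0" by (intro l2_eqI) simp
  next
    assume "f = 0"
    then show "norm f = 0" by (simp add: norm_l2_def l2_inner_def)
  qed
  show "norm (f + g) \<le> norm f + norm g"
  proof (subst norm_l2_le_iff, goal_cases)
    case 2
    show ?case
    proof (intro allI impI)
      fix F :: "'a set" and \<omega> :: "'b \<Rightarrow> complex" assume F: "finite F" and c: "character \<omega>"
      show "char_l2 \<omega> (coef (f + g)) F \<le> norm f + norm g"
        using char_l2_triangle[OF c, of "coef f" "coef g" F] char_l2_le_norm[OF F c, of f]
          char_l2_le_norm[OF F c, of g] by simp
    qed
  qed (simp add: norm_l2_nonneg add_nonneg_nonneg)
  have *: "l2_inner (r *\<^sub>R f) (r *\<^sub>R f) = (r * r) *\<^sub>R l2_inner f f"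
    by (simp add: l2_inner_def star_scaleR infsum_scaleR_right)
  show "norm (r *\<^sub>R f) = \<bar>r\<bar> * norm f" by (simp add: norm_l2_def * real_sqrt_mult)
qed

end

instantiation l2 :: (type, comm_unital_cstar_algebra) complex_banach
begin

definition scaleC_l2 :: "complex \<Rightarrow> ('a, 'b) l2 \<Rightarrow> ('a, 'b) l2" where "c *\<^sub>C f = mk_l2 (\<lambda>i. c *\<^sub>C coef f i)"

lemma coef_scaleC [simp]: "coef (c *\<^sub>C f) = (\<lambda>i. c *\<^sub>C coef f i)" for f :: "('a, 'b) l2"
  by (simp add: scaleC_l2_def coef_mk_l2 square_summable_scaleC)

instance
proof
  fix f g :: "('a, 'b) l2" and c d :: complex and r :: real
  show "c *\<^sub>C (f + g) = c *\<^sub>C f + c *\<^sub>C g" "(c + d) *\<^sub>C f = c *\<^sub>C f + d *\<^sub>C f"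
    "c *\<^sub>C d *\<^sub>C f = (c * d) *\<^sub>C f" "r *\<^sub>R f = complex_of_real r *\<^sub>C f"
    by (rule l2_eqI, simp add: scaleC_add_left scaleC_add_right scaleC_scaleC scaleR_scaleC)+
  have "coef (c *\<^sub>C f) i * star (coef (c *\<^sub>C f) i) = (cmod c)\<^sup>2 *\<^sub>R (coef f i * star (coef f i))" for i
    by (simp only: coef_scaleC star_scaleC mult_scaleC_left mult_scaleC_right scaleC_scaleC scaleR_scaleC
        complex_norm_square mult.commute[of "cnj c"])
  then have "l2_inner (c *\<^sub>C f) (c *\<^sub>C f) = (cmod c)\<^sup>2 *\<^sub>R l2_inner f f"
    by (simp only: l2_inner_def infsum_scaleR_right)
  then show "norm (c *\<^sub>C f) = cmod c * norm f" by (simp add: norm_l2_def real_sqrt_mult)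
next
  fix X :: "nat \<Rightarrow> ('a, 'b) l2" assume X: "Cauchy X"
  have "Cauchy (\<lambda>n. coef (X n) i)" for i
  proof (rule CauchyI)
    fix e :: real assume "0 < e"
    then obtain M where "\<forall>m\<ge>M. \<forall>n\<ge>M. norm (X m - X n) < e" using CauchyD[OF X] by blast
    then show "\<exists>M. \<forall>m\<ge>M. \<forall>n\<ge>M. norm (coef (X m) i - coef (X n) i) < e"
      using le_less_trans[OF norm_coef_le[of "X _ - X _" i, simplified]] by blast
  qed
  then have "\<exists>l. (\<lambda>n. coef (X n) i) \<longlonglongrightarrow> l" for i
    using Cauchy_convergent convergent_def by blast
  then obtain g where g: "\<And>i. (\<lambda>n. coef (X n) i) \<longlonglongrightarrow> g i" by metis
  \<comment> \<open>The entrywise limit approximates \<open>X n\<close> uniformly in the finite set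
    and the character. Hence its tails are small with those of a single \<open>X N\<close>, and the
    convergence is in norm.\<close>
  have close: "\<exists>N. \<forall>n\<ge>N. \<forall>F \<omega>. finite F \<longrightarrow> character \<omega> \<longrightarrow> char_l2 \<omega> (\<lambda>i. g i - coef (X n) i) F \<le> e"
    if "0 < e" for e
  proof -
    obtain N where N: "\<And>m n. N \<le> m \<Longrightarrow> N \<le> n \<Longrightarrow> norm (X m - X n) < e" using CauchyD[OF X \<open>0 < e\<close>] by blast
    have "char_l2 \<omega> (\<lambda>i. g i - coef (X n) i) F \<le> e"
      if n: "N \<le> n" and F: "finite F" and c: "character \<omega>" for n F \<omega>
    proof (rule LIMSEQ_le_const2)
      have "(\<lambda>m. \<omega> (coef (X m) i - coef (X n) i)) \<longlonglongrightarrow> \<omega> (g i - coef (X n) i)" for i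
        by (intro bounded_linear.tendsto[OF bounded_linear_char[OF c]] tendsto_diff g tendsto_const)
      then show "(\<lambda>m. char_l2 \<omega> (\<lambda>i. coef (X m) i - coef (X n) i) F) \<longlonglongrightarrow> char_l2 \<omega> (\<lambda>i. g i - coef (X n) i) F"
        unfolding char_l2_def L2_set_def by (intro tendsto_intros)
      show "\<exists>M. \<forall>m\<ge>M. char_l2 \<omega> (\<lambda>i. coef (X m) i - coef (X n) i) F \<le> e"
      proof (intro exI allI impI)
        fix m assume "N \<le> m"
        then show "char_l2 \<omega> (\<lambda>i. coef (X m) i - coef (X n) i) F \<le> e"
          using char_l2_le_norm[OF F c, of "X m - X n"] N[of m n] n by simp
      qed
    qed
    then show ?thesis by blast
  qed
  have "square_summable g UNIV" unfolding square_summable_iff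
  proof (intro allI impI)
    fix e :: real assume e: "0 < e"
    obtain N where N: "\<And>F \<omega>. finite F \<Longrightarrow> character \<omega> \<Longrightarrow> char_l2 \<omega> (\<lambda>i. g i - coef (X N) i) F \<le> e/2"
      using close[OF half_gt_zero[OF e]] by blast
    obtain F0 where F0: "finite F0" "F0 \<subseteq> UNIV"
      "\<forall>F. finite F \<and> F \<subseteq> UNIV \<and> F \<inter> F0 = {} \<longrightarrow> (\<forall>\<omega>. character \<omega> \<longrightarrow> char_l2 \<omega> (coef (X N)) F \<le> e/2)"
      using square_summable_tail[OF square_summable_coef[of "X N"] half_gt_zero[OF e]] by (elim exE conjE)
    have "char_l2 \<omega> g F \<le> e" if F: "finite F" "F \<inter> F0 = {}" and c: "character \<omega>" for F \<omega>
    proof -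
      have "char_l2 \<omega> (coef (X N)) F \<le> e/2" by (rule F0(3)[rule_format]) (use F c in auto)
      then show ?thesis
        using char_l2_triangle[OF c, of "\<lambda>i. g i - coef (X N) i" "coef (X N)" F] N[OF F(1) c] by simp
    qed
    then show "\<exists>F0. finite F0 \<and> F0 \<subseteq> UNIV \<and> (\<forall>F. finite F \<and> F \<subseteq> UNIV \<and> F \<inter> F0 = {} \<longrightarrow>
        (\<forall>\<omega>. character \<omega> \<longrightarrow> char_l2 \<omega> g F \<le> e))"
      using F0(1) by (intro exI[of _ F0]) auto
  qed
  then have cg: "coef (mk_l2 g) = g" by (rule coef_mk_l2)
  have "X \<longlonglongrightarrow> mk_l2 g"
  proof (rule LIMSEQ_I)
    fix e :: real assume e: "0 < e"
    obtain N where N: "\<And>n F \<omega>. N \<le> n \<Longrightarrow> finite F \<Longrightarrow> character \<omega> \<Longrightarrow> char_l2 \<omega> (\<lambda>i. g i - coef (X n) i) F \<le> e/2"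
      using close[OF half_gt_zero[OF e]] by blast
    have "norm (mk_l2 g - X n) \<le> e/2" if "N \<le> n" for n
      using N[OF that] e by (subst norm_l2_le_iff) (auto simp: cg)
    then have *: "norm (X n - mk_l2 g) \<le> e/2" if "N \<le> n" for n
      using that by (simp add: norm_minus_commute)
    have "e/2 < e" using e by simp
    then show "\<exists>N. \<forall>n\<ge>N. norm (X n - mk_l2 g) < e"
      using le_less_trans[OF *] by blast
  qed
  then show "convergent X" by (auto simp: convergent_def)
qed

end

definition l2_act :: "'a \<Rightarrow> ('i, 'a) l2 \<Rightarrow> ('i, 'a::comm_unital_cstar_algebra) l2"
  where "l2_act c f = mk_l2 (\<lambda>i. c * coef f i)"

lemma coef_l2_act [simp]: "coef (l2_act c f) = (\<lambda>i. c * coef f i)"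
  by (simp add: l2_act_def coef_mk_l2 square_summable_mult)

lemma l2_inner_summable: "(\<lambda>i. coef f i * star (coef g i)) summable_on UNIV"
  by (simp add: summable_on_mult_star)

interpretation L2: comm_hilbert_module "l2_act :: 'a::comm_unital_cstar_algebra \<Rightarrow> ('i, 'a) l2 \<Rightarrow> ('i, 'a) l2" l2_inner
proof
  fix a b :: 'a and f g h :: "('i, 'a) l2" and c :: complex
  show "l2_act (a + b) f = l2_act a f + l2_act b f" "l2_act a (f + g) = l2_act a f + l2_act a g"
    "l2_act a (l2_act b f) = l2_act (a * b) f" "l2_act (c *\<^sub>C a) f = c *\<^sub>C l2_act a f"
    "l2_act a (c *\<^sub>C f) = c *\<^sub>C l2_act a f"
    by (rule l2_eqI, simp add: distrib_left distrib_right mult.assoc mult_scaleC_left mult_scaleC_right)+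
  show "l2_inner (f + g) h = l2_inner f h + l2_inner g h"
    by (simp add: l2_inner_def distrib_right infsum_add l2_inner_summable)
  show *: "l2_inner (l2_act a f) g = a * l2_inner f g" for a f g
    by (simp add: l2_inner_def mult.assoc infsum_cmult_right l2_inner_summable)
  show "l2_inner (c *\<^sub>C f) g = c *\<^sub>C l2_inner f g"
    using *[of "c *\<^sub>C 1" f g] by (simp add: l2_act_def scaleC_l2_def mult_scaleC_left)
  show "l2_inner f g = star (l2_inner g f)"
    using infsumI[OF has_sum_bounded_linear[OF bounded_linear_star has_sum_infsum[OF l2_inner_summable[of g f]]]]
    by (simp add: l2_inner_def star_mult star_star)
  have "positive (l2_inner f f)"
  proof (rule positive_charI)
    fix \<omega> :: "'a \<Rightarrow> complex" assume c: "character \<omega>"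
    show "0 \<le> Re (\<omega> (l2_inner f f))"
      using square_summable_char_bounded[OF square_summable_coef c, of "{}" f] by (simp add: l2_inner_def char_l2_def)
    have "star (l2_inner f f) = l2_inner f f"
      using infsumI[OF has_sum_bounded_linear[OF bounded_linear_star has_sum_infsum[OF l2_inner_summable[of f f]]]]
      by (simp add: l2_inner_def star_mult star_star)
    then show "Im (\<omega> (l2_inner f f)) = 0" using char_self_adjoint_Im[OF c] by blast
  qed
  then show "cstar_le 0 (l2_inner f f)" by (simp add: cstar_le_iff_positive)
  show "l2_inner f f = 0 \<longleftrightarrow> f = 0" by (metis norm_l2_def norm_eq_zero real_sqrt_eq_zero_cancel_iff)
  show "norm f = sqrt (norm (l2_inner f f))" by (rule norm_l2_def)
qed

definition l2_unit :: "'i \<Rightarrow> ('i, 'a::comm_unital_cstar_algebra) l2"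
  where "l2_unit i = mk_l2 (\<lambda>j. if j = i then 1 else 0)"

lemma coef_l2_unit [simp]: "coef (l2_unit i :: ('i, 'a::comm_unital_cstar_algebra) l2) = (\<lambda>j. if j = i then 1 else 0)"
proof -
  have "(\<lambda>j. (if j = i then 1 else 0) * star (if j = i then 1 else (0::'a))) summable_on UNIV"
    by (rule finite_nonzero_values_imp_summable_on) (auto intro: finite_subset[of _ "{i}"])
  then show ?thesis by (simp add: l2_unit_def coef_mk_l2 square_summable_def)
qed

lemma l2_inner_unit: "l2_inner f (l2_unit i) = coef f i"
proof -
  have "(\<Sum>\<^sub>\<infinity>j. coef f j * star (if j = i then 1 else 0)) = (\<Sum>\<^sub>\<infinity>j\<in>{i}. coef f j)"
    by (rule infsum_cong_neutral) auto
  then show ?thesis by (simp add: l2_inner_def)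
qed

lemma l2_inner_unit_left: "l2_inner (l2_unit i) f = star (coef f i)"
  using L2.ip_star[of "l2_unit i" f] by (simp add: l2_inner_unit)

section \<open>Weak limits and extreme contractions\<close>

text \<open>The midpoint form of the Krein--Milman theorem for the product topology. A closed face is
  represented by its complement, so that Zorn's lemma applies to increasing unions.\<close>

lemma compact_midpoint_extreme:
  fixes S :: "('j \<Rightarrow> real) set"
  assumes S: "compact S" "S \<noteq> {}"
  shows "\<exists>s\<in>S. \<forall>a\<in>S. \<forall>b\<in>S. (\<forall>j. 2 * s j = a j + b j) \<longrightarrow> a = s"
proof -
  define A where "A = {X. open X \<and> \<not> S \<subseteq> X \<and>
    (\<forall>s\<in>S - X. \<forall>a\<in>S. \<forall>b\<in>S. (\<forall>j. 2 * s j = a j + b j) \<longrightarrow> a \<notin> X \<and> b \<notin> X)}"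
  have "\<exists>M\<in>A. \<forall>X\<in>A. M \<subseteq> X \<longrightarrow> X = M"
  proof (rule subset_Zorn_nonempty)
    show "A \<noteq> {}" using S(2) by (auto simp: A_def intro!: exI[of _ "{}"])
    fix C assume C: "C \<noteq> {}" "subset.chain A C"
    then have CA: "\<And>X. X \<in> C \<Longrightarrow> X \<in> A" and ch: "\<And>X Y. X \<in> C \<Longrightarrow> Y \<in> C \<Longrightarrow> X \<subseteq> Y \<or> Y \<subseteq> X"
      unfolding subset_chain_def by auto
    \<comment> \<open>By compactness a cover of \<open>S\<close> by the chain would already be
      achieved by a single member.\<close>
    have "\<not> S \<subseteq> \<Union>C"
    proof
      assume "S \<subseteq> \<Union>C"
      moreover have "open X" if "X \<in> C" for X using CA[OF that] by (simp add: A_def)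
      ultimately obtain C' where C': "C' \<subseteq> C" "finite C'" "S \<subseteq> \<Union>C'"
        by (rule compactE[OF S(1)])
      have "C' \<noteq> {}" using C'(3) S(2) by auto
      moreover have "subset.chain A C'" unfolding subset_chain_def
        by (intro conjI subsetI ballI ch CA subsetD[OF C'(1)])
      ultimately have "\<Union>C' \<in> C" using Union_in_chain[OF C'(2)] C'(1) by blast
      then show False using CA C'(3) by (auto simp: A_def)
    qed
    moreover have "open (\<Union>C)" using CA by (auto simp: A_def)
    moreover have "\<forall>s\<in>S - \<Union>C. \<forall>a\<in>S. \<forall>b\<in>S. (\<forall>j. 2 * s j = a j + b j) \<longrightarrow> a \<notin> \<Union>C \<and> b \<notin> \<Union>C"
    proof (intro ballI impI)
      fix s a b assume *: "s \<in> S - \<Union>C" "a \<in> S" "b \<in> S" "\<forall>j. 2 * s j = a j + b j"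
      have "a \<notin> X \<and> b \<notin> X" if "X \<in> C" for X
        using CA[OF that] * that unfolding A_def by blast
      then show "a \<notin> \<Union>C \<and> b \<notin> \<Union>C" by blast
    qed
    ultimately show "\<Union>C \<in> A" unfolding A_def mem_Collect_eq by (intro conjI)
  qed
  then obtain M where M: "M \<in> A" and max: "\<forall>X\<in>A. M \<subseteq> X \<longrightarrow> X = M" by (elim bexE)
  have oM: "open M" and SM: "\<not> S \<subseteq> M"
    and face: "\<forall>s\<in>S - M. \<forall>a\<in>S. \<forall>b\<in>S. (\<forall>j. 2 * s j = a j + b j) \<longrightarrow> a \<notin> M \<and> b \<notin> M"
    by (rule M[unfolded A_def mem_Collect_eq, THEN conjunct1]
        M[unfolded A_def mem_Collect_eq, THEN conjunct2, THEN conjunct1]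
        M[unfolded A_def mem_Collect_eq, THEN conjunct2, THEN conjunct2])+
  \<comment> \<open>\<open>S - M\<close> is a minimal closed face. If two of its points differed at
    \<open>j\<close>, the part where the coordinate \<open>j\<close> is maximal would be a smaller
    one.\<close>
  have single: "s = t" if st: "s \<in> S" "s \<notin> M" "t \<in> S" "t \<notin> M" for s t
  proof (rule ext, rule ccontr)
    fix j assume ne: "s j \<noteq> t j"
    have cont: "continuous_on UNIV (\<lambda>f::'j \<Rightarrow> real. f j)" by simp
    have "compact (S - M)" using S(1) oM by (simp add: compact_diff)
    moreover have "S - M \<noteq> {}" using SM by auto
    ultimately obtain f where f: "f \<in> S" "f \<notin> M" "\<And>g. g \<in> S \<Longrightarrow> g \<notin> M \<Longrightarrow> g j \<le> f j"
      using continuous_attains_sup[of "S - M" "\<lambda>f. f j"] continuous_on_subset[OF cont] by auto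
    define X where "X = M \<union> {g. g j < f j}"
    have "open {g :: 'j \<Rightarrow> real. g j < f j}" by (rule open_Collect_less[OF cont]) (rule continuous_on_const)
    then have "open X" using oM by (simp add: X_def open_Un)
    moreover have "\<not> S \<subseteq> X" using f by (auto simp: X_def)
    moreover have "\<forall>u\<in>S - X. \<forall>a\<in>S. \<forall>b\<in>S. (\<forall>j. 2 * u j = a j + b j) \<longrightarrow> a \<notin> X \<and> b \<notin> X"
    proof (intro ballI impI)
      fix u a b assume u: "u \<in> S - X" and ab: "a \<in> S" "b \<in> S" and mid: "\<forall>j. 2 * u j = a j + b j"
      have "u \<in> S - M" using u by (auto simp: X_def)
      then have nM: "a \<notin> M" "b \<notin> M" using face[rule_format, OF _ ab] mid by simp_all
      have "f j \<le> u j" using u by (auto simp: X_def)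
      moreover have "a j \<le> f j" "b j \<le> f j" using f(3) ab nM by auto
      moreover have "2 * u j = a j + b j" using mid by blast
      ultimately have "\<not> a j < f j" "\<not> b j < f j" by linarith+
      then show "a \<notin> X \<and> b \<notin> X" using nM by (simp add: X_def)
    qed
    ultimately have "X \<in> A" unfolding A_def mem_Collect_eq by (intro conjI)
    then have "X = M" by (rule max[rule_format]) (simp add: X_def)
    then have "\<not> s j < f j" "\<not> t j < f j" using st by (auto simp: X_def)
    then show False using f(3)[OF st(1,2)] f(3)[OF st(3,4)] ne by simp
  qed
  obtain s where s: "s \<in> S" "s \<notin> M" using SM by blast
  have "a = s" if ab: "a \<in> S" "b \<in> S" "\<forall>j. 2 * s j = a j + b j" for a b
  proof (rule single[OF ab(1) _ s])
    show "a \<notin> M" using face[rule_format, of s, OF _ ab(1,2)] s ab(3) by simp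
  qed
  then show ?thesis using s(1) by blast
qed

section \<open>Weak-star limits in the algebra\<close>

definition dual_iso :: "('a::complex_banach \<Rightarrow> ('x::complex_banach \<Rightarrow>\<^sub>L complex)) \<Rightarrow> bool"
  where "dual_iso \<Phi> \<longleftrightarrow> bij_betw \<Phi> UNIV complex_dual \<and> (\<forall>a b. \<Phi> (a + b) = \<Phi> a + \<Phi> b) \<and>
    (\<forall>c a x. \<Phi> (c *\<^sub>C a) x = c * \<Phi> a x) \<and> (\<forall>a. norm (\<Phi> a) = norm a)"

lemma dual_iso_add: "dual_iso \<Phi> \<Longrightarrow> \<Phi> (a + b) x = \<Phi> a x + \<Phi> b x"
  by (simp add: dual_iso_def blinfun.add_left)

lemma dual_iso_scaleC: "dual_iso \<Phi> \<Longrightarrow> \<Phi> (c *\<^sub>C a) x = c * \<Phi> a x"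
  by (simp add: dual_iso_def)

lemma dual_iso_diff: "dual_iso \<Phi> \<Longrightarrow> \<Phi> (a - b) x = \<Phi> a x - \<Phi> b x"
  using dual_iso_add[of \<Phi> "a - b" b x] by simp

lemma dual_iso_arg: "dual_iso \<Phi> \<Longrightarrow> \<Phi> a (c *\<^sub>C x) = c * \<Phi> a x"
  unfolding dual_iso_def bij_betw_def complex_dual_def by blast

lemma dual_iso_norm: "dual_iso \<Phi> \<Longrightarrow> norm (\<Phi> a) = norm a"
  by (simp add: dual_iso_def)

lemma dual_iso_inj: "dual_iso \<Phi> \<Longrightarrow> (\<And>x. \<Phi> a x = \<Phi> b x) \<Longrightarrow> a = b"
  unfolding dual_iso_def bij_betw_def by (metis blinfun_eqI injD)

text \<open>Real parts at \<open>\<i> *\<^sub>C x\<close> supply the imaginary parts, so real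
  coordinates suffice for the compactness argument.\<close>

lemma dual_iso_inj_Re:
  assumes \<Phi>: "dual_iso \<Phi>" and Re: "\<And>x. Re (\<Phi> a x) = Re (\<Phi> b x)"
  shows "a = b"
proof (rule dual_iso_inj[OF \<Phi>])
  fix x
  have "Re (\<i> * \<Phi> a x) = Re (\<i> * \<Phi> b x)" using Re[of "\<i> *\<^sub>C x"] by (simp only: dual_iso_arg[OF \<Phi>])
  then show "\<Phi> a x = \<Phi> b x" using Re[of x] by (simp add: complex_eq_iff)
qed

definition wlim :: "('a::complex_banach \<Rightarrow> ('x::complex_banach \<Rightarrow>\<^sub>L complex)) \<Rightarrow> ('s \<Rightarrow> 'a) \<Rightarrow> 'a \<Rightarrow> 's filter \<Rightarrow> bool"
  where "wlim \<Phi> f a F \<longleftrightarrow> (\<forall>x. ((\<lambda>s. \<Phi> (f s) x) \<longlongrightarrow> \<Phi> a x) F)"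

lemma wlim_unique: "dual_iso \<Phi> \<Longrightarrow> F \<noteq> bot \<Longrightarrow> wlim \<Phi> f a F \<Longrightarrow> wlim \<Phi> f b F \<Longrightarrow> a = b"
  unfolding wlim_def by (rule dual_iso_inj) (assumption, erule tendsto_unique, erule spec, erule spec)

lemma wlim_add: "dual_iso \<Phi> \<Longrightarrow> wlim \<Phi> f a F \<Longrightarrow> wlim \<Phi> g b F \<Longrightarrow> wlim \<Phi> (\<lambda>s. f s + g s) (a + b) F"
  unfolding wlim_def by (simp add: dual_iso_add tendsto_add)

lemma wlim_scaleC: "dual_iso \<Phi> \<Longrightarrow> wlim \<Phi> f a F \<Longrightarrow> wlim \<Phi> (\<lambda>s. c *\<^sub>C f s) (c *\<^sub>C a) F"
  unfolding wlim_def by (simp add: dual_iso_scaleC tendsto_mult_left)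

lemma wlim_diff: "dual_iso \<Phi> \<Longrightarrow> wlim \<Phi> f a F \<Longrightarrow> wlim \<Phi> g b F \<Longrightarrow> wlim \<Phi> (\<lambda>s. f s - g s) (a - b) F"
  unfolding wlim_def by (simp add: dual_iso_diff tendsto_diff)

lemma wlim_const: "wlim \<Phi> (\<lambda>s. a) a F"
  by (simp add: wlim_def)

lemma wlim_cong: "eventually (\<lambda>s. f s = g s) F \<Longrightarrow> wlim \<Phi> f a F \<Longrightarrow> wlim \<Phi> g a F"
  unfolding wlim_def
proof (intro allI)
  fix x assume ev: "eventually (\<lambda>s. f s = g s) F" and *: "\<forall>x. ((\<lambda>s. \<Phi> (f s) x) \<longlongrightarrow> \<Phi> a x) F"
  have "eventually (\<lambda>s. \<Phi> (f s) x = \<Phi> (g s) x) F" using ev by eventually_elim simp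
  from iffD1[OF tendsto_cong[OF this] *[rule_format]]
  show "((\<lambda>s. \<Phi> (g s) x) \<longlongrightarrow> \<Phi> a x) F" .
qed

lemma wlim_norm_le:
  assumes \<Phi>: "dual_iso \<Phi>" and F: "F \<noteq> bot" and l: "wlim \<Phi> f a F"
    and b: "eventually (\<lambda>s. norm (f s) \<le> K) F" and K: "0 \<le> K"
  shows "norm a \<le> K"
proof -
  have "norm (\<Phi> a) \<le> K"
  proof (rule norm_blinfun_bound[OF K])
    fix x
    have "((\<lambda>s. norm (\<Phi> (f s) x)) \<longlongrightarrow> norm (\<Phi> a x)) F" using l by (auto simp: wlim_def intro: tendsto_norm)
    moreover have "eventually (\<lambda>s. norm (\<Phi> (f s) x) \<le> K * norm x) F"
      using b
    proof eventually_elim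
      case (elim s)
      show ?case using norm_blinfun[of "\<Phi> (f s)" x] mult_right_mono[OF elim, of "norm x"]
        by (simp add: dual_iso_norm[OF \<Phi>])
    qed
    ultimately show "norm (\<Phi> a x) \<le> K * norm x" using F by (rule tendsto_upperbound)
  qed
  then show ?thesis by (simp add: dual_iso_norm[OF \<Phi>])
qed

text \<open>This is the representation half of Banach-Alaoglu: a pointwise limit of uniformly
  bounded functionals is bounded and linear, and surjectivity of \<open>\<Phi>\<close> represents it
  by an element of the algebra.\<close>

lemma wlim_exists:
  assumes \<Phi>: "dual_iso \<Phi>" and F: "F \<noteq> bot" and b: "eventually (\<lambda>s. norm (f s) \<le> K) F" and K: "0 \<le> K"
    and l: "\<And>x. ((\<lambda>s. Re (\<Phi> (f s) x)) \<longlongrightarrow> l x) F"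
  shows "\<exists>a. wlim \<Phi> f a F"
proof -
  \<comment> \<open>The imaginary part is recovered from the real part at
    \<open>\<i> *\<^sub>C x\<close>, because \<open>Re (\<i> * z) = - Im z\<close>.\<close>
  define \<psi> where "\<psi> x = Complex (l x) (- l (\<i> *\<^sub>C x))" for x
  have lim: "((\<lambda>s. \<Phi> (f s) x) \<longlongrightarrow> \<psi> x) F" for x
  proof -
    have "((\<lambda>s. Re (\<i> * \<Phi> (f s) x)) \<longlongrightarrow> l (\<i> *\<^sub>C x)) F"
      using l[of "\<i> *\<^sub>C x"] by (simp only: dual_iso_arg[OF \<Phi>])
    then have "((\<lambda>s. - Im (\<Phi> (f s) x)) \<longlongrightarrow> l (\<i> *\<^sub>C x)) F" by simp
    from tendsto_minus[OF this] l[of x] show ?thesis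
      by (simp add: tendsto_complex_iff \<psi>_def)
  qed
  have add: "\<psi> (x + y) = \<psi> x + \<psi> y" for x y
    using tendsto_unique[OF F lim[of "x + y"]] tendsto_add[OF lim[of x] lim[of y]]
    by (simp add: blinfun.add_right)
  have sc: "\<psi> (c *\<^sub>C x) = c * \<psi> x" for c x
    using tendsto_unique[OF F lim[of "c *\<^sub>C x"]] tendsto_mult_left[OF lim[of x], of c]
    by (simp add: dual_iso_arg[OF \<Phi>])
  have bd: "norm (\<psi> x) \<le> norm x * K" for x
  proof -
    have "eventually (\<lambda>s. norm (\<Phi> (f s) x) \<le> norm x * K) F"
      using b
    proof eventually_elim
      case (elim s)
      show ?case using norm_blinfun[of "\<Phi> (f s)" x] mult_right_mono[OF elim, of "norm x"]
        by (simp add: dual_iso_norm[OF \<Phi>] mult.commute)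
    qed
    then show ?thesis by (rule tendsto_upperbound[OF tendsto_norm[OF lim[of x]] _ F])
  qed
  have bl: "bounded_linear \<psi>"
    by (rule bounded_linear_intro[OF add _ bd]) (simp add: scaleR_scaleC sc scaleR_conv_of_real)
  have "Blinfun \<psi> \<in> complex_dual"
    by (simp add: complex_dual_def bounded_linear_Blinfun_apply[OF bl] sc)
  then obtain a where "\<Phi> a = Blinfun \<psi>" using \<Phi> unfolding dual_iso_def bij_betw_def by (metis imageE)
  then have "wlim \<Phi> f a F" using lim by (simp add: wlim_def bounded_linear_Blinfun_apply[OF bl])
  then show ?thesis by blast
qed

text \<open>Multiplication by \<open>b\<close> is weakly continuous on bounded sets. With \<open>d = b - \<omega> b\<close> the family
  \<open>d f\<^sub>s\<close> is small where \<open>d\<close> is, so adding a large multiple of \<open>\<parallel>d\<parallel>\<^sup>2 - d\<^sup>*d\<close>, which peaks at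
  \<open>\<omega>\<close>, increases its norm by hardly more than the norm of that multiple.\<close>

lemma wlim_mult:
  fixes b :: "'a::comm_unital_cstar_algebra"
  assumes \<Phi>: "dual_iso \<Phi>" and F: "F \<noteq> bot" and bd: "eventually (\<lambda>s. norm (f s) \<le> K) F"
    and f: "wlim \<Phi> f a F" and bf: "wlim \<Phi> (\<lambda>s. b * f s) a' F"
  shows "a' = b * a"
proof (rule char_eqI)
  fix \<omega> :: "'a \<Rightarrow> complex" assume c: "character \<omega>"
  define d where "d = b - \<omega> b *\<^sub>C 1"
  have wd: "\<omega> d = 0" using c by (simp add: d_def char_simps)
  define z where "z = a' - \<omega> b *\<^sub>C a"
  have "wlim \<Phi> (\<lambda>s. b * f s - \<omega> b *\<^sub>C f s) z F"
    unfolding z_def by (intro wlim_diff wlim_scaleC \<Phi> f bf)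
  then have z: "wlim \<Phi> (\<lambda>s. d * f s) z F"
    by (simp add: d_def left_diff_distrib mult_scaleC_left)
  have small: "cmod (\<omega> z) \<le> 0 + e" if e: "0 < e" for e
  proof (cases "\<omega> z = 0")
    case False
    \<comment> \<open>The maximum of \<open>t * K - n * t\<^sup>2\<close> over \<open>t\<close> is
      \<open>K\<^sup>2 / (4 * n)\<close>; this \<open>n\<close> makes it at most
      \<open>e\<close>.\<close>
    define n where "n = (K\<^sup>2 + 1) / e"
    have n: "0 < n" using e by (simp add: n_def add_nonneg_pos)
    have Kn: "K\<^sup>2 / (4 * n) \<le> e"
    proof -
      have "K\<^sup>2 \<le> 4 * (K\<^sup>2 + 1)" by simp
      also have "\<dots> = e * (4 * n)" using e by (simp add: n_def)
      finally show ?thesis using n by (simp add: pos_divide_le_eq)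
    qed
    define D where "D = (norm d)\<^sup>2"
    \<comment> \<open>With the phase of \<open>\<omega> z\<close> in \<open>w\<close>, the two terms
      of \<open>\<omega> (z + w)\<close> add up without cancellation.\<close>
    define u where "u = sgn (\<omega> z)"
    have u: "cmod u = 1" "\<omega> z = u * cmod (\<omega> z)" using False by (simp_all add: u_def sgn_eq norm_divide)
    define w where "w = (u * of_real n) *\<^sub>C (D *\<^sub>R 1 - d * star d)"
    have "norm (z + w) \<le> n * D + K\<^sup>2 / (4 * n)"
    proof (rule wlim_norm_le[OF \<Phi> F])
      show "wlim \<Phi> (\<lambda>s. d * f s + w) (z + w) F" by (intro wlim_add \<Phi> z wlim_const)
      show "0 \<le> n * D + K\<^sup>2 / (4 * n)" using n by (simp add: D_def)
      show "eventually (\<lambda>s. norm (d * f s + w) \<le> n * D + K\<^sup>2 / (4 * n)) F"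
        using bd
      proof eventually_elim
        case (elim s)
        show ?case
        proof (rule norm_le_char)
          fix \<phi> :: "'a \<Rightarrow> complex" assume p: "character \<phi>"
          define t where "t = cmod (\<phi> d)"
          have t: "0 \<le> t" "t\<^sup>2 \<le> D" using norm_char_le[OF p, of d] by (simp_all add: t_def D_def power_mono)
          have "cmod (\<phi> (f s)) \<le> K" using norm_char_le[OF p] elim order_trans by blast
          then have 1: "cmod (\<phi> (d * f s)) \<le> t * K" using p t by (simp add: char_mult norm_mult t_def mult_left_mono)
          have "\<phi> w = u * of_real (n * (D - t\<^sup>2))"
            using p char_mult_star[OF p, of d]
            by (simp add: w_def char_scaleC char_diff char_scaleR char_one t_def mult.assoc)
          then have 2: "cmod (\<phi> w) = n * (D - t\<^sup>2)" using u n t by (simp only: norm_mult norm_of_real) simp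
          have "t * K - n * t\<^sup>2 \<le> K\<^sup>2 / (4 * n)"
          proof -
            have "0 \<le> (K - 2 * n * t)\<^sup>2" by simp
            then have "(t * K - n * t\<^sup>2) * (4 * n) \<le> K\<^sup>2" by (simp add: power2_eq_square algebra_simps)
            then show ?thesis using n by (simp add: pos_le_divide_eq)
          qed
          then have "t * K + n * (D - t\<^sup>2) \<le> n * D + K\<^sup>2 / (4 * n)" by (simp add: right_diff_distrib)
          moreover have "cmod (\<phi> (d * f s + w)) \<le> t * K + n * (D - t\<^sup>2)"
            using norm_triangle_ineq[of "\<phi> (d * f s)" "\<phi> w"] 1 2 by (simp add: char_add[OF p])
          ultimately show "cmod (\<phi> (d * f s + w)) \<le> n * D + K\<^sup>2 / (4 * n)" by linarith
        next
          show "0 \<le> n * D + K\<^sup>2 / (4 * n)" using n by (simp add: D_def)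
        qed
      qed
    qed
    moreover have "\<omega> (z + w) = u * of_real (cmod (\<omega> z) + n * D)"
    proof -
      have "\<omega> w = u * of_real (n * D)"
        using c wd by (simp add: w_def char_simps)
      then show ?thesis using u(2) c by (simp add: char_add distrib_left)
    qed
    then have "cmod (\<omega> (z + w)) = cmod (\<omega> z) + n * D"
      using u(1) n by (simp only: norm_mult norm_of_real) (simp add: D_def)
    ultimately show ?thesis using norm_char_le[OF c, of "z + w"] Kn by linarith
  qed (use e in simp)
  then have "cmod (\<omega> z) \<le> 0" by (rule field_le_epsilon)
  then show "\<omega> a' = \<omega> (b * a)" using c by (simp add: z_def char_simps)
qed

section \<open>An extreme point in a set of module contractions\<close>

context comm_hilbert_module
begin

text \<open>In the application \<open>e\<close> restricts families to \<open>G\<close>,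
  \<open>L\<close> consists of the translations, and \<open>\<alpha>\<close>, \<open>\<beta>\<close>
  are the analysis operators of two Parseval vectors.\<close>

definition corner_contractions ::
  "('h \<Rightarrow> 'h) \<Rightarrow> 'g set \<Rightarrow> ('g \<Rightarrow> 'h \<Rightarrow> 'h) \<Rightarrow> ('z \<Rightarrow> 'h) \<Rightarrow> ('z \<Rightarrow> 'h) \<Rightarrow> ('h \<Rightarrow> 'h) set"
  where "corner_contractions e I L \<alpha> \<beta> = {w. (\<exists>w'. adj_pair ip ip w w') \<and> (\<forall>x. norm (w x) \<le> norm x) \<and>
    (\<forall>x. w (e x) = w x) \<and> (\<forall>x. e (w x) = w x) \<and> (\<forall>g\<in>I. \<forall>x. w (L g x) = L g (w x)) \<and> (\<forall>z. w (\<alpha> z) = \<beta> z)}"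

text \<open>The module need not be self-dual itself: only functionals that factor through the
  projection \<open>e\<close> have to be represented.\<close>

lemma weakly_compact_contractions:
  fixes \<Phi> :: "'a \<Rightarrow> ('x::complex_banach \<Rightarrow>\<^sub>L complex)"
  assumes \<Phi>: "dual_iso \<Phi>"
    and e: "adj_pair ip ip e e" "\<And>x. e (e x) = e x"
    and sd: "\<And>f. (\<And>x y. f (x + y) = f x + f y) \<Longrightarrow> (\<And>a x. f (act a x) = a * f x) \<Longrightarrow>
       (\<And>x. f (e x) = f x) \<Longrightarrow> (\<exists>B. \<forall>x. norm (f x) \<le> B * norm x) \<Longrightarrow> \<exists>y. \<forall>x. f x = ip x y"
    and L: "\<And>g. g \<in> I \<Longrightarrow> \<exists>L'. adj_pair ip ip (L g) L'"
  shows "compact ((\<lambda>w. (\<lambda>(x, y, p). Re (\<Phi> (ip (w x) y) p))) ` corner_contractions e I L \<alpha> \<beta>)"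
proof -
  define C where "C = corner_contractions e I L \<alpha> \<beta>"
  define \<iota> :: "('h \<Rightarrow> 'h) \<Rightarrow> ('h \<times> 'h \<times> 'x) \<Rightarrow> real" where "\<iota> w = (\<lambda>(x, y, p). Re (\<Phi> (ip (w x) y) p))" for w
  \<comment> \<open>A product of compact intervals, compact by Tychonoff, that contains the
    coordinates of all contractions.\<close>
  define Q :: "(('h \<times> 'h \<times> 'x) \<Rightarrow> real) set"
    where "Q = PiE UNIV (\<lambda>(x, y, p). {- (norm x * norm y * norm p) .. norm x * norm y * norm p})"
  have bdC: "norm (ip (w x) y) \<le> norm x * norm y" if "w \<in> C" for w x y
  proof -
    have "norm (w x) \<le> norm x" using that by (simp add: C_def corner_contractions_def)
    then show ?thesis using order_trans[OF norm_ip_le mult_right_mono] norm_ge_zero by blast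
  qed
  have CQ: "\<iota> w \<in> Q" if "w \<in> C" for w
  proof -
    have "\<bar>Re (\<Phi> (ip (w x) y) p)\<bar> \<le> norm x * norm y * norm p" for x y p
    proof -
      have "\<bar>Re (\<Phi> (ip (w x) y) p)\<bar> \<le> norm (\<Phi> (ip (w x) y)) * norm p"
        using abs_Re_le_cmod norm_blinfun order_trans by blast
      also have "\<dots> \<le> norm x * norm y * norm p"
        by (intro mult_right_mono) (simp_all add: dual_iso_norm[OF \<Phi>] bdC that)
      finally show ?thesis .
    qed
    then show ?thesis unfolding Q_def \<iota>_def by (auto simp: PiE_def abs_le_iff Pi_def) (smt (verit))+
  qed
  have "compactin (product_topology (\<lambda>_. euclidean) UNIV) Q"
    unfolding Q_def compactin_PiE by (auto simp: compactin_euclidean_iff split: prod.split)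
  then have compQ: "compact Q" by (simp add: euclidean_product_topology)
  show ?thesis unfolding C_def[symmetric] \<iota>_def[symmetric] compact_filter
  proof (intro allI impI)
    fix F0 :: "(('h \<times> 'h \<times> 'x) \<Rightarrow> real) filter"
    assume F0: "F0 \<noteq> bot" "eventually (\<lambda>s. s \<in> \<iota> ` C) F0"
    have "eventually (\<lambda>s. s \<in> Q) F0" using F0(2) by eventually_elim (use CQ in auto)
    then obtain p where "inf (nhds p) F0 \<noteq> bot" using compQ F0(1) unfolding compact_filter by blast
    define F where "F = inf (nhds p) F0"
    have F: "F \<noteq> bot" using \<open>inf (nhds p) F0 \<noteq> bot\<close> by (simp add: F_def)
    have coord: "((\<lambda>s. s j) \<longlongrightarrow> p j) F" for j
    proof -
      have "((\<lambda>s. s j) \<longlongrightarrow> p j) (nhds p)"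
      proof (rule topological_tendstoI)
        fix U :: "real set" assume U: "open U" "p j \<in> U"
        have "open ((\<lambda>s::('h \<times> 'h \<times> 'x) \<Rightarrow> real. s j) -` U)"
          using open_vimage[OF U(1) continuous_on_product_coordinates] .
        then show "eventually (\<lambda>s. s j \<in> U) (nhds p)"
          unfolding eventually_nhds using U(2) by (intro exI[of _ "(\<lambda>s. s j) -` U"]) auto
      qed
      then show ?thesis unfolding F_def by (rule tendsto_mono[rotated]) simp
    qed
    \<comment> \<open>The filter lives on coordinate functions; \<open>W s\<close> picks an operator
      with coordinates \<open>s\<close>.\<close>
    define W where "W s = inv_into C \<iota> s" for s
    have "eventually (\<lambda>s. s \<in> \<iota> ` C) F" using F0(2) unfolding F_def by (rule filter_leD[rotated]) simp
    then have ev: "eventually (\<lambda>s. W s \<in> C \<and> \<iota> (W s) = s) F"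
      by eventually_elim (simp add: W_def inv_into_into f_inv_into_f)
    have evb: "eventually (\<lambda>s. norm (ip (W s x) y) \<le> norm x * norm y) F" for x y
      using ev by eventually_elim (simp add: bdC)
    have "\<exists>a. wlim \<Phi> (\<lambda>s. ip (W s x) y) a F" for x y
    proof (rule wlim_exists[OF \<Phi> F evb])
      fix q
      have "eventually (\<lambda>s. s (x, y, q) = Re (\<Phi> (ip (W s x) y) q)) F"
        using ev by eventually_elim (auto simp: \<iota>_def fun_eq_iff)
      from iffD1[OF tendsto_cong[OF this] coord]
      show "((\<lambda>s. Re (\<Phi> (ip (W s x) y) q)) \<longlongrightarrow> p (x, y, q)) F" .
    qed simp
    then obtain \<sigma> where \<sigma>: "\<And>x y. wlim \<Phi> (\<lambda>s. ip (W s x) y) (\<sigma> x y) F" by metis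
    have Wadj: "W s (x + y) = W s x + W s y" "W s (act a x) = act a (W s x)" if "W s \<in> C" for s x y a
      using that E.adj_add E.adj_act by (auto simp: C_def corner_contractions_def)
    have uniq: "\<sigma> x y = a" if "wlim \<Phi> f a F" "eventually (\<lambda>s. W s \<in> C \<longrightarrow> ip (W s x) y = f s) F" for x y a f
    proof -
      have "eventually (\<lambda>s. f s = ip (W s x) y) F" using ev that(2) by eventually_elim simp
      from wlim_unique[OF \<Phi> F \<sigma> wlim_cong[OF this that(1)]] show ?thesis .
    qed
    have add1: "\<sigma> (x + x') y = \<sigma> x y + \<sigma> x' y" for x x' y
      by (rule uniq[OF wlim_add[OF \<Phi> \<sigma> \<sigma>]]) (simp add: Wadj ip_simps)
    have add2: "\<sigma> x (y + y') = \<sigma> x y + \<sigma> x y'" for x y y'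
      by (rule uniq[OF wlim_add[OF \<Phi> \<sigma> \<sigma>]]) (simp add: ip_simps)
    \<comment> \<open>Compatibility with the action survives the limit because multiplication by
      \<open>a\<close> is weak-star continuous on bounded families.\<close>
    have act1: "\<sigma> (act a x) y = a * \<sigma> x y" for a x y
    proof (rule wlim_mult[OF \<Phi> F evb \<sigma>])
      show "wlim \<Phi> (\<lambda>s. a * ip (W s x) y) (\<sigma> (act a x) y) F"
        by (rule wlim_cong[OF _ \<sigma>]) (use ev in \<open>eventually_elim, simp add: Wadj ip_simps\<close>)
    qed
    have act2: "\<sigma> x (act a y) = star a * \<sigma> x y" for a x y
    proof (rule wlim_mult[OF \<Phi> F evb \<sigma>])
      show "wlim \<Phi> (\<lambda>s. star a * ip (W s x) y) (\<sigma> x (act a y)) F"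
        by (rule wlim_cong[OF _ \<sigma>]) (simp add: ip_simps)
    qed
    have bd: "norm (\<sigma> x y) \<le> norm x * norm y" for x y by (rule wlim_norm_le[OF \<Phi> F \<sigma> evb]) simp
    have e1: "\<sigma> (e x) y = \<sigma> x y" for x y
      by (rule uniq[OF \<sigma>]) (simp add: C_def corner_contractions_def)
    have e2: "\<sigma> x (e y) = \<sigma> x y" for x y
      by (rule uniq[OF \<sigma>]) (simp add: C_def corner_contractions_def flip: adj_pairD[OF e(1)])
    \<comment> \<open>The limit form is represented in both variables: in the first this yields the
      adjoint \<open>v\<close>, in the second, after \<open>star\<close>, the operator
      \<open>w\<close>.\<close>
    have "\<exists>v. \<forall>x. \<sigma> x y = ip x v" for y
      by (rule sd) (auto simp: add1 act1 e1 intro!: exI[of _ "norm y"] order_trans[OF bd] simp: mult.commute)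
    then obtain v where v: "\<And>x y. \<sigma> x y = ip x (v y)" by metis
    have "\<exists>w. \<forall>y. star (\<sigma> x y) = ip y w" for x
      by (rule sd) (auto simp: add2 act2 e2 star_add star_mult star_star mult.commute intro!: exI[of _ "norm x"] bd)
    then obtain w where "\<And>x y. star (\<sigma> x y) = ip y (w x)" by metis
    then have w: "\<sigma> x y = ip (w x) y" for x y by (metis ip_star star_star)
    have nw: "norm (w x) \<le> norm x" for x
    proof (cases "norm (w x) = 0")
      case False
      have "norm (w x) * norm (w x) = norm (\<sigma> x (w x))" by (simp add: w flip: norm_square power2_eq_square)
      also have "\<dots> \<le> norm x * norm (w x)" by (rule bd)
      finally show ?thesis by (rule mult_right_le_imp_le) (use False in simp)
    qed simp
    have "adj_pair ip ip w v" unfolding adj_pair_def using w v nw by (metis mult_1)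
    moreover have "w (e x) = w x" for x by (rule ip_ext) (simp add: e1 flip: w)
    moreover have "e (w x) = w x" for x by (rule ip_ext) (simp add: e2 adj_pairD[OF e(1)] flip: w)
    moreover have "w (L g x) = L g (w x)" if g: "g \<in> I" for g x
    proof (rule ip_ext)
      fix y
      obtain L' where L': "adj_pair ip ip (L g) L'" using L[OF g] by blast
      have "\<sigma> (L g x) y = \<sigma> x (L' y)"
        by (rule uniq[OF \<sigma>]) (use g in \<open>simp add: C_def corner_contractions_def adj_pairD[OF L']\<close>)
      then show "ip (w (L g x)) y = ip (L g (w x)) y" by (simp add: adj_pairD[OF L'] flip: w)
    qed
    moreover have "w (\<alpha> z) = \<beta> z" for z
    proof (rule ip_ext)
      fix y
      have "\<sigma> (\<alpha> z) y = ip (\<beta> z) y"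
        by (rule uniq[OF wlim_const]) (simp add: C_def corner_contractions_def)
      then show "ip (w (\<alpha> z)) y = ip (\<beta> z) y" by (simp flip: w)
    qed
    ultimately have wC: "w \<in> C" using nw unfolding C_def corner_contractions_def by blast
    have "\<iota> w = p"
    proof
      fix j :: "'h \<times> 'h \<times> 'x"
      obtain x y q where j: "j = (x, y, q)" by (cases j) auto
      have "((\<lambda>s. Re (\<Phi> (ip (W s x) y) q)) \<longlongrightarrow> Re (\<Phi> (\<sigma> x y) q)) F"
        using \<sigma>[of x y] by (auto simp: wlim_def intro: tendsto_Re)
      moreover have "eventually (\<lambda>s. Re (\<Phi> (ip (W s x) y) q) = s j) F"
        using ev by eventually_elim (auto simp: \<iota>_def fun_eq_iff j)
      ultimately have "((\<lambda>s. s j) \<longlongrightarrow> Re (\<Phi> (\<sigma> x y) q)) F" by (simp only: tendsto_cong)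
      from tendsto_unique[OF F this coord] show "\<iota> w j = p j" by (simp add: \<iota>_def j w)
    qed
    with wC show "\<exists>s\<in>\<iota> ` C. inf (nhds s) F0 \<noteq> bot" using F by (auto simp: F_def)
  qed
qed

text \<open>The coordinates are additive and determine an operator, so an extreme point among the
  coordinate functions comes from an extreme operator.\<close>

lemma ex_extreme_contraction:
  fixes \<Phi> :: "'a \<Rightarrow> ('x::complex_banach \<Rightarrow>\<^sub>L complex)"
  assumes \<Phi>: "dual_iso \<Phi>"
    and e: "adj_pair ip ip e e" "\<And>x. e (e x) = e x"
    and sd: "\<And>f. (\<And>x y. f (x + y) = f x + f y) \<Longrightarrow> (\<And>a x. f (act a x) = a * f x) \<Longrightarrow>
       (\<And>x. f (e x) = f x) \<Longrightarrow> (\<exists>B. \<forall>x. norm (f x) \<le> B * norm x) \<Longrightarrow> \<exists>y. \<forall>x. f x = ip x y"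
    and L: "\<And>g. g \<in> I \<Longrightarrow> \<exists>L'. adj_pair ip ip (L g) L'"
    and ne: "corner_contractions e I L \<alpha> \<beta> \<noteq> {}"
  shows "\<exists>u\<in>corner_contractions e I L \<alpha> \<beta>. \<forall>a\<in>corner_contractions e I L \<alpha> \<beta>.
    \<forall>b\<in>corner_contractions e I L \<alpha> \<beta>. (\<forall>x. u x + u x = a x + b x) \<longrightarrow> a = u"
proof -
  define C where "C = corner_contractions e I L \<alpha> \<beta>"
  define \<iota> :: "('h \<Rightarrow> 'h) \<Rightarrow> ('h \<times> 'h \<times> 'x) \<Rightarrow> real" where "\<iota> w = (\<lambda>(x, y, p). Re (\<Phi> (ip (w x) y) p))" for w
  have "compact (\<iota> ` C)" unfolding C_def \<iota>_def
    by (rule weakly_compact_contractions[OF \<Phi> e sd L])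
  moreover have "\<iota> ` C \<noteq> {}" using ne by (simp add: C_def)
  ultimately obtain s where s: "s \<in> \<iota> ` C"
    "\<forall>a\<in>\<iota> ` C. \<forall>b\<in>\<iota> ` C. (\<forall>j. 2 * s j = a j + b j) \<longrightarrow> a = s"
    using compact_midpoint_extreme[of "\<iota> ` C"] by blast
  then obtain u0 where u0: "u0 \<in> C" "s = \<iota> u0" by blast
  have u: "\<iota> a = \<iota> u0" if "a \<in> C" "b \<in> C" "\<forall>j. 2 * \<iota> u0 j = \<iota> a j + \<iota> b j" for a b
    using s(2) that unfolding u0(2) by blast
  have inj: "a = b" if "\<iota> a = \<iota> b" for a b
  proof (rule ext, rule ip_ext)
    fix x y
    show "ip (a x) y = ip (b x) y"
      by (rule dual_iso_inj_Re[OF \<Phi>]) (use that in \<open>auto simp: \<iota>_def fun_eq_iff\<close>)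
  qed
  have "a = u0" if "a \<in> C" "b \<in> C" "\<forall>x. u0 x + u0 x = a x + b x" for a b
  proof (rule inj, rule u[OF that(1,2)], rule allI)
    fix j :: "'h \<times> 'h \<times> 'x"
    obtain x y q where j: "j = (x, y, q)" by (cases j) auto
    have "ip (u0 x) y + ip (u0 x) y = ip (a x) y + ip (b x) y" using that(3) by (metis ip_add_left)
    then have "\<Phi> (ip (u0 x) y) q + \<Phi> (ip (u0 x) y) q = \<Phi> (ip (a x) y) q + \<Phi> (ip (b x) y) q"
      by (metis dual_iso_add[OF \<Phi>])
    then show "2 * \<iota> u0 j = \<iota> a j + \<iota> b j" by (auto simp: \<iota>_def j complex_eq_iff)
  qed
  then show ?thesis using u0(1) unfolding C_def by blast
qed

end

section \<open>Invariant operators on the standard module of a group\<close>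

lemma square_summable_extend:
  "square_summable (\<lambda>h. if h \<in> A then f h else 0) UNIV \<longleftrightarrow> square_summable f A"
  unfolding square_summable_def by (rule summable_on_cong_neutral) auto

lemma square_summable_subset: "square_summable f B \<Longrightarrow> A \<subseteq> B \<Longrightarrow> square_summable f A"
  unfolding square_summable_def by (rule summable_on_subset_banach)

text \<open>The values are cut off outside \<open>G\<close>, so the identity permutation gives the
  projection onto families supported on \<open>G\<close>.\<close>

definition l2_reindex :: "'g set \<Rightarrow> ('g \<Rightarrow> 'g) \<Rightarrow> ('g, 'a) l2 \<Rightarrow> ('g, 'a::comm_unital_cstar_algebra) l2"
  where "l2_reindex G \<sigma> f = mk_l2 (\<lambda>h. if h \<in> G then coef f (\<sigma> h) else 0)"

lemma coef_l2_reindex: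
  assumes "bij_betw \<sigma> G G"
  shows "coef (l2_reindex G \<sigma> f) = (\<lambda>h. if h \<in> G then coef f (\<sigma> h) else 0)"
proof -
  have "square_summable (coef f) G" by (rule square_summable_subset[OF square_summable_coef]) simp
  then have "square_summable (\<lambda>h. coef f (\<sigma> h)) G" by (simp add: square_summable_reindex[OF assms])
  then show ?thesis unfolding l2_reindex_def by (intro coef_mk_l2) (simp add: square_summable_extend)
qed

lemma l2_inner_supported:
  assumes "\<And>h. h \<notin> G \<Longrightarrow> coef g h = 0"
  shows "l2_inner f g = (\<Sum>\<^sub>\<infinity>h\<in>G. coef f h * star (coef g h))"
  unfolding l2_inner_def by (rule infsum_cong_neutral) (auto simp: assms)

lemma l2_inner_supported_left:
  assumes "\<And>h. h \<notin> G \<Longrightarrow> coef f h = 0"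
  shows "l2_inner f g = (\<Sum>\<^sub>\<infinity>h\<in>G. coef f h * star (coef g h))"
  unfolding l2_inner_def by (rule infsum_cong_neutral) (auto simp: assms)

lemma l2_reindex_adjoint:
  assumes \<sigma>: "bij_betw \<sigma> G G" and \<tau>: "bij_betw \<tau> G G" and inv: "\<And>h. h \<in> G \<Longrightarrow> \<tau> (\<sigma> h) = h"
  shows "l2_inner (l2_reindex G \<sigma> f) g = l2_inner f (l2_reindex G \<tau> g)"
proof -
  have "l2_inner (l2_reindex G \<sigma> f) g = (\<Sum>\<^sub>\<infinity>h\<in>G. coef f (\<sigma> h) * star (coef g h))"
    by (subst l2_inner_supported_left[of G]) (auto simp: coef_l2_reindex[OF \<sigma>] intro: infsum_cong)
  also have "\<dots> = (\<Sum>\<^sub>\<infinity>h\<in>G. coef f (\<sigma> h) * star (coef g (\<tau> (\<sigma> h))))"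
    by (rule infsum_cong) (simp add: inv)
  also have "\<dots> = (\<Sum>\<^sub>\<infinity>h\<in>G. coef f h * star (coef g (\<tau> h)))"
    by (rule infsum_reindex_bij_betw[OF \<sigma>])
  also have "\<dots> = l2_inner f (l2_reindex G \<tau> g)"
    by (subst l2_inner_supported[of G]) (auto simp: coef_l2_reindex[OF \<tau>] intro: infsum_cong)
  finally show ?thesis .
qed

lemma norm_l2_reindex:
  assumes \<sigma>: "bij_betw \<sigma> G G"
  shows "norm (l2_reindex G \<sigma> f) \<le> norm f"
proof (subst norm_l2_le_iff, simp, intro allI impI)
  fix F :: "'a set" and \<omega> :: "'b \<Rightarrow> complex" assume F: "finite F" and c: "character \<omega>"
  have inj: "inj_on \<sigma> (F \<inter> G)" using \<sigma> by (meson bij_betw_def inf_le2 inj_on_subset)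
  have "(char_l2 \<omega> (coef (l2_reindex G \<sigma> f)) F)\<^sup>2 = (\<Sum>h\<in>F \<inter> G. (cmod (\<omega> (coef f (\<sigma> h))))\<^sup>2)"
    unfolding char_l2_square coef_l2_reindex[OF \<sigma>]
    by (rule sum.mono_neutral_cong_right[OF F]) (auto simp: char_zero[OF c])
  also have "\<dots> = (char_l2 \<omega> (coef f) (\<sigma> ` (F \<inter> G)))\<^sup>2"
    unfolding char_l2_square by (simp add: sum.reindex[OF inj])
  finally have "char_l2 \<omega> (coef (l2_reindex G \<sigma> f)) F = char_l2 \<omega> (coef f) (\<sigma> ` (F \<inter> G))"
    by (simp add: power2_eq_iff_nonneg)
  then show "char_l2 \<omega> (coef (l2_reindex G \<sigma> f)) F \<le> norm f"
    using char_l2_le_norm[OF _ c, of "\<sigma> ` (F \<inter> G)" f] F by simp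
qed

lemma l2_reindex_adj_pair:
  assumes \<sigma>: "bij_betw \<sigma> G G" and \<tau>: "bij_betw \<tau> G G" and inv: "\<And>h. h \<in> G \<Longrightarrow> \<tau> (\<sigma> h) = h"
  shows "adj_pair l2_inner l2_inner (l2_reindex G \<sigma>) (l2_reindex G \<tau>)"
  unfolding adj_pair_def using l2_reindex_adjoint[OF assms] norm_l2_reindex[OF \<sigma>] by (metis mult_1)

text \<open>The group is a set inside a type because it will consist of operators under
  composition.\<close>

locale index_group =
  fixes G :: "'g set" and mul :: "'g \<Rightarrow> 'g \<Rightarrow> 'g" (infixl \<open>\<cdot>\<close> 70) and e :: 'g and inv :: "'g \<Rightarrow> 'g"
  assumes mul_closed: "g \<in> G \<Longrightarrow> h \<in> G \<Longrightarrow> g \<cdot> h \<in> G" and e_closed: "e \<in> G"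
    and inv_closed: "g \<in> G \<Longrightarrow> inv g \<in> G"
    and assoc: "g \<in> G \<Longrightarrow> h \<in> G \<Longrightarrow> k \<in> G \<Longrightarrow> g \<cdot> h \<cdot> k = g \<cdot> (h \<cdot> k)"
    and e_left: "g \<in> G \<Longrightarrow> e \<cdot> g = g" and e_right: "g \<in> G \<Longrightarrow> g \<cdot> e = g"
    and inv_left: "g \<in> G \<Longrightarrow> inv g \<cdot> g = e" and inv_right: "g \<in> G \<Longrightarrow> g \<cdot> inv g = e"
begin

lemma inv_mul_cancel: "g \<in> G \<Longrightarrow> h \<in> G \<Longrightarrow> inv g \<cdot> (g \<cdot> h) = h"
  by (simp add: inv_left e_left inv_closed flip: assoc)

lemma mul_inv_cancel: "g \<in> G \<Longrightarrow> h \<in> G \<Longrightarrow> g \<cdot> (inv g \<cdot> h) = h"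
  by (simp add: inv_right e_left inv_closed flip: assoc)

lemma inv_eqI: "g \<in> G \<Longrightarrow> h \<in> G \<Longrightarrow> g \<cdot> h = e \<Longrightarrow> inv g = h"
  by (metis e_right inv_closed inv_mul_cancel)

lemma inv_inv: "g \<in> G \<Longrightarrow> inv (inv g) = g"
  by (rule inv_eqI) (simp_all add: inv_closed inv_left)

lemma inv_mul:
  assumes "g \<in> G" "h \<in> G" shows "inv (g \<cdot> h) = inv h \<cdot> inv g"
proof (rule inv_eqI)
  have "g \<cdot> h \<cdot> (inv h \<cdot> inv g) = g \<cdot> (h \<cdot> (inv h \<cdot> inv g))"
    using assms by (simp add: assoc mul_closed inv_closed)
  then show "g \<cdot> h \<cdot> (inv h \<cdot> inv g) = e" using assms by (simp add: mul_inv_cancel inv_closed inv_right)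
qed (use assms in \<open>simp_all add: mul_closed inv_closed\<close>)

lemma bij_same: "bij_betw (\<lambda>h. h) G G"
  by (simp add: bij_betw_def)

lemma bij_mul: "g \<in> G \<Longrightarrow> bij_betw ((\<cdot>) g) G G"
  by (rule bij_betw_byWitness[where f' = "(\<cdot>) (inv g)"])
    (auto simp: inv_mul_cancel mul_inv_cancel mul_closed inv_closed)

lemma bij_inv: "bij_betw inv G G"
  by (rule bij_betw_byWitness[where f' = inv]) (auto simp: inv_inv inv_closed)

definition rst :: "('g, 'a) l2 \<Rightarrow> ('g, 'a::comm_unital_cstar_algebra) l2"
  where "rst = l2_reindex G (\<lambda>h. h)"

definition lam :: "'g \<Rightarrow> ('g, 'a) l2 \<Rightarrow> ('g, 'a::comm_unital_cstar_algebra) l2"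
  where "lam g = l2_reindex G ((\<cdot>) (inv g))"

definition conj_inv :: "('g, 'a) l2 \<Rightarrow> ('g, 'a::comm_unital_cstar_algebra) l2"
  where "conj_inv f = mk_l2 (\<lambda>h. if h \<in> G then star (coef f (inv h)) else 0)"

lemma coef_rst [simp]: "coef (rst f) = (\<lambda>h. if h \<in> G then coef f h else 0)"
  by (simp add: rst_def coef_l2_reindex[OF bij_same])

lemma coef_lam: "g \<in> G \<Longrightarrow> coef (lam g f) = (\<lambda>h. if h \<in> G then coef f (inv g \<cdot> h) else 0)"
  by (simp add: lam_def coef_l2_reindex bij_mul inv_closed)

lemma coef_conj_inv [simp]: "coef (conj_inv f) = (\<lambda>h. if h \<in> G then star (coef f (inv h)) else 0)"
proof -
  have "square_summable (coef f) G" by (rule square_summable_subset[OF square_summable_coef]) simp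
  then have "square_summable (\<lambda>h. coef f (inv h)) G" by (simp add: square_summable_reindex[OF bij_inv])
  then have "square_summable (\<lambda>h. star (coef f (inv h))) G"
    by (simp add: square_summable_def star_star mult.commute)
  then show ?thesis unfolding conj_inv_def by (intro coef_mk_l2) (simp add: square_summable_extend)
qed

lemma adj_rst: "adj_pair l2_inner l2_inner rst rst"
  unfolding rst_def by (rule l2_reindex_adj_pair[OF bij_same bij_same refl])

lemma norm_rst: "norm (rst f) \<le> norm f"
  unfolding rst_def by (rule norm_l2_reindex[OF bij_same])

lemma rst_rst [simp]: "rst (rst f) = rst f"
  by (rule l2_eqI) simp

lemma rst_lam: "g \<in> G \<Longrightarrow> rst (lam g f) = lam g f"
  by (rule l2_eqI) (simp add: coef_lam)

lemma lam_rst: "g \<in> G \<Longrightarrow> lam g (rst f) = lam g f"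
  by (rule l2_eqI) (simp add: coef_lam mul_closed inv_closed)

lemma adj_lam: "g \<in> G \<Longrightarrow> adj_pair l2_inner l2_inner (lam g) (lam (inv g))"
  unfolding lam_def
  by (rule l2_reindex_adj_pair) (simp_all add: bij_mul inv_closed inv_inv mul_inv_cancel)

lemma rst_conj_inv [simp]: "rst (conj_inv f) = conj_inv f"
  by (rule l2_eqI) simp

lemma conj_inv_rst [simp]: "conj_inv (rst f) = conj_inv f"
  by (rule l2_eqI) (simp add: inv_closed)

lemma conj_inv_conj_inv [simp]: "conj_inv (conj_inv f) = rst f"
  by (rule l2_eqI) (simp add: inv_closed inv_inv star_star)

text \<open>\<open>conj_inv\<close> is conjugate-linear, so its symmetry takes this form instead of
  an \<open>adj_pair\<close>. It follows by substituting inverses in the sum of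
  \<open>coef x h * coef y (inv h)\<close>.\<close>

lemma conj_inv_sym: "l2_inner x (conj_inv y) = l2_inner y (conj_inv x)"
proof -
  have *: "l2_inner x (conj_inv y) = (\<Sum>\<^sub>\<infinity>h\<in>G. coef x h * coef y (inv h))" for x y :: "('g, 'a) l2"
    by (subst l2_inner_supported[of G]) (auto simp: star_star intro: infsum_cong)
  have "(\<Sum>\<^sub>\<infinity>h\<in>G. coef x h * coef y (inv h)) = (\<Sum>\<^sub>\<infinity>h\<in>G. coef x (inv h) * coef y (inv (inv h)))"
    by (rule infsum_reindex_bij_betw[OF bij_inv, symmetric])
  also have "\<dots> = (\<Sum>\<^sub>\<infinity>h\<in>G. coef y h * coef x (inv h))"
    by (rule infsum_cong) (simp add: inv_inv mult.commute)
  finally show ?thesis by (simp add: *)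
qed

lemma norm_conj_inv: "norm (conj_inv f) \<le> norm f"
proof -
  have "l2_inner (conj_inv f) (conj_inv f) = l2_inner f (rst f)" by (subst conj_inv_sym) simp
  also have "\<dots> = l2_inner (rst f) (rst f)" by (metis adj_pairD[OF adj_rst] rst_rst)
  finally have "norm (conj_inv f) = norm (rst f)" by (simp add: norm_l2_def)
  then show ?thesis using norm_rst[of f] by simp
qed

text \<open>Conjugating \<open>lam h\<close> by the flip gives right translation by
  \<open>h\<close>, and right and left translations commute by associativity.\<close>

lemma conj_inv_twist:
  assumes "g \<in> G" "h \<in> G"
  shows "conj_inv (lam h (conj_inv (lam g a))) = lam g (conj_inv (lam h (conj_inv a)))"
proof (rule l2_eqI)
  fix k
  have *: "inv (inv h \<cdot> inv j) = j \<cdot> h" if "j \<in> G" for j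
    using assms that by (simp add: inv_mul inv_closed inv_inv)
  show "coef (conj_inv (lam h (conj_inv (lam g a)))) k = coef (lam g (conj_inv (lam h (conj_inv a)))) k"
    using assms by (cases "k \<in> G") (simp_all add: coef_lam inv_closed mul_closed star_star * assoc)
qed

abbreviation (input) "\<delta> \<equiv> l2_unit e"

lemma rst_unit: "g \<in> G \<Longrightarrow> rst (l2_unit g) = l2_unit g"
  by (rule l2_eqI) auto

lemma lam_unit: "g \<in> G \<Longrightarrow> lam g \<delta> = l2_unit g"
proof (rule l2_eqI)
  fix h assume g: "g \<in> G"
  have "inv g \<cdot> h = e \<longleftrightarrow> h = g" if "h \<in> G"
    using g that by (metis e_right inv_left mul_inv_cancel)
  then show "coef (lam g \<delta>) h = coef (l2_unit g) h" using g by (auto simp: coef_lam)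
qed

lemma conj_inv_unit: "g \<in> G \<Longrightarrow> conj_inv (l2_unit g) = l2_unit (inv g)"
  by (rule l2_eqI) (auto simp: inv_inv inv_closed)

section \<open>The algebra \<open>N\<close> and its trace\<close>

definition invariant_op ::
  "(('g, 'a) l2 \<Rightarrow> ('g, 'a) l2) \<Rightarrow> (('g, 'a) l2 \<Rightarrow> ('g, 'a::comm_unital_cstar_algebra) l2) \<Rightarrow> bool"
  where "invariant_op w w' \<longleftrightarrow> adj_pair l2_inner l2_inner w w' \<and> (\<forall>x. w (rst x) = w x) \<and>
    (\<forall>x. rst (w x) = w x) \<and> (\<forall>g\<in>G. \<forall>x. w (lam g x) = lam g (w x))"

lemma inv_op_adj: "invariant_op w w' \<Longrightarrow> adj_pair l2_inner l2_inner w w'"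
  and inv_op_rst: "invariant_op w w' \<Longrightarrow> w (rst x) = w x"
  and rst_inv_op: "invariant_op w w' \<Longrightarrow> rst (w x) = w x"
  and inv_op_lam: "invariant_op w w' \<Longrightarrow> g \<in> G \<Longrightarrow> w (lam g x) = lam g (w x)"
  by (simp_all add: invariant_op_def)

lemma invariant_op_sym:
  assumes w: "invariant_op w w'" shows "invariant_op w' w"
proof -
  note a = inv_op_adj[OF w]
  have a': "l2_inner (w' x) y = l2_inner x (w y)" for x y
    by (rule adj_pairD[OF L2.E.adj_sym[OF a]])
  have "w' (rst x) = w' x" for x
    by (rule L2.ip_ext) (simp add: a' adj_pairD[OF adj_rst] rst_inv_op[OF w])
  moreover have "rst (w' x) = w' x" for x
    by (rule L2.ip_ext) (simp add: a' adj_pairD[OF adj_rst] inv_op_rst[OF w])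
  moreover have "w' (lam g x) = lam g (w' x)" if "g \<in> G" for g x
    by (rule L2.ip_ext) (simp add: a' adj_pairD[OF adj_lam[OF that]] inv_op_lam[OF w inv_closed[OF that]])
  ultimately show ?thesis using L2.E.adj_sym[OF a] by (simp add: invariant_op_def)
qed

lemma invariant_op_comp:
  assumes w: "invariant_op w w'" and v: "invariant_op v v'"
  shows "invariant_op (\<lambda>x. w (v x)) (\<lambda>x. v' (w' x))"
  unfolding invariant_op_def using adj_pair_comp[OF inv_op_adj[OF v] inv_op_adj[OF w]]
  by (simp add: inv_op_rst[OF v] rst_inv_op[OF w] inv_op_lam[OF v] inv_op_lam[OF w])

lemma invariant_op_plus:
  assumes w: "invariant_op w w'" and v: "invariant_op v v'"
  shows "invariant_op (\<lambda>x. w x + v x) (\<lambda>x. w' x + v' x)"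
  unfolding invariant_op_def using L2.E.adj_pair_plus[OF inv_op_adj[OF w] inv_op_adj[OF v]]
  by (simp add: inv_op_rst[OF w] inv_op_rst[OF v] L2.E.adj_add[OF adj_rst] rst_inv_op[OF w] rst_inv_op[OF v]
      L2.E.adj_add[OF adj_lam] inv_op_lam[OF v] inv_op_lam[OF w])

lemma invariant_op_scaleR:
  assumes w: "invariant_op w w'"
  shows "invariant_op (\<lambda>x. r *\<^sub>R w x) (\<lambda>x. r *\<^sub>R w' x)"
  unfolding invariant_op_def using L2.E.adj_pair_scaleR[OF inv_op_adj[OF w]]
  by (simp add: inv_op_rst[OF w] L2.E.adj_scaleR[OF adj_rst] rst_inv_op[OF w]
      L2.E.adj_scaleR[OF adj_lam] inv_op_lam[OF w])

lemma invariant_op_minus: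
  assumes w: "invariant_op w w'" and v: "invariant_op v v'"
  shows "invariant_op (\<lambda>x. w x - v x) (\<lambda>x. w' x - v' x)"
  using invariant_op_plus[OF w invariant_op_scaleR[OF v, of "- 1"]] by simp

lemma invariant_op_rst: "invariant_op rst rst"
  unfolding invariant_op_def using adj_rst by (simp add: rst_lam lam_rst)

text \<open>An invariant operator acts as a convolution by its value at \<open>\<delta>\<close>;
  passing to the adjoint flips the convolving family.\<close>

lemma adjoint_unit:
  assumes w: "invariant_op w w'" shows "w' \<delta> = conj_inv (w \<delta>)"
proof (rule l2_eqI)
  fix h
  note w' = invariant_op_sym[OF w]
  show "coef (w' \<delta>) h = coef (conj_inv (w \<delta>)) h"
  proof (cases "h \<in> G")
    case True
    have "coef (w' \<delta>) h = l2_inner (w' \<delta>) (lam h \<delta>)" by (simp add: lam_unit[OF True] l2_inner_unit)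
    also have "\<dots> = l2_inner \<delta> (lam h (w \<delta>))"
      by (simp add: adj_pairD[OF inv_op_adj[OF w']] inv_op_lam[OF w True])
    also have "\<dots> = l2_inner (lam (inv h) \<delta>) (w \<delta>)"
      using adj_pairD[OF adj_lam[OF inv_closed[OF True]], of \<delta> "w \<delta>"] by (simp add: inv_inv[OF True])
    also have "\<dots> = star (coef (w \<delta>) (inv h))"
      by (simp add: lam_unit[OF inv_closed[OF True]] l2_inner_unit_left)
    finally show ?thesis using True by simp
  next
    case False
    then show ?thesis using arg_cong[OF rst_inv_op[OF w', of \<delta>], of "\<lambda>f. coef f h"] by simp
  qed
qed

text \<open>The trace of \<open>w\<close> is \<open>l2_inner (w \<delta>) \<delta>\<close>. By
  \<open>adjoint_unit\<close> the trace of a product pairs \<open>v \<delta>\<close> with the flip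
  of \<open>w \<delta>\<close>, and this is symmetric in \<open>v\<close> and
  \<open>w\<close>.\<close>

lemma trace_commute:
  assumes w: "invariant_op w w'" and v: "invariant_op v v'"
  shows "l2_inner (w (v \<delta>)) \<delta> = l2_inner (v (w \<delta>)) \<delta>"
proof -
  have "l2_inner (w (v \<delta>)) \<delta> = l2_inner (v \<delta>) (conj_inv (w \<delta>))"
    unfolding adj_pairD[OF inv_op_adj[OF w]] adjoint_unit[OF w] ..
  also have "\<dots> = l2_inner (w \<delta>) (conj_inv (v \<delta>))" by (rule conj_inv_sym)
  also have "\<dots> = l2_inner (v (w \<delta>)) \<delta>"
    unfolding adj_pairD[OF inv_op_adj[OF v]] adjoint_unit[OF v] ..
  finally show ?thesis .
qed

lemma inv_op_unit:
  "invariant_op w w' \<Longrightarrow> g \<in> G \<Longrightarrow> w (l2_unit g) = lam g (w \<delta>)"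
  by (metis inv_op_lam lam_unit)

lemma coef_outside: "rst f = f \<Longrightarrow> h \<notin> G \<Longrightarrow> coef f h = 0"
  by (metis coef_rst)

text \<open>The entries of \<open>T x\<close> are inner products of \<open>x\<close> with the values
  of \<open>T'\<close> at unit vectors, and those values are determined by the matrix entries of
  \<open>T\<close>.\<close>

lemma adj_matrix_eq:
  assumes T: "adj_pair l2_inner l2_inner T T'" and S: "adj_pair l2_inner l2_inner S S'"
    and rT: "\<And>x. T (rst x) = T x" "\<And>x. rst (T x) = T x" and rS: "\<And>x. S (rst x) = S x" "\<And>x. rst (S x) = S x"
    and m: "\<And>g h. g \<in> G \<Longrightarrow> h \<in> G \<Longrightarrow> l2_inner (T (l2_unit g)) (l2_unit h) = l2_inner (S (l2_unit g)) (l2_unit h)"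
  shows "T x = S x"
proof (rule l2_eqI)
  fix h
  have *: "T' (l2_unit h) = S' (l2_unit h)" if h: "h \<in> G"
  proof (rule l2_eqI)
    fix g
    show "coef (T' (l2_unit h)) g = coef (S' (l2_unit h)) g"
    proof (cases "g \<in> G")
      case True
      have "star (coef (T' (l2_unit h)) g) = star (coef (S' (l2_unit h)) g)"
        using m[OF True h] by (simp add: adj_pairD[OF T] adj_pairD[OF S] l2_inner_unit_left)
      then show ?thesis by (metis star_star)
    next
      case False
      have "rst (l2_unit g) = 0" by (rule l2_eqI) (use False in auto)
      then have "l2_inner (l2_unit g) (T' (l2_unit h)) = 0" "l2_inner (l2_unit g) (S' (l2_unit h)) = 0"
        by (metis adj_pairD[OF T] adj_pairD[OF S] rT(1) rS(1) L2.E.adj_zero[OF T] L2.E.adj_zero[OF S] L2.ip_zero_left)+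
      then show ?thesis by (metis l2_inner_unit_left star_star)
    qed
  qed
  show "coef (T x) h = coef (S x) h"
  proof (cases "h \<in> G")
    case True
    then show ?thesis using *[OF True] adj_pairD[OF T, of x "l2_unit h"] adj_pairD[OF S, of x "l2_unit h"]
      by (simp add: l2_inner_unit)
  next
    case False
    then show ?thesis using coef_outside rT(2) rS(2) by metis
  qed
qed

text \<open>\<open>\<delta>\<close> is separating, since \<open>w\<close> maps every unit vector
  over \<open>G\<close> to a translate of \<open>w \<delta>\<close>. This is what makes the trace
  faithful.\<close>

lemma invariant_op_eq_zero:
  assumes w: "invariant_op w w'" and z: "w \<delta> = 0" shows "w x = 0"
proof -
  have "w x = (\<lambda>_. 0) x"
  proof (rule adj_matrix_eq[OF inv_op_adj[OF w]])
    show "adj_pair l2_inner l2_inner (\<lambda>_. 0) (\<lambda>_::('g, 'a) l2. 0 :: ('g, 'a) l2)"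
      by (auto simp: adj_pair_def intro!: exI[of _ 1])
    show "l2_inner (w (l2_unit g)) (l2_unit h) = l2_inner 0 (l2_unit h)" if "g \<in> G" for g h
      by (simp add: inv_op_unit[OF w that] z L2.E.adj_zero[OF adj_lam[OF that]])
  qed (simp_all add: inv_op_rst[OF w] rst_inv_op[OF w] L2.E.adj_zero[OF adj_rst])
  then show ?thesis by simp
qed

definition twist :: "(('g, 'a) l2 \<Rightarrow> ('g, 'a) l2) \<Rightarrow> ('g, 'a) l2 \<Rightarrow> ('g, 'a::comm_unital_cstar_algebra) l2"
  where "twist w x = conj_inv (w (conj_inv x))"

lemma twist_adj:
  assumes w: "invariant_op w w'"
  shows "adj_pair l2_inner l2_inner (twist w) (twist w')"
proof -
  have "l2_inner (twist w x) y = l2_inner x (twist w' y)" for x y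
  proof -
    have "l2_inner (twist w x) y = star (l2_inner (w (conj_inv x)) (conj_inv y))"
      unfolding twist_def by (metis L2.ip_star conj_inv_sym)
    also have "\<dots> = l2_inner (w' (conj_inv y)) (conj_inv x)"
      by (metis L2.ip_star adj_pairD[OF inv_op_adj[OF w]])
    also have "\<dots> = l2_inner x (twist w' y)" unfolding twist_def by (rule conj_inv_sym)
    finally show ?thesis .
  qed
  moreover obtain B where B: "0 < B" "\<And>x. norm (w x) \<le> B * norm x"
    using adj_pair_bound[OF inv_op_adj[OF w]] by blast
  have "norm (twist w x) \<le> B * norm x" for x
  proof -
    have "norm (twist w x) \<le> norm (w (conj_inv x))" unfolding twist_def by (rule norm_conj_inv)
    also have "\<dots> \<le> B * norm (conj_inv x)" by (rule B)
    also have "\<dots> \<le> B * norm x" using B norm_conj_inv by (intro mult_left_mono) auto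
    finally show ?thesis .
  qed
  ultimately show ?thesis unfolding adj_pair_def by blast
qed

lemma twist_rst [simp]: "twist w (rst x) = twist w x" "rst (twist w x) = twist w x"
  by (simp_all add: twist_def)

lemma twist_comp: "invariant_op w w' \<Longrightarrow> twist w (twist v x) = twist (\<lambda>x. w (v x)) x"
  by (simp add: twist_def inv_op_rst)

text \<open>Both products have the matrix entries of a convolution from the
  left by one function and from the right by another.\<close>

lemma twist_commute:
  assumes v: "invariant_op v v'" and w: "invariant_op w w'"
  shows "v (twist w x) = twist w (v x)"
proof (rule adj_matrix_eq[where T = "\<lambda>x. v (twist w x)" and S = "\<lambda>x. twist w (v x)"])
  show "adj_pair l2_inner l2_inner (\<lambda>x. v (twist w x)) (\<lambda>x. twist w' (v' x))"
    by (rule adj_pair_comp[OF twist_adj[OF w] inv_op_adj[OF v]])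
  show "adj_pair l2_inner l2_inner (\<lambda>x. twist w (v x)) (\<lambda>x. v' (twist w' x))"
    by (rule adj_pair_comp[OF inv_op_adj[OF v] twist_adj[OF w]])
  fix g h assume g: "g \<in> G" and h: "h \<in> G"
  note w' = invariant_op_sym[OF w] and v' = invariant_op_sym[OF v]
  define a b where "a = v \<delta>" and "b = w \<delta>"
  have "l2_inner (v (twist w (l2_unit g))) (l2_unit h) = l2_inner (conj_inv (lam (inv g) b)) (lam h (conj_inv a))"
    unfolding adj_pairD[OF inv_op_adj[OF v]] twist_def conj_inv_unit[OF g] inv_op_unit[OF w inv_closed[OF g]]
      inv_op_unit[OF v' h] adjoint_unit[OF v] a_def b_def ..
  also have "\<dots> = star (l2_inner (lam (inv g) b) (conj_inv (lam h (conj_inv a))))"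
    by (metis L2.ip_star conj_inv_sym)
  also have "\<dots> = star (l2_inner b (lam g (conj_inv (lam h (conj_inv a)))))"
    by (simp add: adj_pairD[OF adj_lam[OF inv_closed[OF g]]] inv_inv[OF g])
  also have "\<dots> = star (l2_inner b (conj_inv (lam h (conj_inv (lam g a)))))"
    by (simp add: conj_inv_twist[OF g h])
  also have "\<dots> = star (l2_inner (lam h (conj_inv (lam g a))) (conj_inv b))"
    by (subst conj_inv_sym) (rule refl)
  also have "\<dots> = star (l2_inner (conj_inv (lam g a)) (lam (inv h) (conj_inv b)))"
    by (simp add: adj_pairD[OF adj_lam[OF h]])
  also have "\<dots> = l2_inner (lam (inv h) (conj_inv b)) (conj_inv (lam g a))"
    by (metis L2.ip_star)
  also have "\<dots> = l2_inner (lam g a) (conj_inv (lam (inv h) (conj_inv b)))" by (rule conj_inv_sym)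
  also have "\<dots> = l2_inner (twist w (v (l2_unit g))) (l2_unit h)"
    unfolding adj_pairD[OF twist_adj[OF w]] unfolding twist_def conj_inv_unit[OF h] inv_op_unit[OF w' inv_closed[OF h]]
      inv_op_unit[OF v g] adjoint_unit[OF w] a_def b_def ..
  finally show "l2_inner (v (twist w (l2_unit g))) (l2_unit h) = l2_inner (twist w (v (l2_unit g))) (l2_unit h)" .
qed (simp_all add: inv_op_rst[OF v] rst_inv_op[OF v])

end

section \<open>Extending an isometry of analysis operators to a unitary\<close>

context index_group
begin

lemma contractions_iff:
  "w \<in> L2.corner_contractions rst G lam \<alpha> \<beta> \<longleftrightarrow>
    (\<exists>w'. invariant_op w w') \<and> (\<forall>x. norm (w x) \<le> norm x) \<and> (\<forall>z. w (\<alpha> z) = \<beta> z)"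
  by (auto simp: L2.corner_contractions_def invariant_op_def)

lemma rst_inner: "rst x = x \<Longrightarrow> l2_inner (rst y) x = l2_inner y x"
  by (metis adj_pairD[OF adj_rst])

lemma l2_zeroI: "(\<And>\<omega>. character \<omega> \<Longrightarrow> Re (\<omega> (l2_inner x x)) \<le> 0) \<Longrightarrow> x = 0"
  using L2.norm_leI[of x 0] by simp

lemma contraction_char:
  assumes u: "invariant_op u u'" "\<And>x. norm (u x) \<le> norm x" and c: "character \<omega>"
  shows "Re (\<omega> (l2_inner (u x) (u x))) \<le> Re (\<omega> (l2_inner (rst x) (rst x)))"
proof -
  have "Re (\<omega> (l2_inner (u (rst x)) (u (rst x)))) \<le> 1\<^sup>2 * Re (\<omega> (l2_inner (rst x) (rst x)))"
    by (rule L2.E.char_bound_of_norm_bound[OF L2.E.adj_act[OF inv_op_adj[OF u(1)]] _ c]) (simp add: u(2))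
  then show ?thesis by (simp add: inv_op_rst[OF u(1)])
qed

lemma contractionI:
  fixes x y :: "('g, 'a::comm_unital_cstar_algebra) l2"
  assumes "\<And>\<omega>. character \<omega> \<Longrightarrow> Re (\<omega> (l2_inner y y)) \<le> Re (\<omega> (l2_inner (rst x) (rst x)))"
  shows "norm y \<le> norm x"
proof -
  have "norm y \<le> norm (rst x)"
  proof (rule L2.norm_leI)
    fix \<omega> :: "'a \<Rightarrow> complex" assume c: "character \<omega>"
    show "Re (\<omega> (l2_inner y y)) \<le> (norm (rst x))\<^sup>2"
      using assms[OF c] L2.char_ip_le[OF c, of "rst x"] by linarith
  qed simp
  then show ?thesis using norm_rst[of x] by linarith
qed

text \<open>If \<open>Q w P = 0\<close> for all invariant contractions \<open>w\<close>, where \<open>P = 1 - u\<^sup>* u\<close> and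
  \<open>Q = 1 - u u\<^sup>*\<close>, then the projections \<open>u\<^sup>*\<^sup>k P u\<^sup>k\<close> all have the trace of \<open>P\<close> and add up to at
  most \<open>1\<close>, so that \<open>P = 0\<close>.\<close>

lemma maximal_partial_isometry_unitary:
  fixes u u' :: "('g, 'a::comm_unital_cstar_algebra) l2 \<Rightarrow> ('g, 'a) l2"
  assumes u: "invariant_op u u'" "\<And>x. norm (u x) \<le> norm x"
    and pi: "\<And>x. u (u' (u x)) = u x"
    and max: "\<And>w w' x. invariant_op w w' \<Longrightarrow> (\<And>x. norm (w x) \<le> norm x) \<Longrightarrow>
      rst (w (rst x - u' (u x))) = u (u' (w (rst x - u' (u x))))"
  shows "u' (u x) = rst x" and "u (u' x) = rst x"
proof -
  note u' = invariant_op_sym[OF u(1)]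
  have nu': "norm (u' x) \<le> norm x" for x
    using L2.E.adj_norm_le[OF inv_op_adj[OF u(1)], of 1 x] u(2) by simp
  define P where "P x = rst x - u' (u x)" for x
  have P: "invariant_op P P" unfolding P_def
    by (rule invariant_op_minus[OF invariant_op_rst invariant_op_comp[OF u' u(1)]])
  have PP: "P (P x) = P x" for x
    by (simp add: P_def L2.E.adj_diff[OF inv_op_adj[OF u(1)]] L2.E.adj_diff[OF inv_op_adj[OF u']]
        L2.E.adj_diff[OF adj_rst] inv_op_rst[OF u(1)] pi L2.E.adj_zero[OF inv_op_adj[OF u']] rst_inv_op[OF u'])
  have pw: "invariant_op (\<lambda>x. (u' ^^ k) (rst x)) (\<lambda>x. (u ^^ k) (rst x))
      \<and> (\<forall>x. norm ((u' ^^ k) (rst x)) \<le> norm x)" for k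
  proof (induction k)
    case 0
    then show ?case by (simp add: invariant_op_rst norm_rst)
  next
    case (Suc k)
    have "invariant_op (\<lambda>x. u' ((u' ^^ k) (rst x))) (\<lambda>x. (u ^^ k) (rst (u x)))"
      by (rule invariant_op_comp[OF u']) (use Suc in blast)
    then have "invariant_op (\<lambda>x. (u' ^^ Suc k) (rst x)) (\<lambda>x. (u ^^ Suc k) (rst x))"
      by (simp add: rst_inv_op[OF u(1)] inv_op_rst[OF u(1)] funpow_Suc_right del: funpow.simps flip: funpow.simps(2))
        (simp add: funpow_swap1)
    moreover have "norm ((u' ^^ Suc k) (rst x)) \<le> norm x" for x
      using nu'[of "(u' ^^ k) (rst x)"] Suc by (auto intro: order_trans)
    ultimately show ?case by blast
  qed
  \<comment> \<open>Applied to the \<open>k\<close>-th power of \<open>u'\<close>,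
    \<open>max\<close> says that \<open>u u'\<close> fixes what this power makes of the range of
    \<open>P\<close>; so \<open>u\<close> undoes every application of \<open>u'\<close>
    there.\<close>
  have cancel: "(u ^^ k) ((u' ^^ k) (P x)) = P x" for k x
  proof (induction k)
    case (Suc k)
    have r: "rst (P x) = P x" by (rule rst_inv_op[OF P])
    have "rst ((u' ^^ k) (P x)) = u (u' ((u' ^^ k) (P x)))"
      using max[OF conjunct1[OF pw[of k]], of x] pw[of k] by (simp add: r flip: P_def)
    moreover have "rst ((u' ^^ k) (P x)) = (u' ^^ k) (P x)"
      using rst_inv_op[OF conjunct1[OF pw[of k]], of "P x"] by (simp add: r)
    ultimately have "u (u' ((u' ^^ k) (P x))) = (u' ^^ k) (P x)" by simp
    then show ?case using Suc by (simp add: funpow_swap1)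
  qed simp
  have rd: "rst \<delta> = \<delta>" by (rule rst_unit[OF e_closed])
  have tr: "l2_inner (P ((u ^^ k) \<delta>)) ((u ^^ k) \<delta>) = l2_inner (P \<delta>) \<delta>" for k
  proof -
    note w = conjunct1[OF pw[of k]]
    note w' = invariant_op_sym[OF w]
    have "l2_inner (P ((u ^^ k) \<delta>)) ((u ^^ k) \<delta>) = l2_inner ((u' ^^ k) (rst (P ((u ^^ k) (rst \<delta>))))) \<delta>"
      using adj_pairD[OF inv_op_adj[OF w], of "P ((u ^^ k) \<delta>)" \<delta>] by (simp add: rd)
    also have "\<dots> = l2_inner (P ((u ^^ k) (rst ((u' ^^ k) (rst \<delta>))))) \<delta>"
      by (rule trace_commute[OF w invariant_op_comp[OF P w']])
    also have "\<dots> = l2_inner \<delta> ((u ^^ k) (rst ((u' ^^ k) (rst (P \<delta>)))))"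
      using adj_pairD[OF inv_op_adj[OF invariant_op_comp[OF P invariant_op_comp[OF w' w]]], of \<delta> \<delta>] by simp
    also have "\<dots> = l2_inner \<delta> (P \<delta>)"
      using rst_inv_op[OF w, of "P \<delta>"] by (simp add: rst_inv_op[OF P] cancel)
    also have "\<dots> = l2_inner (P \<delta>) \<delta>" by (simp add: adj_pairD[OF inv_op_adj[OF P]])
    finally show ?thesis .
  qed
  have un: "rst ((u ^^ k) \<delta>) = (u ^^ k) \<delta>" for k
    using rst_inv_op[OF invariant_op_sym[OF conjunct1[OF pw[of k]]], of \<delta>] by (simp add: rd)
  \<comment> \<open>Each application of \<open>u\<close> lowers the inner square by the same amount,
    the trace of \<open>P\<close>. As inner squares stay nonnegative for all \<open>k\<close>, that
    trace cannot be positive.\<close>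
  have sum: "l2_inner ((u ^^ k) \<delta>) ((u ^^ k) \<delta>) = l2_inner \<delta> \<delta> - real k *\<^sub>R l2_inner (P \<delta>) \<delta>" for k
  proof (induction k)
    case (Suc k)
    have "l2_inner (u ((u ^^ k) \<delta>)) (u ((u ^^ k) \<delta>)) = l2_inner (u' (u ((u ^^ k) \<delta>))) ((u ^^ k) \<delta>)"
      by (simp add: adj_pairD[OF inv_op_adj[OF u']])
    also have "\<dots> = l2_inner ((u ^^ k) \<delta>) ((u ^^ k) \<delta>) - l2_inner (P ((u ^^ k) \<delta>)) ((u ^^ k) \<delta>)"
      by (simp add: P_def L2.ip_simps un)
    finally show ?case by (simp add: Suc tr algebra_simps)
  qed simp
  have "P \<delta> = 0"
  proof (rule l2_zeroI)
    fix \<omega> :: "'a \<Rightarrow> complex" assume c: "character \<omega>"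
    define p where "p = Re (\<omega> (l2_inner (P \<delta>) \<delta>))"
    have pp: "l2_inner (P \<delta>) (P \<delta>) = l2_inner (P \<delta>) \<delta>"
      using adj_pairD[OF inv_op_adj[OF P], of "P \<delta>" \<delta>] by (simp add: PP)
    have b: "real k * p \<le> Re (\<omega> (l2_inner \<delta> \<delta>))" for k
      using L2.char_ip_nonneg[OF c, of "(u ^^ k) \<delta>"] c unfolding sum p_def by (simp add: char_simps)
    have "p \<le> 0"
    proof (rule ccontr)
      assume "\<not> p \<le> 0"
      then obtain k where "Re (\<omega> (l2_inner \<delta> \<delta>)) < real k * p" using reals_Archimedean3[of p] by auto
      then show False using b[of k] by simp
    qed
    then show "Re (\<omega> (l2_inner (P \<delta>) (P \<delta>))) \<le> 0" by (simp add: pp p_def)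
  qed
  then have P0: "P x = 0" for x by (rule invariant_op_eq_zero[OF P])
  then show 1: "u' (u x) = rst x" for x by (simp add: P_def)
  define Q where "Q x = rst x - u (u' x)" for x
  have Q: "invariant_op Q Q" unfolding Q_def
    by (rule invariant_op_minus[OF invariant_op_rst invariant_op_comp[OF u(1) u']])
  \<comment> \<open>\<open>u u'\<close> and \<open>u' u = rst\<close> have the same trace, so
    \<open>Q\<close> has trace \<open>0\<close>.\<close>
  have "l2_inner (u (u' \<delta>)) \<delta> = l2_inner (rst \<delta>) \<delta>"
    using trace_commute[OF u(1) u'] by (simp add: 1)
  then have "l2_inner (Q \<delta>) \<delta> = 0" by (simp add: Q_def L2.ip_simps)
  moreover have "Q (Q \<delta>) = Q \<delta>"
    by (simp add: Q_def L2.E.adj_diff[OF inv_op_adj[OF u(1)]] L2.E.adj_diff[OF inv_op_adj[OF u']]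
        L2.E.adj_diff[OF adj_rst] inv_op_rst[OF u'] 1 rst_inv_op[OF u'] rst_inv_op[OF u(1)]
        L2.E.adj_zero[OF inv_op_adj[OF u(1)]])
  ultimately have "l2_inner (Q \<delta>) (Q \<delta>) = 0" using adj_pairD[OF inv_op_adj[OF Q], of "Q \<delta>" \<delta>] by simp
  then have "Q \<delta> = 0" using L2.ip_eq_0_iff by blast
  then have "Q x = 0" by (rule invariant_op_eq_zero[OF Q])
  then show "u (u' x) = rst x" by (simp add: Q_def)
qed

text \<open>Two perturbations exploit extremality. With \<open>P\<close> and \<open>Q\<close> the
  defects of \<open>u' u\<close> and \<open>u u'\<close> from \<open>rst\<close>, the operators
  \<open>u \<plusminus> u P / 2\<close> show \<open>u P = 0\<close>, so \<open>u\<close> is a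
  partial isometry; then \<open>u \<plusminus> Q w P\<close> show \<open>Q w P = 0\<close> for every
  invariant contraction \<open>w\<close>. Neither changes the values on \<open>\<alpha>\<close>,
  because \<open>P\<close> kills \<open>\<alpha>\<close>.\<close>

lemma extreme_contraction_unitary:
  fixes u :: "('g, 'a::comm_unital_cstar_algebra) l2 \<Rightarrow> ('g, 'a) l2"
  assumes \<alpha>: "\<And>z. rst (\<alpha> z) = \<alpha> z" and iso: "\<And>z. l2_inner (\<beta> z) (\<beta> z) = l2_inner (\<alpha> z) (\<alpha> z)"
    and C: "C = L2.corner_contractions rst G lam \<alpha> \<beta>" and uC: "u \<in> C"
    and ext: "\<And>a b. a \<in> C \<Longrightarrow> b \<in> C \<Longrightarrow> (\<forall>x. u x + u x = a x + b x) \<Longrightarrow> a = u"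
  shows "\<exists>u'. invariant_op u u' \<and> (\<forall>x. u' (u x) = rst x) \<and> (\<forall>x. u (u' x) = rst x)"
proof -
  obtain u' where u: "invariant_op u u'" using uC by (auto simp: C contractions_iff)
  have nu: "norm (u x) \<le> norm x" and u\<alpha>: "u (\<alpha> z) = \<beta> z" for x z
    using uC by (auto simp: C contractions_iff)
  note u' = invariant_op_sym[OF u]
  have nu': "norm (u' x) \<le> norm x" for x
    using L2.E.adj_norm_le[OF inv_op_adj[OF u], of 1 x] nu by simp
  note adj = adj_pairD[OF inv_op_adj[OF u]] and adj' = adj_pairD[OF inv_op_adj[OF u']]
  define P where "P x = rst x - u' (u x)" for x
  have P: "invariant_op P P" unfolding P_def
    by (rule invariant_op_minus[OF invariant_op_rst invariant_op_comp[OF u' u]])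
  have rP: "rst (P x) = P x" and Pr: "P (rst x) = P x" for x
    by (rule rst_inv_op[OF P], rule inv_op_rst[OF P])
  have Padj: "l2_inner (P x) y = l2_inner x (P y)" for x y by (rule adj_pairD[OF inv_op_adj[OF P]])
  have usq: "l2_inner (u y) (u y) = l2_inner y y - l2_inner y (P y)" if "rst y = y" for y
    using that by (simp add: P_def adj L2.ip_simps)
  \<comment> \<open>\<open>u\<close> preserves the inner square of \<open>\<alpha> z\<close>.
    Expanding the inner square of \<open>P (\<alpha> z)\<close> and using that \<open>u'\<close> is
    a contraction leaves something nonpositive.\<close>
  have P\<alpha>: "P (\<alpha> z) = 0" for z
  proof (rule l2_zeroI)
    fix \<omega> :: "'a \<Rightarrow> complex" assume c: "character \<omega>"
    have "Re (\<omega> (l2_inner (u' (u (\<alpha> z))) (u' (u (\<alpha> z))))) \<le> Re (\<omega> (l2_inner (u (\<alpha> z)) (u (\<alpha> z))))"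
      using contraction_char[OF u' nu' c, of "u (\<alpha> z)"] by (simp add: rst_inv_op[OF u])
    moreover have "l2_inner (u' (u (\<alpha> z))) (\<alpha> z) = l2_inner (u (\<alpha> z)) (u (\<alpha> z))"
      "l2_inner (\<alpha> z) (u' (u (\<alpha> z))) = l2_inner (u (\<alpha> z)) (u (\<alpha> z))"
      by (rule adj', rule adj[symmetric])
    then have "l2_inner (P (\<alpha> z)) (P (\<alpha> z)) = l2_inner (\<alpha> z) (\<alpha> z) - l2_inner (u (\<alpha> z)) (u (\<alpha> z))
        - l2_inner (u (\<alpha> z)) (u (\<alpha> z)) + l2_inner (u' (u (\<alpha> z))) (u' (u (\<alpha> z)))"
      by (simp add: P_def \<alpha> L2.ip_simps)
    ultimately show "Re (\<omega> (l2_inner (P (\<alpha> z)) (P (\<alpha> z)))) \<le> 0"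
      using c by (simp add: u\<alpha> iso char_simps)
  qed
  have uP0: "u (P x) = 0" for x
  proof -
    \<comment> \<open>Under every character the square of \<open>u (X + t P X)\<close> differs from
      that of \<open>X\<close> by \<open>(2 t - 1) p1 + (t t - 2 t) p2 - t t p3\<close>, where the
      moments of \<open>P\<close> satisfy \<open>0 \<le> p2 \<le> p1\<close> and
      \<open>0 \<le> p3\<close>. Both values of \<open>t\<close> make this nonpositive.\<close>
    have mem: "(\<lambda>x. u x + t *\<^sub>R u (P x)) \<in> C" if t: "t = 1/2 \<or> t = - 1/2" for t :: real
    proof -
      have "invariant_op (\<lambda>x. u x + t *\<^sub>R u (P x)) (\<lambda>x. u' x + t *\<^sub>R P (u' x))"
        by (rule invariant_op_plus[OF u invariant_op_scaleR[OF invariant_op_comp[OF u P]]])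
      moreover have "norm (u x + t *\<^sub>R u (P x)) \<le> norm x" for x
      proof (rule contractionI)
        fix \<omega> :: "'a \<Rightarrow> complex" assume c: "character \<omega>"
        define X where "X = rst x"
        define p1 p2 p3 where "p1 = l2_inner X (P x)" and "p2 = l2_inner (P x) (P x)" and "p3 = l2_inner (P x) (P (P x))"
        define y where "y = X + t *\<^sub>R P x"
        have X: "rst X = X" "P X = P x" "u X = u x" by (simp_all add: X_def Pr inv_op_rst[OF u])
        have ry: "rst y = y" by (simp add: y_def L2.E.adj_add[OF adj_rst] L2.E.adj_scaleR[OF adj_rst] X rP)
        have uy: "u y = u x + t *\<^sub>R u (P x)"
          by (simp add: y_def L2.E.adj_add[OF inv_op_adj[OF u]] L2.E.adj_scaleR[OF inv_op_adj[OF u]] X)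
        have Py: "P y = P x + t *\<^sub>R P (P x)"
          by (simp add: y_def L2.E.adj_add[OF inv_op_adj[OF P]] L2.E.adj_scaleR[OF inv_op_adj[OF P]] X)
        have s: "l2_inner (P x) X = p1" "l2_inner X (P (P x)) = p2"
          unfolding p1_def p2_def using Padj[of x X] Padj[of X "P x"] Padj[of x "X"] X(2) Pr
          by (metis Padj X_def)+
        have "l2_inner (u y) (u y) = l2_inner X X + t *\<^sub>R p1 + t *\<^sub>R p1 + (t * t) *\<^sub>R p2
            - (p1 + t *\<^sub>R p2 + t *\<^sub>R p2 + (t * t) *\<^sub>R p3)" (is "_ = ?r")
          unfolding usq[OF ry] Py by (simp add: y_def L2.ip_simps s p1_def[symmetric] p2_def[symmetric]
              p3_def[symmetric] scaleR_add_right)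
        then have "Re (\<omega> (l2_inner (u y) (u y))) = Re (\<omega> ?r)" by (rule arg_cong)
        also have "Re (\<omega> ?r) = Re (\<omega> (l2_inner X X)) + (2 * t - 1) * Re (\<omega> p1)
            + (t * t - 2 * t) * Re (\<omega> p2) - (t * t) * Re (\<omega> p3)"
          using c by (simp add: char_simps algebra_simps)
        finally have eq: "Re (\<omega> (l2_inner (u y) (u y))) = Re (\<omega> (l2_inner X X)) + (2 * t - 1) * Re (\<omega> p1)
            + (t * t - 2 * t) * Re (\<omega> p2) - (t * t) * Re (\<omega> p3)" .
        have n2: "0 \<le> Re (\<omega> p2)" unfolding p2_def by (rule L2.char_ip_nonneg[OF c])
        have n3: "0 \<le> Re (\<omega> p3)"
        proof -
          have "p3 = l2_inner (P x) (P x) - l2_inner (u (P x)) (u (P x))" using usq[OF rP, of x] by (simp add: p3_def)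
          moreover have "Re (\<omega> (l2_inner (u (P x)) (u (P x)))) \<le> Re (\<omega> (l2_inner (P x) (P x)))"
            using contraction_char[OF u nu c, of "P x"] by (simp add: rP)
          ultimately show ?thesis using c by (simp add: char_simps)
        qed
        have n12: "Re (\<omega> p2) \<le> Re (\<omega> p1)"
        proof -
          have "p1 - p2 = l2_inner (u' (u x)) (P x)" by (simp add: p1_def p2_def X_def P_def L2.ip_simps)
          also have "\<dots> = l2_inner (u x) (u x) - l2_inner (u' (u x)) (u' (u x))"
            by (simp add: adj' P_def L2.E.adj_diff[OF inv_op_adj[OF u]] L2.ip_simps inv_op_rst[OF u])
          finally have "\<omega> p1 - \<omega> p2 = \<omega> (l2_inner (u x) (u x)) - \<omega> (l2_inner (u' (u x)) (u' (u x)))"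
            using c by (metis char_diff)
          moreover have "Re (\<omega> (l2_inner (u' (u x)) (u' (u x)))) \<le> Re (\<omega> (l2_inner (u x) (u x)))"
            using contraction_char[OF u' nu' c, of "u x"] by (simp add: rst_inv_op[OF u])
          ultimately show ?thesis by (simp add: complex_eq_iff)
        qed
        have "Re (\<omega> (l2_inner (u y) (u y))) \<le> Re (\<omega> (l2_inner X X))"
          using t n2 n3 n12 unfolding eq by (elim disjE; hypsubst; simp)
        then show "Re (\<omega> (l2_inner (u x + t *\<^sub>R u (P x)) (u x + t *\<^sub>R u (P x)))) \<le> Re (\<omega> (l2_inner (rst x) (rst x)))"
          by (simp add: uy X_def)
      qed
      moreover have "u (\<alpha> z) + t *\<^sub>R u (P (\<alpha> z)) = \<beta> z" for z by (simp add: P\<alpha> u\<alpha> L2.E.adj_zero[OF inv_op_adj[OF u]])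
      ultimately show ?thesis unfolding C contractions_iff by blast
    qed
    have "(\<lambda>x. u x + (1/2) *\<^sub>R u (P x)) = u"
      by (rule ext[OF mem mem[of "- 1/2"]]) simp_all
    from fun_cong[OF this, of x] show ?thesis by simp
  qed
  have pi: "u (u' (u x)) = u x" for x
    using uP0[of x] by (simp add: P_def L2.E.adj_diff[OF inv_op_adj[OF u]] inv_op_rst[OF u])
  define Q where "Q x = rst x - u (u' x)" for x
  have Q: "invariant_op Q Q" unfolding Q_def
    by (rule invariant_op_minus[OF invariant_op_rst invariant_op_comp[OF u u']])
  have Qu: "l2_inner (Q x) (u y) = 0" for x y
  proof -
    have "Q (u y) = 0" by (simp add: Q_def pi rst_inv_op[OF u])
    then show ?thesis by (simp add: adj_pairD[OF inv_op_adj[OF Q]])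
  qed
  have Qsq: "Re (\<omega> (l2_inner (Q x) (Q x))) \<le> Re (\<omega> (l2_inner (rst x) (rst x)))" if c: "character \<omega>" for x \<omega>
  proof -
    have "rst x = Q x + u (u' x)" by (simp add: Q_def)
    then have "l2_inner (rst x) (rst x) = l2_inner (Q x) (Q x) + l2_inner (u (u' x)) (Q x) + l2_inner (u (u' x)) (u (u' x))"
      by (simp add: L2.ip_simps Qu)
    moreover have "l2_inner (u (u' x)) (Q x) = 0" using Qu[of x "u' x"] L2.ip_star[of "u (u' x)" "Q x"] by simp
    ultimately show ?thesis using L2.char_ip_nonneg[OF c, of "u (u' x)"] c by (simp add: char_simps)
  qed
  have max: "rst (w (P x)) = u (u' (w (P x)))" if w: "invariant_op w w'" "\<And>x. norm (w x) \<le> norm x" for w w' x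
  proof -
    \<comment> \<open>\<open>Q\<close> maps into the complement of the range of \<open>u\<close>,
      and \<open>P x\<close> accounts for exactly the part of \<open>x\<close> that \<open>u\<close>
      loses; so adding \<open>Q w P\<close> with either sign keeps a contraction.\<close>
    have mem: "(\<lambda>x. u x + t *\<^sub>R Q (w (P x))) \<in> C" if t: "t = 1 \<or> t = - 1" for t :: real
    proof -
      have "invariant_op (\<lambda>x. u x + t *\<^sub>R Q (w (P x))) (\<lambda>x. u' x + t *\<^sub>R P (w' (Q x)))"
        by (rule invariant_op_plus[OF u invariant_op_scaleR[OF invariant_op_comp[OF Q invariant_op_comp[OF w(1) P]]]])
      moreover have "norm (u x + t *\<^sub>R Q (w (P x))) \<le> norm x" for x
      proof (rule contractionI)
        fix \<omega> :: "'a \<Rightarrow> complex" assume c: "character \<omega>"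
        define Y where "Y = Q (w (P x))"
        have uY: "l2_inner (u x) Y = 0" "l2_inner Y (u x) = 0"
          using Qu[of "w (P x)" x] L2.ip_star[of "u x" Y] by (simp_all add: Y_def)
        have tt: "t * t = 1" using t by auto
        have "l2_inner (u x + t *\<^sub>R Y) (u x + t *\<^sub>R Y) = l2_inner (u x) (u x) + l2_inner Y Y"
          by (simp add: L2.ip_simps uY tt)
        moreover have "Re (\<omega> (l2_inner Y Y)) \<le> Re (\<omega> (l2_inner (P x) (P x)))"
          using Qsq[OF c, of "w (P x)"] contraction_char[OF w c, of "P x"] by (simp add: Y_def rst_inv_op[OF w(1)] rP)
        moreover have "l2_inner (P x) (P x) = l2_inner (rst x) (rst x) - l2_inner (u x) (u x)"
        proof -
          have "P (P x) = P x"
            by (simp add: P_def[of "P x"] uP0 rP L2.E.adj_zero[OF inv_op_adj[OF u']])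
          then have "l2_inner (P x) (P x) = l2_inner (rst x) (P (rst x))" by (simp add: Padj Pr rst_inner rP)
          then show ?thesis using usq[of "rst x"] by (simp add: inv_op_rst[OF u])
        qed
        ultimately show "Re (\<omega> (l2_inner (u x + t *\<^sub>R Q (w (P x))) (u x + t *\<^sub>R Q (w (P x))))) \<le> Re (\<omega> (l2_inner (rst x) (rst x)))"
          using c by (simp add: char_simps flip: Y_def)
      qed
      moreover have "u (\<alpha> z) + t *\<^sub>R Q (w (P (\<alpha> z))) = \<beta> z" for z
        by (simp add: P\<alpha> u\<alpha> L2.E.adj_zero[OF inv_op_adj[OF Q]] L2.E.adj_zero[OF inv_op_adj[OF w(1)]])
      ultimately show ?thesis unfolding C contractions_iff by blast
    qed
    have "(\<lambda>x. u x + 1 *\<^sub>R Q (w (P x))) = u"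
      by (rule ext[OF mem mem[of "- 1"]]) simp_all
    from fun_cong[OF this, of x] show ?thesis by (simp add: Q_def)
  qed
  have "u' (u x) = rst x" "u (u' x) = rst x" for x
    by (rule maximal_partial_isometry_unitary[where u = u and u' = u'], rule u, rule nu, rule pi,
        rule max[unfolded P_def], assumption, blast)+
  with u show ?thesis by blast
qed

text \<open>\<open>w\<close> shows that the set of admissible contractions is nonempty; the unitary
  is an extreme point of that set.\<close>

theorem unitary_extension:
  fixes \<Phi> :: "'a::comm_unital_cstar_algebra \<Rightarrow> ('x::complex_banach \<Rightarrow>\<^sub>L complex)"
    and \<alpha> \<beta> :: "'z \<Rightarrow> ('g, 'a) l2"
  assumes \<Phi>: "dual_iso \<Phi>"
    and sd: "\<And>f :: ('g, 'a) l2 \<Rightarrow> 'a. (\<And>x y. f (x + y) = f x + f y) \<Longrightarrow> (\<And>a x. f (l2_act a x) = a * f x) \<Longrightarrow>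
       (\<And>x. f (rst x) = f x) \<Longrightarrow> (\<exists>B. \<forall>x. norm (f x) \<le> B * norm x) \<Longrightarrow> \<exists>y. \<forall>x. f x = l2_inner x y"
    and \<alpha>: "\<And>z. rst (\<alpha> z) = \<alpha> z" and iso: "\<And>z. l2_inner (\<beta> z) (\<beta> z) = l2_inner (\<alpha> z) (\<alpha> z)"
    and w: "invariant_op w w'" "\<And>x. norm (w x) \<le> norm x" "\<And>z. w (\<alpha> z) = \<beta> z"
  shows "\<exists>u u'. invariant_op u u' \<and> (\<forall>x. u' (u x) = rst x) \<and> (\<forall>x. u (u' x) = rst x) \<and> (\<forall>z. u (\<alpha> z) = \<beta> z)"
proof -
  define C where "C = L2.corner_contractions rst G lam \<alpha> \<beta>"
  have "w \<in> C" unfolding C_def contractions_iff using w by blast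
  then have "C \<noteq> {}" by blast
  then obtain u where u: "u \<in> C" "\<forall>a\<in>C. \<forall>b\<in>C. (\<forall>x. u x + u x = a x + b x) \<longrightarrow> a = u"
    using L2.ex_extreme_contraction[OF \<Phi> adj_rst rst_rst sd, of G lam \<alpha> \<beta>] adj_lam unfolding C_def by blast
  then have "\<exists>u'. invariant_op u u' \<and> (\<forall>x. u' (u x) = rst x) \<and> (\<forall>x. u (u' x) = rst x)"
    by (intro extreme_contraction_unitary[OF \<alpha> iso C_def]) blast+
  moreover have "\<forall>z. u (\<alpha> z) = \<beta> z" using u(1) by (simp add: C_def contractions_iff)
  ultimately show ?thesis by blast
qed

end

section \<open>Analysis operators of the orbits of a unitary group\<close>

locale unitary_module = comm_hilbert_module act ip
  for act :: "'a::comm_unital_cstar_algebra \<Rightarrow> 'h::complex_banach \<Rightarrow> 'h" and ip :: "'h \<Rightarrow> 'h \<Rightarrow> 'a" +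
  fixes G :: "('h \<Rightarrow> 'h) set"
  assumes unitary_group: "unitary_group act ip G"
begin

lemma group_inverse: "U \<in> G \<Longrightarrow> inv U \<in> G \<and> U \<circ> inv U = id \<and> inv U \<circ> U = id"
  using unitary_group unfolding unitary_group_def by (metis inv_unique_comp)

end

sublocale unitary_module \<subseteq> index_group G "(\<circ>)" id inv
proof
  show "g \<circ> h \<in> G" if "g \<in> G" "h \<in> G" for g h
    using unitary_group that unfolding unitary_group_def by blast
  show "id \<in> G" using unitary_group unfolding unitary_group_def by blast
qed (use group_inverse in \<open>simp_all add: comp_assoc\<close>)

sublocale unitary_module \<subseteq> HL: hilbert_module_pair act ip
    "l2_act :: 'a \<Rightarrow> ('h \<Rightarrow> 'h, 'a) l2 \<Rightarrow> ('h \<Rightarrow> 'h, 'a) l2" l2_inner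
  by unfold_locales

sublocale unitary_module \<subseteq> LH: hilbert_module_pair
    "l2_act :: 'a \<Rightarrow> ('h \<Rightarrow> 'h, 'a) l2 \<Rightarrow> ('h \<Rightarrow> 'h, 'a) l2" l2_inner act ip
  by unfold_locales

section \<open>Analysis and synthesis operators of Bessel vectors\<close>

context unitary_module
begin

lemma inv_apply: "U \<in> G \<Longrightarrow> U (inv U x) = x" "U \<in> G \<Longrightarrow> inv U (U x) = x"
  using group_inverse by (metis comp_apply id_apply)+

lemma adj_group: "U \<in> G \<Longrightarrow> adj_pair ip ip U (inv U)"
proof -
  assume U: "U \<in> G"
  then obtain V where V: "adj_pair ip ip U V" "\<forall>x. U (V x) = x"
    using unitary_group unfolding unitary_group_def unitary_op_iff by blast
  have "V = inv U" using V(2) inv_apply(2)[OF U] by (metis ext)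
  with V show ?thesis by simp
qed

lemma ip_group_right: "U \<in> G \<Longrightarrow> ip x (U y) = ip (inv U x) y"
  using adj_pairD[OF adj_group[OF inv_closed]] by (simp add: inv_inv)

text \<open>\<open>mk_l2\<close> of a family that is not square summable is unspecified, so the
  entries are known only under the hypothesis of \<open>coef_\<theta>\<close>.\<close>

definition \<theta> :: "'h \<Rightarrow> 'h \<Rightarrow> ('h \<Rightarrow> 'h, 'a) l2"
  where "\<theta> \<xi> x = mk_l2 (\<lambda>U. if U \<in> G then ip x (U \<xi>) else 0)"

definition syn :: "'h \<Rightarrow> ('h \<Rightarrow> 'h, 'a) l2 \<Rightarrow> 'h"
  where "syn \<xi> c = (\<Sum>\<^sub>\<infinity>U\<in>G. act (coef c U) (U \<xi>))"

text \<open>A norm bound stands in for the order bound of \<open>bessel_with_bound\<close>;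
  \<open>char_bound_of_norm_bound\<close> recovers the latter.\<close>

definition bessel :: "'h \<Rightarrow> bool"
  where "bessel \<xi> \<longleftrightarrow> (\<forall>x. square_summable (\<lambda>U. ip x (U \<xi>)) G) \<and> (\<exists>K. \<forall>x. norm (\<theta> \<xi> x) \<le> K * norm x)"

lemma coef_\<theta>:
  "square_summable (\<lambda>U. ip x (U \<xi>)) G \<Longrightarrow> coef (\<theta> \<xi> x) = (\<lambda>U. if U \<in> G then ip x (U \<xi>) else 0)"
  unfolding \<theta>_def by (intro coef_mk_l2) (simp add: square_summable_extend)

lemma square_summable_coefI:
  "(\<And>U. coef f U = (if U \<in> A then g U else 0)) \<Longrightarrow> square_summable g A"
proof -
  assume "\<And>U. coef f U = (if U \<in> A then g U else 0)"
  then have "coef f = (\<lambda>U. if U \<in> A then g U else 0)" by (rule ext)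
  then show ?thesis using square_summable_coef[of f] by (simp add: square_summable_extend)
qed

lemma bessel_coef: "bessel \<xi> \<Longrightarrow> coef (\<theta> \<xi> x) = (\<lambda>U. if U \<in> G then ip x (U \<xi>) else 0)"
  by (simp add: bessel_def coef_\<theta>)

lemma \<theta>_diff:
  assumes "square_summable (\<lambda>U. ip x (U \<xi>)) G" "square_summable (\<lambda>U. ip y (U \<xi>)) G"
  shows "\<theta> \<xi> (x - y) = \<theta> \<xi> x - \<theta> \<xi> y"
  using square_summable_diff[OF assms] by (intro l2_eqI) (simp add: coef_\<theta> assms ip_simps)

text \<open>Convergence by duality: for a finite partial sum \<open>z\<close>, \<open>ip z z\<close>
  pairs the coefficients with \<open>\<theta> \<xi> z\<close>. So the norm of \<open>z\<close> is at
  most \<open>K\<close> times the norm of the coefficients on that finite set, and tails are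
  small.\<close>

lemma synthesis:
  assumes \<xi>: "bessel \<xi>"
  shows "((\<lambda>U. act (coef c U) (U \<xi>)) has_sum syn \<xi> c) G" and "adj_pair ip l2_inner (\<theta> \<xi>) (syn \<xi>)"
proof -
  obtain K0 where K0: "\<And>x. norm (\<theta> \<xi> x) \<le> K0 * norm x" using \<xi> by (auto simp: bessel_def)
  define K where "K = \<bar>K0\<bar> + 1"
  have K: "0 < K" "norm (\<theta> \<xi> x) \<le> K * norm x" for x
    using order_trans[OF K0[of x] mult_right_mono[of K0 K "norm x"]] by (auto simp: K_def)
  have fin: "norm (\<Sum>U\<in>F. act (coef c U) (U \<xi>)) \<le> e * K"
    if F: "finite F" "F \<subseteq> G" and e: "0 \<le> e" "\<And>\<omega>. character \<omega> \<Longrightarrow> char_l2 \<omega> (coef c) F \<le> e" for F c e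
  proof -
    define z where "z = (\<Sum>U\<in>F. act (coef c U) (U \<xi>))"
    have "norm (ip z z) \<le> e * K * norm z"
    proof (rule norm_le_char)
      fix \<omega> :: "'a \<Rightarrow> complex" assume w: "character \<omega>"
      have "ip z z = (\<Sum>U\<in>F. coef c U * ip (U \<xi>) z)" by (subst (1) z_def) (simp add: ip_sum_left ip_simps)
      also have "\<dots> = (\<Sum>U\<in>F. coef c U * star (coef (\<theta> \<xi> z) U))"
        using F(2) by (intro sum.cong) (auto simp: bessel_coef[OF \<xi>] simp flip: ip_star)
      finally have "cmod (\<omega> (ip z z)) \<le> char_l2 \<omega> (coef c) F * char_l2 \<omega> (coef (\<theta> \<xi> z)) F"
        using char_l2_Cauchy_Schwarz[OF w] by simp
      also have "\<dots> \<le> e * (K * norm z)"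
        using e w order_trans[OF char_l2_le_norm[OF F(1) w] K(2)] by (intro mult_mono) auto
      finally show "cmod (\<omega> (ip z z)) \<le> e * K * norm z" by simp
    qed (use e K in simp)
    then have *: "norm z * norm z \<le> e * K * norm z" by (simp flip: norm_square power2_eq_square)
    show ?thesis
    proof (cases "norm z = 0")
      case False
      from * have "norm z \<le> e * K" by (rule mult_right_le_imp_le) (use False in simp)
      then show ?thesis by (simp add: z_def)
    qed (use e K in \<open>simp add: z_def\<close>)
  qed
  have hs: "((\<lambda>U. act (coef c U) (U \<xi>)) has_sum syn \<xi> c) G" for c
  proof -
    have "(\<lambda>U. act (coef c U) (U \<xi>)) summable_on G" unfolding summable_on_Cauchy_criterion
    proof (intro allI impI)
      fix e :: real assume e: "0 < e"
      have ss: "square_summable (coef c) G" by (rule square_summable_subset[OF square_summable_coef]) simp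
      have eK: "0 < e / K" using e K by simp
      obtain F0 where F0: "finite F0" "F0 \<subseteq> G"
        "\<forall>F. finite F \<and> F \<subseteq> G \<and> F \<inter> F0 = {} \<longrightarrow> (\<forall>\<omega>. character \<omega> \<longrightarrow> char_l2 \<omega> (coef c) F \<le> e / K)"
        using square_summable_tail[OF ss eK] by (elim exE conjE)
      have "norm (\<Sum>U\<in>F. act (coef c U) (U \<xi>)) \<le> e" if F: "finite F" "F \<subseteq> G" "F \<inter> F0 = {}" for F
      proof -
        have "norm (\<Sum>U\<in>F. act (coef c U) (U \<xi>)) \<le> e / K * K"
          by (rule fin[OF F(1,2)]) (use F0(3) F eK in auto)
        then show ?thesis using K by simp
      qed
      then show "\<exists>F0. finite F0 \<and> F0 \<subseteq> G \<and> (\<forall>F. finite F \<and> F \<subseteq> G \<and> F \<inter> F0 = {} \<longrightarrow>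
          norm (\<Sum>U\<in>F. act (coef c U) (U \<xi>)) \<le> e)" using F0(1,2) by (intro exI[of _ F0]) simp
    qed
    then show ?thesis by (simp add: syn_def)
  qed
  show "((\<lambda>U. act (coef c U) (U \<xi>)) has_sum syn \<xi> c) G" by (rule hs)
  have "l2_inner (\<theta> \<xi> x) c = ip x (syn \<xi> c)" for x c
  proof -
    have "((\<lambda>U. ip x (act (coef c U) (U \<xi>))) has_sum ip x (syn \<xi> c)) G"
      by (rule has_sum_bounded_linear[OF bounded_linear_ip_right hs])
    then have "((\<lambda>U. ip x (U \<xi>) * star (coef c U)) has_sum ip x (syn \<xi> c)) G"
      by (simp add: ip_simps mult.commute)
    then have "ip x (syn \<xi> c) = (\<Sum>\<^sub>\<infinity>U\<in>G. ip x (U \<xi>) * star (coef c U))" by (simp add: infsumI)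
    also have "\<dots> = l2_inner (\<theta> \<xi> x) c"
      by (subst l2_inner_supported_left[of G]) (auto simp: bessel_coef[OF \<xi>] intro: infsum_cong)
    finally show ?thesis by simp
  qed
  then show "adj_pair ip l2_inner (\<theta> \<xi>) (syn \<xi>)" unfolding adj_pair_def using K(2) by blast
qed

lemmas adj_\<theta> = synthesis(2)

lemma adj_syn: "bessel \<xi> \<Longrightarrow> adj_pair l2_inner ip (syn \<xi>) (\<theta> \<xi>)"
  by (rule HL.adj_sym[OF adj_\<theta>])

lemma rst_\<theta>: "bessel \<xi> \<Longrightarrow> rst (\<theta> \<xi> x) = \<theta> \<xi> x"
  by (rule l2_eqI) (simp add: bessel_coef)

lemma \<theta>_group: "bessel \<xi> \<Longrightarrow> V \<in> G \<Longrightarrow> \<theta> \<xi> (V x) = lam V (\<theta> \<xi> x)"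
proof (rule l2_eqI)
  fix U assume \<xi>: "bessel \<xi>" and V: "V \<in> G"
  show "coef (\<theta> \<xi> (V x)) U = coef (lam V (\<theta> \<xi> x)) U"
    using V by (simp add: bessel_coef[OF \<xi>] coef_lam adj_pairD[OF adj_group[OF V]])
      (metis comp_assoc comp_apply id_comp group_inverse inv_closed mul_closed)
qed

lemma syn_rst: "bessel \<xi> \<Longrightarrow> syn \<xi> (rst c) = syn \<xi> c"
  by (rule ip_ext) (simp add: adj_pairD[OF adj_syn] adj_pairD[OF adj_rst] rst_\<theta>)

lemma syn_lam:
  assumes \<xi>: "bessel \<xi>" and V: "V \<in> G" shows "syn \<xi> (lam V c) = V (syn \<xi> c)"
  by (rule ip_ext) (simp add: adj_pairD[OF adj_syn[OF \<xi>]] adj_pairD[OF adj_lam[OF V]]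
      adj_pairD[OF adj_group[OF V]] \<theta>_group[OF \<xi> inv_closed[OF V]])

definition commuting_pair :: "('h \<Rightarrow> 'h) \<Rightarrow> ('h \<Rightarrow> 'h) \<Rightarrow> bool"
  where "commuting_pair T T' \<longleftrightarrow> adj_pair ip ip T T' \<and> (\<forall>U\<in>G. \<forall>x. T (U x) = U (T x))"

lemma commuting_pair_id: "commuting_pair (\<lambda>x. x) (\<lambda>x. x)"
  by (simp add: commuting_pair_def adj_pair_id)

lemma invariant_op_transport:
  assumes \<xi>: "bessel \<xi>" and \<zeta>: "bessel \<zeta>" and T: "commuting_pair T T'"
  shows "invariant_op (\<lambda>c. \<theta> \<xi> (T (syn \<zeta> c))) (\<lambda>c. \<theta> \<zeta> (T' (syn \<xi> c)))"
proof -
  have "adj_pair ip ip T T'" using T by (simp add: commuting_pair_def)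
  from adj_pair_comp[OF adj_pair_comp[OF adj_syn[OF \<zeta>] this] adj_\<theta>[OF \<xi>]] show ?thesis
    using T unfolding invariant_op_def commuting_pair_def
    by (simp add: syn_rst[OF \<zeta>] rst_\<theta>[OF \<xi>] syn_lam[OF \<zeta>] \<theta>_group[OF \<xi>])
qed

lemma frame_operator_commuting:
  assumes \<xi>: "bessel \<xi>" shows "commuting_pair (\<lambda>x. syn \<xi> (\<theta> \<xi> x)) (\<lambda>x. syn \<xi> (\<theta> \<xi> x))"
  unfolding commuting_pair_def using adj_pair_comp[OF adj_\<theta>[OF \<xi>] adj_syn[OF \<xi>]]
  by (simp add: \<theta>_group[OF \<xi>] syn_lam[OF \<xi>])

lemma frame_operator_ip: "bessel \<xi> \<Longrightarrow> ip (syn \<xi> (\<theta> \<xi> x)) y = l2_inner (\<theta> \<xi> x) (\<theta> \<xi> y)"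
  by (rule adj_pairD[OF adj_syn])

text \<open>Moving \<open>U\<close> to the other side and applying \<open>star\<close> turns the
  orbit of \<open>\<xi>\<close> seen from \<open>x\<close> into the orbit of \<open>x\<close> seen
  from \<open>\<xi>\<close>. So a Bessel vector \<open>x\<close> gives summability for every
  \<open>\<xi>\<close>.\<close>

lemma \<theta>_swap:
  assumes x: "bessel x"
  shows "square_summable (\<lambda>U. ip x (U \<xi>)) G" and "\<theta> \<xi> x = conj_inv (\<theta> x \<xi>)"
proof -
  have *: "(\<lambda>U. if U \<in> G then ip x (U \<xi>) else 0) = coef (conj_inv (\<theta> x \<xi>))"
  proof (rule ext)
    fix U
    show "(if U \<in> G then ip x (U \<xi>) else 0) = coef (conj_inv (\<theta> x \<xi>)) U"
      using ip_group_right[of U x \<xi>] ip_star[of "inv U x" \<xi>] by (simp add: bessel_coef[OF x] inv_closed)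
  qed
  then show s: "square_summable (\<lambda>U. ip x (U \<xi>)) G"
    by (intro square_summable_coefI) (rule fun_cong[OF *[symmetric]])
  show "\<theta> \<xi> x = conj_inv (\<theta> x \<xi>)" by (rule l2_eqI) (simp only: coef_\<theta>[OF s] *)
qed

text \<open>The flip preserves inner squares of families over \<open>G\<close>; the frame sum of
  \<open>\<xi>\<close> at \<open>x\<close> thereby becomes a quadratic form in
  \<open>\<xi>\<close>.\<close>

lemma \<theta>_swap_norm:
  assumes x: "bessel x"
  shows "l2_inner (\<theta> \<xi> x) (\<theta> \<xi> x) = ip (syn x (\<theta> x \<xi>)) \<xi>"
proof -
  have "l2_inner (\<theta> \<xi> x) (\<theta> \<xi> x) = l2_inner (\<theta> x \<xi>) (conj_inv (conj_inv (\<theta> x \<xi>)))"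
    unfolding \<theta>_swap(2)[OF x] by (rule conj_inv_sym)
  also have "\<dots> = ip (syn x (\<theta> x \<xi>)) \<xi>" by (simp add: rst_\<theta>[OF x] frame_operator_ip[OF x])
  finally show ?thesis .
qed

lemma besselI:
  assumes "\<And>x. square_summable (\<lambda>U. ip x (U \<xi>)) G" "\<And>x. norm (\<theta> \<xi> x) \<le> K * norm x"
  shows "bessel \<xi>"
  using assms by (auto simp: bessel_def)

lemma bessel_add:
  assumes x: "bessel x" and y: "bessel y" shows "bessel (x + y)"
proof -
  obtain K L where K: "\<And>z. norm (\<theta> x z) \<le> K * norm z" and L: "\<And>z. norm (\<theta> y z) \<le> L * norm z"
    using x y by (auto simp: bessel_def)
  have *: "ip z (U (x + y)) = ip z (U x) + ip z (U y)" if "U \<in> G" for U z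
    by (simp add: E.adj_add[OF adj_group[OF that]] ip_simps)
  have s: "square_summable (\<lambda>U. ip z (U (x + y))) G" for z
    by (rule square_summable_coefI[of "\<theta> x z + \<theta> y z"]) (simp add: bessel_coef x y *)
  have "\<theta> (x + y) z = \<theta> x z + \<theta> y z" for z
    by (rule l2_eqI) (simp add: coef_\<theta>[OF s] bessel_coef x y *)
  then have "norm (\<theta> (x + y) z) \<le> (K + L) * norm z" for z
    using norm_triangle_mono[OF K L, of z z] by (simp add: distrib_right)
  with s show ?thesis by (rule besselI)
qed

lemma bessel_act:
  assumes x: "bessel x" shows "bessel (act a x)"
proof -
  obtain K where K: "\<And>z. norm (\<theta> x z) \<le> K * norm z" using x by (auto simp: bessel_def)
  have *: "ip z (U (act a x)) = star a * ip z (U x)" if "U \<in> G" for U z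
    by (simp add: E.adj_act[OF adj_group[OF that]] ip_simps)
  have s: "square_summable (\<lambda>U. ip z (U (act a x))) G" for z
    by (rule square_summable_coefI[of "l2_act (star a) (\<theta> x z)"]) (simp add: bessel_coef x *)
  have "\<theta> (act a x) z = l2_act (star a) (\<theta> x z)" for z
    by (rule l2_eqI) (simp add: coef_\<theta>[OF s] bessel_coef x *)
  then have "norm (\<theta> (act a x) z) \<le> (norm a * K) * norm z" for z
    using order_trans[OF L2.norm_act_le[of "star a" "\<theta> x z"] mult_left_mono[OF K]] by (simp add: mult.assoc)
  with s show ?thesis by (rule besselI)
qed

lemma bij_mul_right: "V \<in> G \<Longrightarrow> bij_betw (\<lambda>U. U \<circ> V) G G"
  by (rule bij_betw_byWitness[where f' = "\<lambda>U. U \<circ> inv V"])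
    (auto simp: comp_assoc group_inverse mul_closed inv_closed)

lemma bessel_group:
  assumes x: "bessel x" and V: "V \<in> G" shows "bessel (V x)"
proof -
  obtain K where K: "\<And>z. norm (\<theta> x z) \<le> K * norm z" using x by (auto simp: bessel_def)
  have *: "(\<lambda>U. if U \<in> G then ip z (U (V x)) else 0) = coef (l2_reindex G (\<lambda>U. U \<circ> V) (\<theta> x z))" for z
    by (auto simp: coef_l2_reindex[OF bij_mul_right[OF V]] bessel_coef x fun_eq_iff mul_closed V)
  have s: "square_summable (\<lambda>U. ip z (U (V x))) G" for z
    by (rule square_summable_coefI) (rule fun_cong[OF *[symmetric]])
  have "\<theta> (V x) z = l2_reindex G (\<lambda>U. U \<circ> V) (\<theta> x z)" for z
    by (rule l2_eqI) (simp only: coef_\<theta>[OF s] *)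
  then have "norm (\<theta> (V x) z) \<le> K * norm z" for z
    using order_trans[OF norm_l2_reindex[OF bij_mul_right[OF V]] K] by simp
  with s show ?thesis by (rule besselI)
qed

lemma bessel_zero: "bessel 0"
proof -
  have *: "ip z (U 0) = 0" if "U \<in> G" for U z by (simp add: E.adj_zero[OF adj_group[OF that]])
  have s: "square_summable (\<lambda>U. ip z (U 0)) G" for z
    by (rule square_summable_coefI[of 0]) (simp add: *)
  have "\<theta> 0 z = 0" for z by (rule l2_eqI) (simp add: coef_\<theta>[OF s] *)
  with s show ?thesis by (intro besselI[of _ 0]) auto
qed

lemma bessel_diff: "bessel x \<Longrightarrow> bessel y \<Longrightarrow> bessel (x - y)"
  using bessel_add[OF _ bessel_act[of y "(- 1) *\<^sub>R 1"], of x] unfolding act_scaleR_one by simp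

text \<open>For a limit \<open>x\<close> of Bessel vectors even summability has to be shown. The
  bound makes the families of the approximating vectors Cauchy, and the entries of their limit are
  the inner products with \<open>x\<close>.\<close>

lemma bessel_extend:
  assumes dense: "closure {x. bessel x} = UNIV"
    and K: "\<And>x. bessel x \<Longrightarrow> norm (\<theta> \<xi> x) \<le> K * norm x"
  shows "bessel \<xi>"
proof -
  have *: "square_summable (\<lambda>U. ip x (U \<xi>)) G \<and> norm (\<theta> \<xi> x) \<le> K * norm x" for x
  proof -
    have "x \<in> closure {x. bessel x}" using dense by simp
    then obtain X where X: "\<And>n. bessel (X n)" "X \<longlonglongrightarrow> x" by (auto simp: closure_sequential)
    have ss: "square_summable (\<lambda>U. ip (X n) (U \<xi>)) G" for n by (rule \<theta>_swap(1)[OF X(1)])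
    have "norm (\<theta> \<xi> (X m) - \<theta> \<xi> (X n)) \<le> \<bar>K\<bar> * norm (X m - X n)" for m n
    proof -
      have "norm (\<theta> \<xi> (X m - X n)) \<le> K * norm (X m - X n)" by (intro K bessel_diff X)
      then show ?thesis unfolding \<theta>_diff[OF ss ss] by (smt (verit) mult_right_mono norm_ge_zero)
    qed
    then have bd: "norm (\<theta> \<xi> (X m) - \<theta> \<xi> (X n)) \<le> (\<bar>K\<bar> + 1) * norm (X m - X n)" for m n
      by (smt (verit) mult_right_mono norm_ge_zero)
    have "Cauchy (\<lambda>n. \<theta> \<xi> (X n))"
    proof (rule CauchyI)
      fix e :: real assume e: "0 < e"
      have "Cauchy X" using X(2) convergent_Cauchy convergent_def by blast
      moreover have "0 < e / (\<bar>K\<bar> + 1)" using e by (simp add: add_nonneg_pos)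
      ultimately obtain M where M: "\<forall>m\<ge>M. \<forall>n\<ge>M. norm (X m - X n) < e / (\<bar>K\<bar> + 1)" using CauchyD by blast
      have "norm (\<theta> \<xi> (X m) - \<theta> \<xi> (X n)) < e" if "M \<le> m" "M \<le> n" for m n
      proof -
        have "norm (X m - X n) < e / (\<bar>K\<bar> + 1)" using M that by blast
        then have "(\<bar>K\<bar> + 1) * norm (X m - X n) < e" by (simp add: pos_less_divide_eq add_nonneg_pos mult.commute)
        with bd[of m n] show ?thesis by linarith
      qed
      then show "\<exists>M. \<forall>m\<ge>M. \<forall>n\<ge>M. norm (\<theta> \<xi> (X m) - \<theta> \<xi> (X n)) < e" by blast
    qed
    then obtain f where f: "(\<lambda>n. \<theta> \<xi> (X n)) \<longlonglongrightarrow> f" using Cauchy_convergent convergent_def by blast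
    have cf: "coef f U = (if U \<in> G then ip x (U \<xi>) else 0)" for U
    proof (rule LIMSEQ_unique)
      have "(\<lambda>n. l2_inner (\<theta> \<xi> (X n)) (l2_unit U)) \<longlonglongrightarrow> l2_inner f (l2_unit U)"
        by (rule L2.tendsto_ip[OF f tendsto_const])
      then show "(\<lambda>n. coef (\<theta> \<xi> (X n)) U) \<longlonglongrightarrow> coef f U" by (simp add: l2_inner_unit)
      show "(\<lambda>n. coef (\<theta> \<xi> (X n)) U) \<longlonglongrightarrow> (if U \<in> G then ip x (U \<xi>) else 0)"
        using tendsto_ip[OF X(2) tendsto_const, of "U \<xi>"] by (simp add: coef_\<theta>[OF ss])
    qed
    then have s: "square_summable (\<lambda>U. ip x (U \<xi>)) G"
      by (rule square_summable_coefI)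
    have "\<theta> \<xi> x = f" by (rule l2_eqI) (simp add: coef_\<theta>[OF s] cf)
    moreover have "norm f \<le> K * norm x"
      by (rule LIMSEQ_le[OF tendsto_norm[OF f] tendsto_mult_left[OF tendsto_norm[OF X(2)]]]) (use K X(1) in blast)
    ultimately show ?thesis using s by simp
  qed
  then show ?thesis by (intro besselI[of _ K]) blast+
qed

section \<open>Frame conditions tested by characters\<close>

lemma l2_\<theta>_sum: "l2_inner (\<theta> \<xi> x) (\<theta> \<xi> x) = (\<Sum>\<^sub>\<infinity>U\<in>G. ip x (U \<xi>) * ip (U \<xi>) x)"
  if "square_summable (\<lambda>U. ip x (U \<xi>)) G"
  by (subst l2_inner_supported[of G]) (auto simp: coef_\<theta>[OF that] intro!: infsum_cong simp flip: ip_star)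

lemma square_summable_ip_iff:
  "square_summable (\<lambda>U. ip x (U \<xi>)) G \<longleftrightarrow> (\<lambda>U. ip x (U \<xi>) * ip (U \<xi>) x) summable_on G"
  unfolding square_summable_def by (simp flip: ip_star)

lemma frame_with_bounds_iff:
  "frame_with_bounds ip C D G (\<lambda>U. U \<xi>) \<longleftrightarrow> countable G \<and> (\<forall>x. square_summable (\<lambda>U. ip x (U \<xi>)) G \<and>
    (\<forall>\<omega>. character \<omega> \<longrightarrow> C * Re (\<omega> (ip x x)) \<le> Re (\<omega> (l2_inner (\<theta> \<xi> x) (\<theta> \<xi> x))) \<and>
      Re (\<omega> (l2_inner (\<theta> \<xi> x) (\<theta> \<xi> x))) \<le> D * Re (\<omega> (ip x x))))"
proof -
  have "(cstar_le (C *\<^sub>R ip x x) (\<Sum>\<^sub>\<infinity>U\<in>G. ip x (U \<xi>) * ip (U \<xi>) x) \<and>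
      cstar_le (\<Sum>\<^sub>\<infinity>U\<in>G. ip x (U \<xi>) * ip (U \<xi>) x) (D *\<^sub>R ip x x)) \<longleftrightarrow>
    (\<forall>\<omega>. character \<omega> \<longrightarrow> C * Re (\<omega> (ip x x)) \<le> Re (\<omega> (l2_inner (\<theta> \<xi> x) (\<theta> \<xi> x))) \<and>
      Re (\<omega> (l2_inner (\<theta> \<xi> x) (\<theta> \<xi> x))) \<le> D * Re (\<omega> (ip x x)))"
    if s: "square_summable (\<lambda>U. ip x (U \<xi>)) G" for x
    unfolding l2_\<theta>_sum[OF s, symmetric] cstar_le_iff_char
    using char_ip_Im L2.char_ip_Im by (auto simp: char_scaleR)
  then show ?thesis unfolding frame_with_bounds_def square_summable_ip_iff[symmetric] by blast
qed

lemma bessel_with_bound_iff: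
  "bessel_with_bound ip D G (\<lambda>U. U \<xi>) \<longleftrightarrow> countable G \<and> (\<forall>x. square_summable (\<lambda>U. ip x (U \<xi>)) G \<and>
    (\<forall>\<omega>. character \<omega> \<longrightarrow> Re (\<omega> (l2_inner (\<theta> \<xi> x) (\<theta> \<xi> x))) \<le> D * Re (\<omega> (ip x x))))"
proof -
  have "cstar_le (\<Sum>\<^sub>\<infinity>U\<in>G. ip x (U \<xi>) * ip (U \<xi>) x) (D *\<^sub>R ip x x) \<longleftrightarrow>
    (\<forall>\<omega>. character \<omega> \<longrightarrow> Re (\<omega> (l2_inner (\<theta> \<xi> x) (\<theta> \<xi> x))) \<le> D * Re (\<omega> (ip x x)))"
    if s: "square_summable (\<lambda>U. ip x (U \<xi>)) G" for x
    unfolding l2_\<theta>_sum[OF s, symmetric] cstar_le_iff_char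
    using char_ip_Im L2.char_ip_Im by (auto simp: char_scaleR)
  then show ?thesis unfolding bessel_with_bound_def square_summable_ip_iff[symmetric] by blast
qed

lemma norm_\<theta>_le:
  assumes "\<And>\<omega>. character \<omega> \<Longrightarrow> Re (\<omega> (l2_inner (\<theta> \<xi> x) (\<theta> \<xi> x))) \<le> D * Re (\<omega> (ip x x))" "0 \<le> D"
  shows "norm (\<theta> \<xi> x) \<le> sqrt D * norm x"
proof (rule L2.norm_leI)
  fix \<omega> :: "'a \<Rightarrow> complex" assume c: "character \<omega>"
  have "Re (\<omega> (l2_inner (\<theta> \<xi> x) (\<theta> \<xi> x))) \<le> D * (norm x)\<^sup>2"
    using assms(1)[OF c] mult_left_mono[OF char_ip_le[OF c, of x] assms(2)] by linarith
  then show "Re (\<omega> (l2_inner (\<theta> \<xi> x) (\<theta> \<xi> x))) \<le> (sqrt D * norm x)\<^sup>2"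
    using assms(2) by (simp add: power_mult_distrib)
qed (use assms(2) in simp)

lemma complete_Bessel_iff:
  assumes "countable G" shows "complete_Bessel_vector ip G \<xi> \<longleftrightarrow> bessel \<xi>"
proof
  assume "complete_Bessel_vector ip G \<xi>"
  then obtain D where D: "0 < D" "bessel_with_bound ip D G (\<lambda>U. U \<xi>)" by (auto simp: complete_Bessel_vector_def)
  then show "bessel \<xi>" unfolding bessel_with_bound_iff
    by (intro besselI[of _ "sqrt D"] norm_\<theta>_le) auto
next
  assume \<xi>: "bessel \<xi>"
  then obtain K where K: "\<And>x. norm (\<theta> \<xi> x) \<le> K * norm x" by (auto simp: bessel_def)
  \<comment> \<open>The added \<open>1\<close> makes the Bessel bound positive, as
    \<open>complete_Bessel_vector\<close> demands.\<close>
  have "Re (\<omega> (l2_inner (\<theta> \<xi> x) (\<theta> \<xi> x))) \<le> (K\<^sup>2 + 1) * Re (\<omega> (ip x x))" if c: "character \<omega>" for \<omega> x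
    using HL.char_bound_of_norm_bound[OF HL.adj_act[OF adj_\<theta>[OF \<xi>]] K c, of x] char_ip_nonneg[OF c, of x]
    by (simp add: distrib_right)
  then have "bessel_with_bound ip (K\<^sup>2 + 1) G (\<lambda>U. U \<xi>)"
    using \<xi> assms by (auto simp: bessel_with_bound_iff bessel_def)
  moreover have "0 < K\<^sup>2 + 1" using zero_le_power2[of K] by linarith
  ultimately show "complete_Bessel_vector ip G \<xi>" by (auto simp: complete_Bessel_vector_def)
qed

lemma frame_bessel: "0 \<le> D \<Longrightarrow> frame_with_bounds ip C D G (\<lambda>U. U \<xi>) \<Longrightarrow> bessel \<xi>"
  unfolding frame_with_bounds_iff by (intro besselI[of _ "sqrt D"] norm_\<theta>_le) auto

lemma Parseval_iff:
  assumes "countable G"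
  shows "complete_Parseval_frame_vector ip G \<xi> \<longleftrightarrow> bessel \<xi> \<and> (\<forall>x. l2_inner (\<theta> \<xi> x) (\<theta> \<xi> x) = ip x x)"
proof
  assume P: "complete_Parseval_frame_vector ip G \<xi>"
  then have f: "frame_with_bounds ip 1 1 G (\<lambda>U. U \<xi>)" by (simp add: complete_Parseval_frame_vector_def)
  have "l2_inner (\<theta> \<xi> x) (\<theta> \<xi> x) = ip x x" for x
  proof (rule char_eqI)
    fix \<omega> :: "'a \<Rightarrow> complex" assume c: "character \<omega>"
    show "\<omega> (l2_inner (\<theta> \<xi> x) (\<theta> \<xi> x)) = \<omega> (ip x x)"
      using f c char_ip_Im[OF c, of x] L2.char_ip_Im[OF c, of "\<theta> \<xi> x"]
      unfolding frame_with_bounds_iff by (simp add: complex_eq_iff order_antisym)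
  qed
  then show "bessel \<xi> \<and> (\<forall>x. l2_inner (\<theta> \<xi> x) (\<theta> \<xi> x) = ip x x)" using frame_bessel[OF _ f] by simp
next
  assume "bessel \<xi> \<and> (\<forall>x. l2_inner (\<theta> \<xi> x) (\<theta> \<xi> x) = ip x x)"
  then show "complete_Parseval_frame_vector ip G \<xi>"
    using assms by (simp add: complete_Parseval_frame_vector_def frame_with_bounds_iff bessel_def)
qed

end

section \<open>Modules with a complete Parseval frame vector\<close>

locale parseval_module = unitary_module act ip G
  for act :: "'a::comm_unital_cstar_algebra \<Rightarrow> 'h::complex_banach \<Rightarrow> 'h" and ip :: "'h \<Rightarrow> 'h \<Rightarrow> 'a"
    and G :: "('h \<Rightarrow> 'h) set" +
  fixes \<eta> :: 'h and \<Phi> :: "'a \<Rightarrow> ('x::complex_banach \<Rightarrow>\<^sub>L complex)"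
  assumes dual: "dual_iso \<Phi>" and self_dual: "l2_self_dual TYPE('a) G" and cnt: "countable G"
    and eta: "bessel \<eta>" and parseval: "l2_inner (\<theta> \<eta> x) (\<theta> \<eta> x) = ip x x"
begin

text \<open>Self-duality is assumed for functions that vanish outside \<open>G\<close>. Functionals
  on the type \<open>l2\<close> that factor through \<open>rst\<close> are determined by these
  functions.\<close>

lemma l2_representation:
  fixes f :: "('h \<Rightarrow> 'h, 'a) l2 \<Rightarrow> 'a"
  assumes add: "\<And>x y. f (x + y) = f x + f y" and act: "\<And>a x. f (l2_act a x) = a * f x"
    and rst: "\<And>x. f (rst x) = f x" and bd: "\<exists>B. \<forall>x. norm (f x) \<le> B * norm x"
  shows "\<exists>y. \<forall>x. f x = l2_inner x y"
proof -
  define K where "K = (l2_carrier G :: (('h \<Rightarrow> 'h) \<Rightarrow> 'a) set)"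
  have Kc: "coef (mk_l2 a) = a" and K0: "U \<notin> G \<Longrightarrow> a U = 0" if "a \<in> K" for a U
  proof -
    have a: "\<forall>U. U \<notin> G \<longrightarrow> a U = 0" "square_summable a G"
      using that by (simp_all add: K_def l2_carrier_def square_summable_def)
    have "(\<lambda>U. if U \<in> G then a U else 0) = a" using a(1) by auto
    then have "square_summable a UNIV" using a(2) square_summable_extend by metis
    then show "coef (mk_l2 a) = a" by (rule coef_mk_l2)
    show "U \<notin> G \<Longrightarrow> a U = 0" using a(1) by blast
  qed
  have ipK: "l2_ip G a b = l2_inner (mk_l2 a) (mk_l2 b)" if "a \<in> K" "b \<in> K" for a b
    unfolding l2_ip_def by (subst l2_inner_supported[of G]) (simp_all add: Kc K0 that)
  obtain B where B: "\<And>x. norm (f x) \<le> B * norm x" using bd by blast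
  have 1: "f (mk_l2 (\<lambda>U. a U + b U)) = f (mk_l2 a) + f (mk_l2 b)" if "a \<in> K" "b \<in> K" for a b
    using add[of "mk_l2 a" "mk_l2 b"] by (simp add: plus_l2_def Kc that)
  have 2: "f (mk_l2 (\<lambda>U. c * a U)) = c * f (mk_l2 a)" if "a \<in> K" for a c
    using act[of c "mk_l2 a"] by (simp add: l2_act_def Kc that)
  have 3: "norm (f (mk_l2 a)) \<le> B * sqrt (norm (l2_ip G a a))" if "a \<in> K" for a
    using B[of "mk_l2 a"] by (simp add: ipK that norm_l2_def)
  have "\<exists>y\<in>K. \<forall>a\<in>K. f (mk_l2 a) = l2_ip G a y"
    by (rule self_dual[unfolded l2_self_dual_def self_dual_def, folded K_def, rule_format, of "\<lambda>a. f (mk_l2 a)"])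
      (use 1 2 3 in blast)
  then obtain y where y: "y \<in> K" "\<And>a. a \<in> K \<Longrightarrow> f (mk_l2 a) = l2_ip G a y" by blast
  have "f x = l2_inner x (mk_l2 y)" for x
  proof -
    have xK: "coef (rst x) \<in> K"
      using square_summable_subset[OF square_summable_coef[of "rst x"], of G]
      by (simp add: K_def l2_carrier_def square_summable_def)
    have "f x = f (mk_l2 (coef (rst x)))" by (simp only: coef_inverse rst)
    also have "\<dots> = l2_ip G (coef (rst x)) y" by (rule y(2)[OF xK])
    also have "\<dots> = l2_inner (mk_l2 (coef (rst x))) (mk_l2 y)" by (rule ipK[OF xK y(1)])
    also have "mk_l2 (coef (rst x)) = rst x" by (rule coef_inverse)
    also have "l2_inner (rst x) (mk_l2 y) = l2_inner x (mk_l2 y)"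
    proof -
      have "rst (mk_l2 y) = mk_l2 y" by (rule l2_eqI) (auto simp: Kc[OF y(1)] K0[OF y(1)])
      then show ?thesis by (metis adj_pairD[OF adj_rst])
    qed
    finally show ?thesis .
  qed
  then show ?thesis by blast
qed

text \<open>\<open>Z\<close> is self-adjoint with vanishing quadratic form; evaluating the form at
  \<open>x + Z x\<close> leaves \<open>2 *\<^sub>R ip (Z x) (Z x) = 0\<close>.\<close>

lemma reconstruction: "syn \<eta> (\<theta> \<eta> x) = x"
proof -
  define Z where "Z x = syn \<eta> (\<theta> \<eta> x) - x" for x
  have Z: "adj_pair ip ip Z Z" unfolding Z_def
    by (rule E.adj_pair_minus[OF adj_pair_comp[OF adj_\<theta>[OF eta] adj_syn[OF eta]] adj_pair_id])
  have Z0: "ip (Z x) x = 0" for x by (simp add: Z_def ip_simps frame_operator_ip[OF eta] parseval)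
  have "ip (Z (x + Z x)) (x + Z x) = ip (Z x) (Z x) + ip (Z x) (Z x)"
    by (simp add: E.adj_add[OF Z] ip_simps Z0) (simp add: adj_pairD[OF Z])
  then have "2 *\<^sub>R ip (Z x) (Z x) = 0" by (simp only: Z0 scaleR_2)
  then have "Z x = 0" by (simp add: ip_eq_0_iff)
  then show ?thesis by (simp add: Z_def)
qed

lemma norm_\<theta>_eta: "norm (\<theta> \<eta> x) = norm x"
  by (simp add: norm_l2_def parseval norm_ip)

lemma norm_syn_eta: "norm (syn \<eta> c) \<le> norm c"
  using HL.adj_norm_le[OF adj_\<theta>[OF eta], of 1 c] by (simp add: norm_\<theta>_eta)

text \<open>The module is a complemented copy inside the standard module, so self-duality passes to
  it: the functional \<open>ip (T x) y\<close> of \<open>x\<close> is pulled back along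
  \<open>syn \<eta>\<close>, represented there, and brought back by
  \<open>reconstruction\<close>.\<close>

lemma End_mod_adjointable:
  assumes T: "T \<in> End_mod act" shows "\<exists>T'. adj_pair ip ip T T'"
proof -
  have bl: "bounded_linear T" and hom: "T (act a x) = act a (T x)" for a x using T by (auto simp: End_mod_def)
  obtain B where B: "0 < B" "\<And>x. norm (T x) \<le> norm x * B" using bounded_linear.pos_bounded[OF bl] by blast
  have "\<exists>z. \<forall>x. ip (T x) y = ip x z" for y
  proof -
    define f where "f c = ip (T (syn \<eta> c)) y" for c
    have "\<exists>d. \<forall>c. f c = l2_inner c d"
    proof (rule l2_representation)
      show "f (c + d) = f c + f d" for c d
        by (simp add: f_def LH.adj_add[OF adj_syn[OF eta]] ip_simps linear_add[OF bounded_linear.linear[OF bl]])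
      show "f (l2_act a c) = a * f c" for a c by (simp add: f_def LH.adj_act[OF adj_syn[OF eta]] hom ip_simps)
      show "f (rst c) = f c" for c by (simp add: f_def syn_rst[OF eta])
      have "norm (f c) \<le> (B * norm y) * norm c" for c
      proof -
        have "norm (f c) \<le> norm (T (syn \<eta> c)) * norm y" unfolding f_def by (rule norm_ip_le)
        also have "\<dots> \<le> (norm c * B) * norm y"
          using B order_trans[OF B(2) mult_right_mono[OF norm_syn_eta]] by (intro mult_right_mono) auto
        finally show ?thesis by (simp add: ac_simps)
      qed
      then show "\<exists>B. \<forall>c. norm (f c) \<le> B * norm c" by blast
    qed
    then obtain d where "\<And>c. f c = l2_inner c d" by blast
    then have "ip (T x) y = l2_inner (\<theta> \<eta> x) d" for x by (metis f_def reconstruction)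
    then have "ip (T x) y = ip x (syn \<eta> d)" for x by (simp add: adj_pairD[OF adj_\<theta>[OF eta]])
    then show ?thesis by blast
  qed
  then obtain T' where "\<And>x y. ip (T x) y = ip x (T' y)" by metis
  then have "adj_pair ip ip T T'" unfolding adj_pair_def using B(2) by (metis mult.commute)
  then show ?thesis by blast
qed

lemma commutant_iff: "T \<in> commutant act G \<longleftrightarrow> (\<exists>T'. commuting_pair T T')"
proof
  assume T: "T \<in> commutant act G"
  then have "T \<in> End_mod act" "\<forall>U\<in>G. \<forall>x. T (U x) = U (T x)"
    by (auto simp: commutant_def fun_eq_iff)
  then show "\<exists>T'. commuting_pair T T'" using End_mod_adjointable by (auto simp: commuting_pair_def)
next
  assume "\<exists>T'. commuting_pair T T'"
  then obtain T' where "adj_pair ip ip T T'" "\<forall>U\<in>G. \<forall>x. T (U x) = U (T x)" by (auto simp: commuting_pair_def)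
  then show "T \<in> commutant act G" by (auto simp: commutant_def adj_End fun_eq_iff)
qed

section \<open>From frame vectors to operators in the bicommutant\<close>

definition compress :: "(('h \<Rightarrow> 'h, 'a) l2 \<Rightarrow> ('h \<Rightarrow> 'h, 'a) l2) \<Rightarrow> 'h \<Rightarrow> 'h"
  where "compress w x = syn \<eta> (twist w (\<theta> \<eta> x))"

lemma compress_adj: "invariant_op w w' \<Longrightarrow> adj_pair ip ip (compress w) (compress w')"
  unfolding compress_def
  by (rule adj_pair_comp[OF adj_pair_comp[OF adj_\<theta>[OF eta] twist_adj] adj_syn[OF eta]])

text \<open>An operator \<open>T\<close> commuting with \<open>G\<close> becomes an invariant
  operator on the standard module when placed between \<open>\<theta> \<eta>\<close> and
  \<open>syn \<eta>\<close>. As such it commutes with \<open>twist w\<close>, and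
  \<open>reconstruction\<close> removes the outer factors.\<close>

lemma compress_bicommutant:
  assumes w: "invariant_op w w'"
  shows "compress w \<in> commutant act (commutant act G)"
proof -
  have "compress w (T x) = T (compress w x)" if T: "commuting_pair T T'" for T T' x
  proof -
    note v = invariant_op_transport[OF eta eta T]
    have "twist w (\<theta> \<eta> (T (syn \<eta> (\<theta> \<eta> x)))) = \<theta> \<eta> (T (syn \<eta> (twist w (\<theta> \<eta> x))))"
      by (rule twist_commute[OF v w, symmetric])
    then show ?thesis by (simp add: compress_def reconstruction)
  qed
  then show ?thesis using adj_End[OF compress_adj[OF w]]
    by (auto simp: commutant_def[of act "commutant act G"] commutant_iff fun_eq_iff)
qed

lemma compress_eta:
  assumes \<xi>: "bessel \<xi>" and w: "\<And>x. w (\<theta> \<eta> x) = \<theta> \<xi> x"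
  shows "compress w \<eta> = \<xi>"
proof -
  have "conj_inv (\<theta> \<eta> \<eta>) = \<theta> \<eta> \<eta>" by (rule \<theta>_swap(2)[OF eta, symmetric])
  moreover have "conj_inv (\<theta> \<xi> \<eta>) = \<theta> \<eta> \<xi>" by (rule \<theta>_swap(2)[OF \<xi>, symmetric])
  ultimately show ?thesis by (simp add: compress_def twist_def w reconstruction)
qed

text \<open>The projection onto the range of \<open>\<theta> \<eta>\<close> is invariant and hence
  commutes with \<open>twist w\<close>; this makes compression multiplicative.\<close>

lemma compress_comp:
  assumes w: "invariant_op w w'" and v: "invariant_op v v'"
  shows "compress w (compress v x) = compress (\<lambda>x. w (v x)) x"
proof -
  have "twist w (\<theta> \<eta> (syn \<eta> y)) = \<theta> \<eta> (syn \<eta> (twist w y))" for y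
    by (rule twist_commute[OF invariant_op_transport[OF eta eta commuting_pair_id] w, symmetric])
  then show ?thesis by (simp add: compress_def reconstruction twist_comp[OF w])
qed

lemma compress_rst: "(\<And>y. w y = rst y) \<Longrightarrow> compress w x = x"
  by (simp add: compress_def twist_def rst_\<theta>[OF eta] reconstruction)

lemma Bessel_witness:
  assumes \<xi>: "bessel \<xi>"
  shows "\<exists>A\<in>commutant act (commutant act G). A \<in> End_adj act ip \<and> \<xi> = A \<eta>"
proof -
  note w = invariant_op_transport[OF \<xi> eta commuting_pair_id]
  have "compress (\<lambda>c. \<theta> \<xi> (syn \<eta> c)) \<eta> = \<xi>" by (rule compress_eta[OF \<xi>]) (simp add: reconstruction)
  then show ?thesis using compress_bicommutant[OF w] compress_adj[OF w] End_adj_iff by metis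
qed

lemma Parseval_unitary:
  assumes \<xi>: "bessel \<xi>" and P: "\<And>x. l2_inner (\<theta> \<xi> x) (\<theta> \<xi> x) = ip x x"
  shows "\<exists>u u'. invariant_op u u' \<and> (\<forall>x. u' (u x) = rst x) \<and> (\<forall>x. u (u' x) = rst x) \<and> (\<forall>z. u (\<theta> \<eta> z) = \<theta> \<xi> z)"
proof (rule unitary_extension[OF dual l2_representation])
  show "invariant_op (\<lambda>c. \<theta> \<xi> (syn \<eta> c)) (\<lambda>c. \<theta> \<eta> (syn \<xi> c))"
    by (rule invariant_op_transport[OF \<xi> eta commuting_pair_id])
  show "norm (\<theta> \<xi> (syn \<eta> c)) \<le> norm c" for c
    using norm_syn_eta[of c] by (simp add: norm_l2_def P norm_ip)
qed (simp_all add: rst_\<theta>[OF eta] P parseval reconstruction)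

lemma Parseval_witness:
  assumes \<xi>: "bessel \<xi>" and P: "\<And>x. l2_inner (\<theta> \<xi> x) (\<theta> \<xi> x) = ip x x"
  shows "\<exists>A\<in>commutant act (commutant act G). unitary_op act ip A \<and> \<xi> = A \<eta>"
proof -
  obtain u u' where u: "invariant_op u u'" "\<forall>x. u' (u x) = rst x" "\<forall>x. u (u' x) = rst x" "\<forall>z. u (\<theta> \<eta> z) = \<theta> \<xi> z"
    using Parseval_unitary[OF assms] by blast
  note u' = invariant_op_sym[OF u(1)]
  have "compress u (compress u' x) = x" "compress u' (compress u x) = x" for x
    using u(2,3) by (simp_all add: compress_comp[OF u(1) u'] compress_comp[OF u' u(1)] compress_rst)
  then have "unitary_op act ip (compress u)" using compress_adj[OF u(1)] unitary_op_iff by blast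
  moreover have "compress u \<eta> = \<xi>" by (rule compress_eta[OF \<xi>]) (simp add: u(4))
  ultimately show ?thesis using compress_bicommutant[OF u(1)] by blast
qed

text \<open>With \<open>R\<close> the square root of the frame operator of \<open>\<xi>\<close>, the vector \<open>R\<^sup>-\<^sup>1 \<xi>\<close> is Parseval.\<close>

lemma frame_operator_root:
  assumes \<xi>: "bessel \<xi>" and C: "0 < C" and D: "0 < D"
    and f: "\<And>x \<omega>. character \<omega> \<Longrightarrow> C * Re (\<omega> (ip x x)) \<le> Re (\<omega> (l2_inner (\<theta> \<xi> x) (\<theta> \<xi> x))) \<and>
      Re (\<omega> (l2_inner (\<theta> \<xi> x) (\<theta> \<xi> x))) \<le> D * Re (\<omega> (ip x x))"
  shows "\<exists>R V. commuting_pair R R \<and> commuting_pair V V \<and> (\<forall>x. R (R x) = syn \<xi> (\<theta> \<xi> x)) \<and>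
    (\<forall>x. R (V x) = x) \<and> (\<forall>x. V (R x) = x)"
proof -
  define S where "S x = syn \<xi> (\<theta> \<xi> x)" for x
  have S: "adj_pair ip ip S S" and SU: "\<And>U x. U \<in> G \<Longrightarrow> S (U x) = U (S x)"
    using frame_operator_commuting[OF \<xi>] unfolding commuting_pair_def S_def[abs_def] by blast+
  have Sip: "ip (S x) x = l2_inner (\<theta> \<xi> x) (\<theta> \<xi> x)" for x by (simp add: S_def frame_operator_ip[OF \<xi>])
  \<comment> \<open>With this \<open>s\<close> the operator \<open>1 - S / s\<close> lies between
    \<open>0\<close> and \<open>1 - C / s = D / s\<close>, so its norm stays below
    \<open>1\<close>.\<close>
  define s where "s = C + D"
  define c where "c = D / s"
  have s: "0 < s" and c: "0 < c" "c < 1" using C D by (simp_all add: s_def c_def)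
  define X where "X x = x - (1/s) *\<^sub>R S x" for x
  have X: "adj_pair ip ip X X" unfolding X_def by (rule E.adj_pair_minus[OF adj_pair_id E.adj_pair_scaleR[OF S]])
  have Xb: "0 \<le> Re (\<omega> (ip (X x) x)) \<and> Re (\<omega> (ip (X x) x)) \<le> c * Re (\<omega> (ip x x))" if w: "character \<omega>" for x \<omega>
  proof -
    define p q where "p = Re (\<omega> (ip x x))" and "q = Re (\<omega> (ip (S x) x))"
    have e: "Re (\<omega> (ip (X x) x)) = p - (1/s) * q"
      using w by (simp add: X_def ip_simps char_simps p_def q_def del: of_real_divide)
    have pq: "C * p \<le> q" "q \<le> D * p" "0 \<le> p"
      using f[OF w, of x] char_ip_nonneg[OF w, of x] by (simp_all add: p_def q_def Sip)
    have "q \<le> s * p" using pq C by (simp add: s_def distrib_right) (metis add_increasing less_imp_le mult_nonneg_nonneg)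
    moreover have "c * p = p - (1/s) * (C * p)" using s by (simp add: c_def s_def field_simps)
    moreover have "(1/s) * (C * p) \<le> (1/s) * q" using pq s by (intro mult_left_mono) auto
    ultimately show ?thesis unfolding e using s by (simp add: p_def[symmetric] field_simps)
  qed
  have nX: "norm (X x) \<le> c * norm x" for x
  proof (rule norm_leI)
    fix \<omega> :: "'a \<Rightarrow> complex" assume w: "character \<omega>"
    define p q where "p = Re (\<omega> (ip x x))" and "q = Re (\<omega> (ip (X x) (X x)))"
    \<comment> \<open>The form of \<open>X\<close> at \<open>x - X x / c\<close> is nonnegative, and
      \<open>0 \<le> X \<le> c\<close> bounds it by \<open>c p - q / c\<close>; this gives
      \<open>q \<le> c\<^sup>2 p\<close>.\<close>
    define t where "t = 1 / c"
    have "ip (X (x - t *\<^sub>R X x)) (x - t *\<^sub>R X x) = ip (X x) x - t *\<^sub>R ip (X x) (X x) - t *\<^sub>R ip (X x) (X x)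
       + (t * t) *\<^sub>R ip (X (X x)) (X x)"
      by (simp add: E.adj_diff[OF X] E.adj_scaleR[OF X] ip_simps adj_pairD[OF X, of "X x" x] algebra_simps)
    then have "Re (\<omega> (ip (X (x - t *\<^sub>R X x)) (x - t *\<^sub>R X x))) = Re (\<omega> (ip (X x) x - t *\<^sub>R ip (X x) (X x)
       - t *\<^sub>R ip (X x) (X x) + (t * t) *\<^sub>R ip (X (X x)) (X x)))" by (rule arg_cong)
    also have "\<dots> = Re (\<omega> (ip (X x) x)) - 2 * t * q + (t * t) * Re (\<omega> (ip (X (X x)) (X x)))"
      using w by (simp add: char_simps q_def)
    finally have "0 \<le> Re (\<omega> (ip (X x) x)) - 2 * t * q + (t * t) * Re (\<omega> (ip (X (X x)) (X x)))"
      using Xb[OF w, of "x - t *\<^sub>R X x"] by simp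
    also have "\<dots> \<le> c * p - 2 * t * q + (t * t) * (c * q)"
      using Xb[OF w, of x] Xb[OF w, of "X x"] unfolding p_def q_def
      by (intro add_mono diff_right_mono mult_left_mono) auto
    also have "\<dots> = c * p - q / c" using c by (simp add: t_def field_simps)
    finally have "q \<le> c\<^sup>2 * p" using c by (simp add: pos_divide_le_eq power2_eq_square ac_simps)
    also have "\<dots> \<le> c\<^sup>2 * (norm x)\<^sup>2" unfolding p_def by (intro mult_left_mono char_ip_le[OF w]) simp
    finally show "Re (\<omega> (ip (X x) (X x))) \<le> (c * norm x)\<^sup>2" by (simp add: q_def power_mult_distrib)
  qed (use c in simp)
  obtain Y where Y: "adj_pair ip ip Y Y" "\<forall>x. norm (Y x) \<le> c * norm x"
    "\<forall>x. (x - Y x) - Y (x - Y x) = x - X x"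
    "\<forall>V. bounded_linear V \<longrightarrow> (\<forall>x. V (X x) = X (V x)) \<longrightarrow> (\<forall>x. V (Y x) = Y (V x))"
    using operator_square_root[OF X nX less_imp_le[OF c(1)] c(2)] by (elim exE conjE)
  have UY: "Y (U x) = U (Y x)" if U: "U \<in> G" for U x
  proof -
    have "U (X x) = X (U x)" for x
      by (simp add: X_def E.adj_diff[OF adj_group[OF U]] E.adj_scaleR[OF adj_group[OF U]] SU[OF U])
    then show ?thesis using Y(4) E.adj_bounded_linear[OF adj_group[OF U]] by simp
  qed
  obtain V where V: "adj_pair ip ip V V" "\<And>x. V x - Y (V x) = x" "\<And>x. V (x - Y x) = x"
    using operator_one_minus_inverse[OF Y(1) Y(2)[rule_format] less_imp_le[OF c(1)] c(2)] by blast
  have UV: "V (U x) = U (V x)" if U: "U \<in> G" for U x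
  proof -
    have "U x = U (V x) - Y (U (V x))"
      by (simp add: UY[OF U] V(2) flip: E.adj_diff[OF adj_group[OF U]])
    then show ?thesis by (metis V(3))
  qed
  define R where "R x = sqrt s *\<^sub>R (x - Y x)" for x
  define W where "W x = (1 / sqrt s) *\<^sub>R V x" for x
  have adjR: "adj_pair ip ip R R" unfolding R_def by (intro E.adj_pair_scaleR E.adj_pair_minus adj_pair_id Y(1))
  have adjW: "adj_pair ip ip W W" unfolding W_def by (rule E.adj_pair_scaleR[OF V(1)])
  have "R (U x) = U (R x)" "W (U x) = U (W x)" if U: "U \<in> G" for U x
    by (simp_all add: R_def W_def UY[OF U] UV[OF U] E.adj_diff[OF adj_group[OF U]] E.adj_scaleR[OF adj_group[OF U]])
  then have "commuting_pair R R" "commuting_pair W W" using adjR adjW by (simp_all add: commuting_pair_def)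
  moreover have "R (R x) = S x" for x
  proof -
    have "R (R x) = s *\<^sub>R ((x - Y x) - Y (x - Y x))" using s
      by (simp add: R_def E.adj_scaleR[OF Y(1)] flip: scaleR_diff_right)
    then show ?thesis using s by (simp add: Y(3) X_def)
  qed
  moreover have "R (W x) = x" for x using s
    by (simp add: R_def W_def E.adj_scaleR[OF Y(1)] V(2) flip: scaleR_diff_right)
  moreover have "W (R x) = x" for x using s by (simp add: R_def W_def E.adj_scaleR[OF V(1)] V(3))
  ultimately show ?thesis unfolding S_def by blast
qed

text \<open>\<open>\<zeta> = V \<xi>\<close> is Parseval for the inverse root \<open>V\<close> of
  the frame operator. If \<open>u\<close> carries \<open>\<theta> \<eta>\<close> to
  \<open>\<theta> \<zeta>\<close>, then \<open>u\<close> preceded by \<open>R\<close> on the range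
  of \<open>\<theta> \<eta>\<close> carries \<open>\<theta> \<eta>\<close> to
  \<open>\<theta> \<xi>\<close>.\<close>

lemma frame_witness:
  assumes \<xi>: "bessel \<xi>" and C: "0 < C" and D: "0 < D"
    and f: "\<And>x \<omega>. character \<omega> \<Longrightarrow> C * Re (\<omega> (ip x x)) \<le> Re (\<omega> (l2_inner (\<theta> \<xi> x) (\<theta> \<xi> x))) \<and>
      Re (\<omega> (l2_inner (\<theta> \<xi> x) (\<theta> \<xi> x))) \<le> D * Re (\<omega> (ip x x))"
  shows "\<exists>A\<in>commutant act (commutant act G). invertible_op act A \<and> A \<in> End_adj act ip \<and> \<xi> = A \<eta>"
proof -
  obtain R V where R: "commuting_pair R R" and V: "commuting_pair V V"
    and RR: "\<And>x. R (R x) = syn \<xi> (\<theta> \<xi> x)" and RV: "\<And>x. R (V x) = x" "\<And>x. V (R x) = x"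
    using frame_operator_root[OF assms] by blast
  have adjR: "adj_pair ip ip R R" and adjV: "adj_pair ip ip V V" using R V by (simp_all add: commuting_pair_def)
  define \<zeta> where "\<zeta> = V \<xi>"
  have *: "ip x (U \<zeta>) = ip (V x) (U \<xi>)" if "U \<in> G" for U x
  proof -
    have "V (U \<xi>) = U (V \<xi>)" using V that by (simp add: commuting_pair_def)
    then show ?thesis by (simp add: \<zeta>_def adj_pairD[OF adjV])
  qed
  have s: "square_summable (\<lambda>U. ip x (U \<zeta>)) G" for x
    by (rule square_summable_coefI[of "\<theta> \<xi> (V x)"]) (simp add: bessel_coef[OF \<xi>] *)
  have \<theta>\<zeta>: "\<theta> \<zeta> x = \<theta> \<xi> (V x)" for x by (rule l2_eqI) (simp add: coef_\<theta>[OF s] bessel_coef[OF \<xi>] *)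
  have \<zeta>: "bessel \<zeta>"
    using adj_pair_comp[OF adjV adj_\<theta>[OF \<xi>]] s unfolding bessel_def adj_pair_def \<theta>\<zeta> by blast
  have "l2_inner (\<theta> \<zeta> x) (\<theta> \<zeta> x) = ip x x" for x
  proof -
    have "l2_inner (\<theta> \<zeta> x) (\<theta> \<zeta> x) = ip (R (R (V x))) (V x)" by (simp add: \<theta>\<zeta> RR frame_operator_ip[OF \<xi>])
    also have "\<dots> = ip x x" by (simp add: RV adj_pairD[OF adjR])
    finally show ?thesis .
  qed
  then obtain u u' where u: "invariant_op u u'" "\<forall>x. u' (u x) = rst x" "\<forall>x. u (u' x) = rst x" "\<forall>z. u (\<theta> \<eta> z) = \<theta> \<zeta> z"
    using Parseval_unitary[OF \<zeta>] by blast
  note u' = invariant_op_sym[OF u(1)]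
  \<comment> \<open>\<open>M T\<close> is \<open>T\<close> transported to the range of
    \<open>\<theta> \<eta>\<close> and the identity on its complement, so that \<open>M V\<close>
    inverts \<open>M R\<close> on all families over \<open>G\<close>.\<close>
  define M where "M T c = \<theta> \<eta> (T (syn \<eta> c)) + (rst c - \<theta> \<eta> (syn \<eta> c))" for T c
  have M: "invariant_op (M T) (M T)" if "commuting_pair T T" for T unfolding M_def
    by (rule invariant_op_plus[OF invariant_op_transport[OF eta eta that]
          invariant_op_minus[OF invariant_op_rst invariant_op_transport[OF eta eta commuting_pair_id]]])
  have MM: "M T (M T' c) = rst c" if "\<And>x. T (T' x) = x" "commuting_pair T T" for T T' c
  proof -
    have T0: "T (a + b) = T a + T b" for a b using that(2) E.adj_add by (auto simp: commuting_pair_def)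
    have "syn \<eta> (M T' c) = T' (syn \<eta> c)"
      by (simp add: M_def LH.adj_add[OF adj_syn[OF eta]] LH.adj_diff[OF adj_syn[OF eta]] reconstruction syn_rst[OF eta])
    moreover have "rst (M T' c) = M T' c"
      by (simp add: M_def L2.E.adj_add[OF adj_rst] L2.E.adj_diff[OF adj_rst] rst_\<theta>[OF eta])
    ultimately show ?thesis by (simp add: M_def[of T] that(1)) (simp add: M_def)
  qed
  define w where "w c = u (M R c)" for c
  define v where "v c = M V (u' c)" for c
  have w: "invariant_op w (\<lambda>c. M R (u' c))" unfolding w_def by (rule invariant_op_comp[OF u(1) M[OF R]])
  have v: "invariant_op v (\<lambda>c. u (M V c))" unfolding v_def by (rule invariant_op_comp[OF M[OF V] u'])
  have "w (v c) = rst c" for c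
    using MM[OF RV(1) R] u(3) by (simp add: w_def v_def rst_inv_op[OF u'])
  moreover have "v (w c) = rst c" for c
    using MM[OF RV(2) V] u(2) rst_inv_op[OF M[OF R]] by (simp add: w_def v_def)
  ultimately have inv: "compress w (compress v x) = x" "compress v (compress w x) = x" for x
    by (simp_all add: compress_comp[OF w v] compress_comp[OF v w] compress_rst)
  have "w (\<theta> \<eta> x) = \<theta> \<xi> x" for x
    by (simp add: w_def M_def reconstruction rst_\<theta>[OF eta] u(4) \<theta>\<zeta> RV)
  then have "compress w \<eta> = \<xi>" by (rule compress_eta[OF \<xi>])
  moreover have "invertible_op act (compress w)" unfolding invertible_op_def
    using adj_End[OF compress_adj[OF w]] adj_End[OF compress_adj[OF v]] inv by (auto simp: fun_eq_iff)
  ultimately show ?thesis using compress_bicommutant[OF w] compress_adj[OF w] End_adj_iff by blast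
qed

section \<open>From operators in the bicommutant to frame vectors\<close>

lemma bessel_sum: "finite F \<Longrightarrow> (\<And>i. i \<in> F \<Longrightarrow> bessel (f i)) \<Longrightarrow> bessel (sum f F)"
  by (induction F rule: finite_induct) (simp_all add: bessel_zero bessel_add)

text \<open>The finite partial sums of the reconstruction formula are combinations of orbit points
  of \<open>\<eta>\<close>, and those are Bessel.\<close>

lemma bessel_dense: "closure {x. bessel x} = UNIV"
proof -
  have "x \<in> closure {x. bessel x}" for x
    unfolding closure_approachable
  proof (intro allI impI)
    fix e :: real assume e: "0 < e"
    have "((\<lambda>U. act (coef (\<theta> \<eta> x) U) (U \<eta>)) has_sum x) G"
      using synthesis(1)[OF eta, of "\<theta> \<eta> x"] by (simp add: reconstruction)
    from has_sum_finite_approximation[OF this half_gt_zero[OF e]]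
    obtain F where F: "finite F" "F \<subseteq> G" "dist (\<Sum>U\<in>F. act (coef (\<theta> \<eta> x) U) (U \<eta>)) x \<le> e/2"
      by blast
    moreover have "bessel (\<Sum>U\<in>F. act (coef (\<theta> \<eta> x) U) (U \<eta>))"
      by (rule bessel_sum[OF F(1)], rule bessel_act, rule bessel_group[OF eta subsetD[OF F(2)]])
    moreover have "dist (\<Sum>U\<in>F. act (coef (\<theta> \<eta> x) U) (U \<eta>)) x < e"
      using F(3) e by simp
    ultimately show "\<exists>y\<in>{x. bessel x}. dist y x < e" by (intro bexI) simp_all
  qed
  then show ?thesis by blast
qed

lemma frame_operator_eta:
  assumes x: "bessel x" shows "ip (syn x (\<theta> x \<eta>)) \<eta> = ip x x"
  by (simp add: parseval flip: \<theta>_swap_norm[OF x])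

text \<open>The frame operator of \<open>x\<close> commutes with \<open>A\<close> and with
  \<open>A'\<close>, so the left side is its form with \<open>A' A\<close> inserted, to which
  \<open>positive_commuting_le\<close> applies. The constant depends on \<open>A\<close> alone: a
  Bessel bound has to be uniform in \<open>x\<close>.\<close>

lemma frame_operator_bound:
  assumes A: "adj_pair ip ip A A'"
  shows "\<exists>s>0. \<forall>x \<zeta> \<omega>. bessel x \<longrightarrow> (\<forall>T. commuting_pair T T \<longrightarrow> (\<forall>y. A (T y) = T (A y))) \<longrightarrow> character \<omega> \<longrightarrow>
    Re (\<omega> (ip (syn x (\<theta> x (A \<zeta>))) (A \<zeta>))) \<le> s * Re (\<omega> (ip (syn x (\<theta> x \<zeta>)) \<zeta>))"
proof -
  have X: "adj_pair ip ip (\<lambda>x. A' (A x)) (\<lambda>x. A' (A x))" by (rule adj_pair_comp[OF A E.adj_sym[OF A]])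
  obtain b where b: "0 < b" "\<And>x. norm (A' (A x)) \<le> b * norm x" using adj_pair_bound[OF X] by blast
  \<comment> \<open>\<open>b + 1\<close> because \<open>positive_commuting_le\<close> asks for a
    constant strictly above the norm bound.\<close>
  have "Re (\<omega> (ip (syn x (\<theta> x (A \<zeta>))) (A \<zeta>))) \<le> (b + 1) * Re (\<omega> (ip (syn x (\<theta> x \<zeta>)) \<zeta>))"
    if x: "bessel x" and AT: "\<forall>T. commuting_pair T T \<longrightarrow> (\<forall>y. A (T y) = T (A y))" and c: "character \<omega>" for x \<zeta> \<omega>
  proof -
    define P where "P y = syn x (\<theta> x y)" for y
    have cP: "commuting_pair P P" unfolding P_def by (rule frame_operator_commuting[OF x])
    then have P: "adj_pair ip ip P P" by (simp add: commuting_pair_def)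
    have AP: "A (P y) = P (A y)" for y using AT cP by blast
    have A'P: "A' (P y) = P (A' y)" for y
      by (rule ip_ext) (simp add: adj_pairD[OF E.adj_sym[OF A]] adj_pairD[OF P] AP)
    have "ip (P (A \<zeta>)) (A \<zeta>) = ip (P (A' (A \<zeta>))) \<zeta>"
      by (simp add: adj_pairD[OF E.adj_sym[OF A]] flip: A'P)
    moreover have "Re (\<omega> (ip (P (A' (A \<zeta>))) \<zeta>)) \<le> (b + 1) * Re (\<omega> (ip (P \<zeta>) \<zeta>))"
    proof (rule positive_commuting_le[OF P _ X b(2) _ less_imp_le[OF b(1)] _ c])
      show "0 \<le> Re (\<phi> (ip (P y) y))" if "character \<phi>" for y \<phi>
        unfolding P_def frame_operator_ip[OF x] by (rule L2.char_ip_nonneg[OF that])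
      show "P (A' (A y)) = A' (A (P y))" for y by (simp only: AP A'P)
    qed simp
    ultimately show ?thesis by (simp add: P_def)
  qed
  moreover have "0 < b + 1" using b(1) by simp
  ultimately show ?thesis by blast
qed

lemma bicommutant_commutes:
  assumes A: "A \<in> commutant act (commutant act G)" and T: "commuting_pair T T'"
  shows "A (T y) = T (A y)"
proof -
  have "A \<circ> T = T \<circ> A" using A T commutant_iff unfolding commutant_def[of act "commutant act G"] by blast
  then show ?thesis by (metis comp_apply)
qed

lemma bicommutant_bessel:
  assumes A: "A \<in> commutant act (commutant act G)" and adj: "A \<in> End_adj act ip"
  shows "bessel (A \<eta>)"
proof -
  obtain A' where A': "adj_pair ip ip A A'" using adj End_adj_iff by blast
  obtain s where s: "0 < s" "\<And>x \<zeta> \<omega>. bessel x \<Longrightarrow> character \<omega> \<Longrightarrow>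
      Re (\<omega> (ip (syn x (\<theta> x (A \<zeta>))) (A \<zeta>))) \<le> s * Re (\<omega> (ip (syn x (\<theta> x \<zeta>)) \<zeta>))"
    using frame_operator_bound[OF A'] bicommutant_commutes[OF A] by blast
  show ?thesis
  proof (rule bessel_extend[OF bessel_dense])
    fix x assume x: "bessel x"
    show "norm (\<theta> (A \<eta>) x) \<le> sqrt s * norm x"
      by (rule norm_\<theta>_le) (use s x in \<open>auto simp: \<theta>_swap_norm[OF x] simp flip: frame_operator_eta\<close>)
  qed
qed

lemma closed_extend:
  assumes "closed {x. Q x}" "\<And>x. bessel x \<Longrightarrow> Q x" shows "Q x"
proof -
  have "closure {x. bessel x} \<subseteq> {x. Q x}" using assms by (intro closure_minimal) auto
  then show ?thesis using bessel_dense by auto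
qed

lemma continuous_\<theta>_inner:
  assumes \<xi>: "bessel \<xi>" shows "continuous_on UNIV (\<lambda>x. l2_inner (\<theta> \<xi> x) (\<theta> \<xi> x))"
proof -
  have "continuous_on UNIV (\<theta> \<xi>)" by (rule linear_continuous_on[OF HL.adj_bounded_linear[OF adj_\<theta>[OF \<xi>]]])
  then show ?thesis unfolding continuous_on_def by (intro ballI L2.tendsto_ip) auto
qed

lemma continuous_ip_self: "continuous_on UNIV (\<lambda>x. ip x x)"
  unfolding continuous_on_def by (intro ballI tendsto_ip tendsto_ident_at)

lemma unitary_Parseval:
  assumes A: "A \<in> commutant act (commutant act G)" and u: "unitary_op act ip A"
  shows "bessel (A \<eta>)" and "l2_inner (\<theta> (A \<eta>) x) (\<theta> (A \<eta>) x) = ip x x"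
proof -
  obtain A' where A': "adj_pair ip ip A A'" "\<And>x. A' (A x) = x" using u unitary_op_iff by blast
  then show b: "bessel (A \<eta>)" using bicommutant_bessel[OF A] End_adj_iff by blast
  show "l2_inner (\<theta> (A \<eta>) x) (\<theta> (A \<eta>) x) = ip x x"
  proof (rule closed_extend[where x = x])
    show "closed {x. l2_inner (\<theta> (A \<eta>) x) (\<theta> (A \<eta>) x) = ip x x}"
      by (rule closed_Collect_eq[OF continuous_\<theta>_inner[OF b] continuous_ip_self])
    fix x assume x: "bessel x"
    \<comment> \<open>Once \<open>A\<close> is moved in front of the frame operator, its left
      inverse \<open>A'\<close> turns the comparison of the two forms into an equality.\<close>
    have "l2_inner (\<theta> (A \<eta>) x) (\<theta> (A \<eta>) x) = ip (A (syn x (\<theta> x \<eta>))) (A \<eta>)"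
      by (simp add: \<theta>_swap_norm[OF x] bicommutant_commutes[OF A frame_operator_commuting[OF x]])
    also have "\<dots> = ip x x" by (simp add: adj_pairD[OF A'(1)] A'(2) frame_operator_eta[OF x])
    finally show "l2_inner (\<theta> (A \<eta>) x) (\<theta> (A \<eta>) x) = ip x x" .
  qed
qed

text \<open>The inverse commutes with whatever \<open>A\<close> commutes with.
  \<open>frame_operator_bound\<close> for the inverse at \<open>\<zeta> = A \<eta>\<close> bounds
  \<open>ip x x\<close> by \<open>s\<close> times the frame sum of \<open>A \<eta>\<close>, so
  \<open>1 / s\<close> is a lower frame bound.\<close>

lemma invertible_lower_bound:
  assumes A: "A \<in> commutant act (commutant act G)" and inv: "invertible_op act A" and b: "bessel (A \<eta>)"
  shows "\<exists>C>0. \<forall>x \<omega>. character \<omega> \<longrightarrow> C * Re (\<omega> (ip x x)) \<le> Re (\<omega> (l2_inner (\<theta> (A \<eta>) x) (\<theta> (A \<eta>) x)))"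
proof -
  obtain B where "B \<in> End_mod act" "A \<circ> B = id" "B \<circ> A = id" using inv by (auto simp: invertible_op_def)
  then obtain B' where B': "adj_pair ip ip B B'" and AB: "\<And>x. A (B x) = x" "\<And>x. B (A x) = x"
    using End_mod_adjointable by (metis comp_apply id_apply)
  have "\<forall>T. commuting_pair T T \<longrightarrow> (\<forall>y. B (T y) = T (B y))"
  proof (intro allI impI)
    fix T y assume T: "commuting_pair T T"
    have "T y = A (T (B y))" using bicommutant_commutes[OF A T, of "B y"] by (simp add: AB)
    then show "B (T y) = T (B y)" by (simp add: AB)
  qed
  then obtain s where s: "0 < s" "\<And>x \<zeta> \<omega>. bessel x \<Longrightarrow> character \<omega> \<Longrightarrow>
      Re (\<omega> (ip (syn x (\<theta> x (B \<zeta>))) (B \<zeta>))) \<le> s * Re (\<omega> (ip (syn x (\<theta> x \<zeta>)) \<zeta>))"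
    using frame_operator_bound[OF B'] by blast
  have "(1/s) * Re (\<omega> (ip x x)) \<le> Re (\<omega> (l2_inner (\<theta> (A \<eta>) x) (\<theta> (A \<eta>) x)))" if c: "character \<omega>" for x \<omega>
  proof (rule closed_extend[where x = x])
    have co: "continuous_on UNIV (\<lambda>x. Re (\<omega> (f x)))" if "continuous_on UNIV f" for f :: "'h \<Rightarrow> 'a"
      by (intro continuous_intros continuous_on_compose2[OF linear_continuous_on[OF bounded_linear_char[OF c]] that]) auto
    show "closed {x. (1/s) * Re (\<omega> (ip x x)) \<le> Re (\<omega> (l2_inner (\<theta> (A \<eta>) x) (\<theta> (A \<eta>) x)))}"
      by (intro closed_Collect_le continuous_on_mult_left co continuous_\<theta>_inner[OF b] continuous_ip_self)
    fix x assume x: "bessel x"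
    have "Re (\<omega> (ip x x)) \<le> s * Re (\<omega> (ip (syn x (\<theta> x (A \<eta>))) (A \<eta>)))"
      using s(2)[OF x c, of "A \<eta>"] by (simp add: AB frame_operator_eta[OF x])
    then show "(1/s) * Re (\<omega> (ip x x)) \<le> Re (\<omega> (l2_inner (\<theta> (A \<eta>) x) (\<theta> (A \<eta>) x)))"
      using s(1) by (simp add: \<theta>_swap_norm[OF x] pos_divide_le_eq mult.commute)
  qed
  then show ?thesis using s(1) by (intro exI[of _ "1/s"]) auto
qed

section \<open>The three equivalences\<close>

theorem Parseval_vectors:
  "complete_Parseval_frame_vector ip G \<xi> \<longleftrightarrow>
    (\<exists>A\<in>commutant act (commutant act G). unitary_op act ip A \<and> \<xi> = A \<eta>)"
  unfolding Parseval_iff[OF cnt] using Parseval_witness unitary_Parseval by blast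

theorem Bessel_vectors:
  "complete_Bessel_vector ip G \<xi> \<longleftrightarrow>
    (\<exists>A\<in>commutant act (commutant act G). A \<in> End_adj act ip \<and> \<xi> = A \<eta>)"
  unfolding complete_Bessel_iff[OF cnt] using Bessel_witness bicommutant_bessel by blast

theorem frame_vectors:
  "complete_frame_vector ip G \<xi> \<longleftrightarrow>
    (\<exists>A\<in>commutant act (commutant act G). invertible_op act A \<and> A \<in> End_adj act ip \<and> \<xi> = A \<eta>)"
proof
  assume "complete_frame_vector ip G \<xi>"
  then obtain C D where CD: "0 < C" "0 < D" and f: "frame_with_bounds ip C D G (\<lambda>U. U \<xi>)"
    by (auto simp: complete_frame_vector_def)
  have "bessel \<xi>" by (rule frame_bessel[OF _ f]) (use CD in simp)
  then show "\<exists>A\<in>commutant act (commutant act G). invertible_op act A \<and> A \<in> End_adj act ip \<and> \<xi> = A \<eta>"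
    using CD f unfolding frame_with_bounds_iff by (intro frame_witness[of \<xi> C D]) blast+
next
  assume "\<exists>A\<in>commutant act (commutant act G). invertible_op act A \<and> A \<in> End_adj act ip \<and> \<xi> = A \<eta>"
  then obtain A where A: "A \<in> commutant act (commutant act G)" "invertible_op act A" "A \<in> End_adj act ip" "\<xi> = A \<eta>"
    by blast
  have b: "bessel \<xi>" using bicommutant_bessel[OF A(1,3)] A(4) by simp
  obtain C where C: "0 < C" "\<And>x \<omega>. character \<omega> \<Longrightarrow> C * Re (\<omega> (ip x x)) \<le> Re (\<omega> (l2_inner (\<theta> \<xi> x) (\<theta> \<xi> x)))"
    using invertible_lower_bound[OF A(1,2)] b A(4) by blast
  obtain D where D: "0 < D" "bessel_with_bound ip D G (\<lambda>U. U \<xi>)"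
    using b complete_Bessel_iff[OF cnt] by (auto simp: complete_Bessel_vector_def)
  have "frame_with_bounds ip C D G (\<lambda>U. U \<xi>)"
    using D(2) C(2) unfolding frame_with_bounds_iff bessel_with_bound_iff by blast
  then show "complete_frame_vector ip G \<xi>" using C(1) D(1) by (auto simp: complete_frame_vector_def)
qed

end

theorem theorem3p2:
  fixes act :: "'a::comm_unital_cstar_algebra \<Rightarrow> 'h::complex_banach \<Rightarrow> 'h"
    and ip :: "'h \<Rightarrow> 'h \<Rightarrow> 'a"
    and G :: "('h \<Rightarrow> 'h) set"
    and \<eta> \<xi> :: 'h
  assumes "wstar_algebra TYPE('a) TYPE('x::complex_banach)"
    and "hilbert_module act ip"
    and "finitely_generated act \<or> countably_generated act"
    and "unitary_group act ip G"
    and "l2_self_dual TYPE('a) G"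
    and "complete_Parseval_frame_vector ip G \<eta>"
  shows "(complete_Parseval_frame_vector ip G \<xi> \<longleftrightarrow>
            (\<exists>A \<in> commutant act (commutant act G). unitary_op act ip A \<and> \<xi> = A \<eta>)) \<and>
         (complete_frame_vector ip G \<xi> \<longleftrightarrow>
            (\<exists>A \<in> commutant act (commutant act G).
               invertible_op act A \<and> A \<in> End_adj act ip \<and> \<xi> = A \<eta>)) \<and>
         (complete_Bessel_vector ip G \<xi> \<longleftrightarrow>
            (\<exists>A \<in> commutant act (commutant act G). A \<in> End_adj act ip \<and> \<xi> = A \<eta>))"
proof -
  obtain \<Phi> :: "'a \<Rightarrow> ('x \<Rightarrow>\<^sub>L complex)" where \<Phi>: "dual_iso \<Phi>"
    using assms(1) unfolding wstar_algebra_def is_dual_of_def dual_iso_def by blast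
  interpret hilbert_module act ip by fact
  interpret comm_hilbert_module act ip ..
  interpret unitary_module act ip G by unfold_locales fact
  \<comment> \<open>Frames are indexed by countable sets, so the hypothesis on \<open>\<eta>\<close>
    contains the countability of \<open>G\<close>.\<close>
  have cnt: "countable G"
    using assms(6) by (simp add: complete_Parseval_frame_vector_def frame_with_bounds_def)
  interpret parseval_module act ip G \<eta> \<Phi>
    using \<Phi> assms(5,6) cnt by unfold_locales (simp_all add: Parseval_iff[OF cnt])
  show ?thesis using Parseval_vectors frame_vectors Bessel_vectors by blast
qed

end
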